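(* Let $R$ be a finite non-abelian differentiably simple Lie conformal superalgebra. Then there exist a simple Lie conformal superalgebra $S$ and an integer $n\ge 0$ such that $R\simeq S\otimes\wedge(n)$ as Lie conformal superalgebras.
   Context: Everything is over $\mathbb{C}$; $p(a)\in\mathbb{Z}/2\mathbb{Z}$ denotes parity. A Lie conformal superalgebra is a $\mathbb{Z}/2\mathbb{Z}$-graded $\mathbb{C}[\partial]$-module $R$ ($\partial$ even) with a parity-preserving $\mathbb{C}$-linear map $R\otimes R\to\mathbb{C}[\lambda]\otimes R$, $a\otimes b\mapsto[a_\lambda b]=\sum_{n\ge0}\frac{\lambda^n}{n!}a_{(n)}b$, satisfying: $[\partial a_\lambda b]=-\lambda[a_\lambda b]$, $[a_\lambda\partial b]=(\partial+\lambda)[a_\lambda b]$; $[b_\lambda a]=-(-1)^{p(a)p(b)}[a_{-\lambda-\partial}b]$; $[a_\lambda[b_\mu c]]=[[a_\lambda b]_{\lambda+\mu}c]+(-1)^{p(a)p(b)}[b_\mu[a_\lambda c]]$. $R$ is finite if it is finitely generated over $\mathbb{C}[\partial]$; it is abelian if $[R_\lambda R]=0$. An ideal is a ($\mathbb{Z}/2\mathbb{Z}$-graded) $\mathbb{C}[\partial]$-submodule $I$ with $a_{(n)}b\in I$ for all $a\in R$, $b\in I$, $n\ge0$. $R$ is simple if it is non-abelian and has no ideals other than $0$ and $R$. A conformal derivation of $R$ is a $\mathbb{C}$-linear map $\phi_\lambda:R\to\mathbb{C}[\lambda]\otimes R$ with $\phi_\lambda(\partial v)=(\partial+\lambda)\phi_\lambda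 v$ and $\phi_\lambda[x_\mu y]=[(\phi_\lambda x)_{\lambda+\mu}y]+(-1)^{p(x)p(\phi)}[x_\mu(\phi_\lambda y)]$. For a set $D$ of conformal derivations, an ideal $I$ is $D$-stable if $\phi_\lambda I\subset\mathbb{C}[\lambda]\otimes I$ for all $\phi\in D$. $R$ is differentiably simple if for some set $D$ of conformal derivations it has no $D$-stable ideals other than $0$ and $R$. $\wedge(n)$ is the Grassmann superalgebra on $n$ odd generators. For a Lie conformal superalgebra $S$ and a commutative associative superalgebra $B$, $S\otimes B$ is the Lie conformal superalgebra with $\partial(r\otimes b)=(\partial r)\otimes b$ and $[(r\otimes b)_\lambda(r'\otimes b')]=(-1)^{p(b)p(r')}[r_\lambda r']\otimes bb'$. *)

theory Defs
  imports Complex_Main "HOL-Library.Z2" "HOL-Library.Function_Algebras"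
begin

section \<open>Complex superspaces\<close>

text \<open>Parities live in the two-element field \<^typ>\<open>bit\<close>. A superspace is a subset of an ambient
  complex vector space; only its addition comes from a type class.\<close>

record 'a superspace =
  smul :: "complex \<Rightarrow> 'a \<Rightarrow> 'a"
  carrier :: "'a set"
  gr :: "bit \<Rightarrow> 'a set"

locale super_space =
  fixes V :: "('a::ab_group_add, 'm) superspace_scheme"
  assumes vector_space_smul: "vector_space (smul V)"
    and subspace_gr: "module.subspace (smul V) (gr V p)"
    and carrier_eq: "carrier V = {x + y |x y. x \<in> gr V 0 \<and> y \<in> gr V 1}"
    and gr_disjoint: "gr V 0 \<inter> gr V 1 = {0}"

definition koszul :: "bit \<Rightarrow> bit \<Rightarrow> complex" where
  "koszul p q = (if p = 1 \<and> q = 1 then - 1 else 1)"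

definition proj :: "('a::ab_group_add, 'm) superspace_scheme \<Rightarrow> bit \<Rightarrow> 'a \<Rightarrow> 'a" where
  "proj V p x = (THE y. y \<in> gr V p \<and> x - y \<in> gr V (p + 1))"

definition linear_map ::
  "('a::ab_group_add, 'm) superspace_scheme \<Rightarrow> ('b::ab_group_add, 'k) superspace_scheme \<Rightarrow> ('a \<Rightarrow> 'b) \<Rightarrow> bool" where
  "linear_map V W f \<longleftrightarrow>
     (\<forall>x\<in>carrier V. f x \<in> carrier W) \<and>
     (\<forall>x\<in>carrier V. \<forall>y\<in>carrier V. f (x + y) = f x + f y) \<and>
     (\<forall>c. \<forall>x\<in>carrier V. f (smul V c x) = smul W c (f x))"

text \<open>An element \<open>\<Sum>n. (l^n / n!) a\<^sub>n\<close> of \<open>\<complex>[l] \<otimes> V\<close> is given by its finitely supported sequence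
  of divided-power coefficients \<open>a\<close>. As \<open>\<complex>\<close> is infinite, such a polynomial is determined by its values
  at complex numbers \<open>l\<close>, so identities in \<open>\<complex>[l] \<otimes> V\<close> and \<open>\<complex>[l,m] \<otimes> V\<close> are stated as identities for
  all complex \<open>l\<close>, \<open>m\<close>.\<close>

definition gen_poly :: "('a::ab_group_add, 'm) superspace_scheme \<Rightarrow> (nat \<Rightarrow> 'a) \<Rightarrow> complex \<Rightarrow> 'a" where
  "gen_poly V a l = (\<Sum>n | a n \<noteq> 0. smul V (l ^ n / fact n) (a n))"

text \<open>Substitution of an operator \<open>T\<close> for the variable, the powers of \<open>T\<close> acting on the coefficients.\<close>

definition gen_poly_op ::
  "('a::ab_group_add, 'm) superspace_scheme \<Rightarrow> (nat \<Rightarrow> 'a) \<Rightarrow> ('a \<Rightarrow> 'a) \<Rightarrow> 'a" where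
  "gen_poly_op V a T = (\<Sum>n | a n \<noteq> 0. smul V (1 / fact n) ((T ^^ n) (a n)))"


section \<open>Lie conformal superalgebras\<close>

record 'a lcs = "'a superspace" +
  der :: "'a \<Rightarrow> 'a"
  nprod :: "nat \<Rightarrow> 'a \<Rightarrow> 'a \<Rightarrow> 'a"

definition bracket :: "('a::ab_group_add, 'm) lcs_scheme \<Rightarrow> complex \<Rightarrow> 'a \<Rightarrow> 'a \<Rightarrow> 'a" where
  "bracket R l a b = gen_poly R (\<lambda>n. nprod R n a b) l"

locale lie_conformal_superalgebra = super_space R
  for R :: "('a::ab_group_add, 'm) lcs_scheme" +
  assumes der_linear: "linear_map R R (der R)"
    and der_even: "x \<in> gr R p \<Longrightarrow> der R x \<in> gr R p"
    and nprod_linear_left: "b \<in> carrier R \<Longrightarrow> linear_map R R (\<lambda>a. nprod R n a b)"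
    and nprod_linear_right: "a \<in> carrier R \<Longrightarrow> linear_map R R (\<lambda>b. nprod R n a b)"
    and nprod_finite: "a \<in> carrier R \<Longrightarrow> b \<in> carrier R \<Longrightarrow> finite {n. nprod R n a b \<noteq> 0}"
    and nprod_parity: "a \<in> gr R p \<Longrightarrow> b \<in> gr R q \<Longrightarrow> nprod R n a b \<in> gr R (p + q)"
    and sesquilinear_left: "a \<in> carrier R \<Longrightarrow> b \<in> carrier R \<Longrightarrow>
      bracket R l (der R a) b = - smul R l (bracket R l a b)"
    and sesquilinear_right: "a \<in> carrier R \<Longrightarrow> b \<in> carrier R \<Longrightarrow>
      bracket R l a (der R b) = der R (bracket R l a b) + smul R l (bracket R l a b)"
    and skew: "a \<in> gr R p \<Longrightarrow> b \<in> gr R q \<Longrightarrow>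
      bracket R l b a =
        - smul R (koszul p q) (gen_poly_op R (\<lambda>n. nprod R n a b) (\<lambda>x. - smul R l x - der R x))"
    and jacobi: "a \<in> gr R p \<Longrightarrow> b \<in> gr R q \<Longrightarrow> c \<in> carrier R \<Longrightarrow>
      bracket R l a (bracket R m b c) =
        bracket R (l + m) (bracket R l a b) c + smul R (koszul p q) (bracket R m b (bracket R l a c))"

text \<open>Finite generation as a \<open>\<complex>[\<partial>]\<close>-module: the \<open>\<complex>[\<partial>]\<close>-span of \<open>F\<close> is the \<open>\<complex>\<close>-span of all \<open>\<partial>\<^sup>k f\<close>.\<close>

definition finite_lcs :: "('a::ab_group_add, 'm) lcs_scheme \<Rightarrow> bool" where
  "finite_lcs R \<longleftrightarrow> (\<exists>F. finite F \<and> F \<subseteq> carrier R \<and>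
     carrier R = module.span (smul R) {(der R ^^ k) f |k f. f \<in> F})"

definition abelian :: "('a::ab_group_add, 'm) lcs_scheme \<Rightarrow> bool" where
  "abelian R \<longleftrightarrow> (\<forall>a\<in>carrier R. \<forall>b\<in>carrier R. \<forall>n. nprod R n a b = 0)"

definition lcs_ideal :: "('a::ab_group_add, 'm) lcs_scheme \<Rightarrow> 'a set \<Rightarrow> bool" where
  "lcs_ideal R I \<longleftrightarrow>
     module.subspace (smul R) I \<and> I \<subseteq> carrier R \<and>
     (\<forall>x\<in>I. \<exists>y\<in>I \<inter> gr R 0. \<exists>z\<in>I \<inter> gr R 1. x = y + z) \<and>
     (\<forall>x\<in>I. der R x \<in> I) \<and>
     (\<forall>a\<in>carrier R. \<forall>b\<in>I. \<forall>n. nprod R n a b \<in> I)"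

definition simple_lcs :: "('a::ab_group_add, 'm) lcs_scheme \<Rightarrow> bool" where
  "simple_lcs R \<longleftrightarrow> \<not> abelian R \<and> (\<forall>I. lcs_ideal R I \<longrightarrow> I = {0} \<or> I = carrier R)"

text \<open>A conformal derivation of parity \<open>s\<close>: \<open>\<phi> n x\<close> is the coefficient of \<open>l^n / n!\<close> in \<open>\<phi>\<^sub>l x\<close>.\<close>

definition conformal_derivation_of_parity ::
  "('a::ab_group_add, 'm) lcs_scheme \<Rightarrow> bit \<Rightarrow> (nat \<Rightarrow> 'a \<Rightarrow> 'a) \<Rightarrow> bool" where
  "conformal_derivation_of_parity R s \<phi> \<longleftrightarrow>
     (\<forall>n. linear_map R R (\<phi> n)) \<and>
     (\<forall>x\<in>carrier R. finite {n. \<phi> n x \<noteq> 0}) \<and>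
     (\<forall>n p. \<forall>x\<in>gr R p. \<phi> n x \<in> gr R (s + p)) \<and>
     (\<forall>l. \<forall>v\<in>carrier R. gen_poly R (\<lambda>n. \<phi> n (der R v)) l =
        der R (gen_poly R (\<lambda>n. \<phi> n v) l) + smul R l (gen_poly R (\<lambda>n. \<phi> n v) l)) \<and>
     (\<forall>l m p. \<forall>x\<in>gr R p. \<forall>y\<in>carrier R.
        gen_poly R (\<lambda>n. \<phi> n (bracket R m x y)) l =
          bracket R (l + m) (gen_poly R (\<lambda>n. \<phi> n x) l) y
          + smul R (koszul p s) (bracket R m x (gen_poly R (\<lambda>n. \<phi> n y) l)))"

definition conformal_derivation :: "('a::ab_group_add, 'm) lcs_scheme \<Rightarrow> (nat \<Rightarrow> 'a \<Rightarrow> 'a) \<Rightarrow> bool" where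
  "conformal_derivation R \<phi> \<longleftrightarrow> (\<exists>s. conformal_derivation_of_parity R s \<phi>)"

definition stable_under :: "(nat \<Rightarrow> 'a \<Rightarrow> 'a) set \<Rightarrow> 'a set \<Rightarrow> bool" where
  "stable_under D I \<longleftrightarrow> (\<forall>\<phi>\<in>D. \<forall>x\<in>I. \<forall>n. \<phi> n x \<in> I)"

definition differentiably_simple :: "('a::ab_group_add, 'm) lcs_scheme \<Rightarrow> bool" where
  "differentiably_simple R \<longleftrightarrow>
     (\<exists>D. (\<forall>\<phi>\<in>D. conformal_derivation R \<phi>) \<and>
          (\<forall>I. lcs_ideal R I \<and> stable_under D I \<longrightarrow> I = {0} \<or> I = carrier R))"

definition lcs_iso ::
  "('a::ab_group_add, 'm) lcs_scheme \<Rightarrow> ('b::ab_group_add, 'k) lcs_scheme \<Rightarrow> ('a \<Rightarrow> 'b) \<Rightarrow> bool" where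
  "lcs_iso R R' f \<longleftrightarrow>
     linear_map R R' f \<and> bij_betw f (carrier R) (carrier R') \<and>
     (\<forall>p. \<forall>x\<in>gr R p. f x \<in> gr R' p) \<and>
     (\<forall>x\<in>carrier R. f (der R x) = der R' (f x)) \<and>
     (\<forall>n. \<forall>x\<in>carrier R. \<forall>y\<in>carrier R. f (nprod R n x y) = nprod R' n (f x) (f y))"

definition lcs_isomorphic ::
  "('a::ab_group_add, 'm) lcs_scheme \<Rightarrow> ('b::ab_group_add, 'k) lcs_scheme \<Rightarrow> bool" where
  "lcs_isomorphic R R' \<longleftrightarrow> (\<exists>f. lcs_iso R R' f)"


section \<open>Commutative associative superalgebras\<close>

record 'b superalg = "'b superspace" +
  mul :: "'b \<Rightarrow> 'b \<Rightarrow> 'b"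
  unit :: 'b

locale comm_superalgebra = super_space B
  for B :: "('b::ab_group_add, 'm) superalg_scheme" +
  assumes mul_linear_left: "y \<in> carrier B \<Longrightarrow> linear_map B B (\<lambda>x. mul B x y)"
    and mul_linear_right: "x \<in> carrier B \<Longrightarrow> linear_map B B (\<lambda>y. mul B x y)"
    and mul_parity: "x \<in> gr B p \<Longrightarrow> y \<in> gr B q \<Longrightarrow> mul B x y \<in> gr B (p + q)"
    and mul_assoc: "x \<in> carrier B \<Longrightarrow> y \<in> carrier B \<Longrightarrow> z \<in> carrier B \<Longrightarrow>
      mul B (mul B x y) z = mul B x (mul B y z)"
    and mul_comm: "x \<in> gr B p \<Longrightarrow> y \<in> gr B q \<Longrightarrow> mul B x y = smul B (koszul p q) (mul B y x)"
    and unit_gr: "unit B \<in> gr B 0"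
    and mul_unit: "x \<in> carrier B \<Longrightarrow> mul B (unit B) x = x"

text \<open>The Grassmann superalgebra on odd generators \<open>\<xi>\<^sub>0, \<dots>, \<xi>\<^sub>n\<^sub>-\<^sub>1\<close>: the coordinate \<open>f I\<close> is the
  coefficient of the monomial \<open>\<xi>\<^sub>I\<close>, the product of the \<open>\<xi>\<^sub>i\<close> with \<open>i \<in> I\<close> in increasing order. For
  disjoint \<open>I\<close> and \<open>J\<close>, \<open>\<xi>\<^sub>I \<xi>\<^sub>J = grass_sign I J \<xi>\<^sub>I\<^sub>\<union>\<^sub>J\<close>, the sign of the sorting permutation.\<close>

definition grass_sign :: "nat set \<Rightarrow> nat set \<Rightarrow> complex" where
  "grass_sign I J = (- 1) ^ card {(i, j). i \<in> I \<and> j \<in> J \<and> j < i}"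

definition grassmann :: "nat \<Rightarrow> (nat set \<Rightarrow> complex) superalg" where
  "grassmann n = \<lparr>
     smul = (\<lambda>c f I. c * f I),
     carrier = {f. \<forall>I. f I \<noteq> 0 \<longrightarrow> I \<subseteq> {..<n}},
     gr = (\<lambda>p. {f. \<forall>I. f I \<noteq> 0 \<longrightarrow> I \<subseteq> {..<n} \<and> of_nat (card I) = p}),
     mul = (\<lambda>f g K. \<Sum>I\<in>Pow K. grass_sign I (K - I) * f I * g (K - I)),
     unit = (\<lambda>I. if I = {} then 1 else 0)\<rparr>"


section \<open>Tensor products\<close>

text \<open>The tensor product over \<open>\<complex>\<close> is realised inside the dual of the space of bilinear forms: the pure
  tensor of \<open>r\<close> and \<open>b\<close> is evaluation of bilinear forms at \<open>(r, b)\<close>. Since linear forms on a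
  vector space separate points, this is the usual tensor product: a sum of pure tensors
  vanishes as soon as all bilinear forms vanish on it.\<close>

definition bilinear_form ::
  "('a::ab_group_add, 'm) superspace_scheme \<Rightarrow> ('b::ab_group_add, 'k) superspace_scheme \<Rightarrow>
   ('a \<Rightarrow> 'b \<Rightarrow> complex) \<Rightarrow> bool" where
  "bilinear_form V W \<beta> \<longleftrightarrow>
     (\<forall>x\<in>carrier V. \<forall>x'\<in>carrier V. \<forall>y\<in>carrier W. \<beta> (x + x') y = \<beta> x y + \<beta> x' y) \<and>
     (\<forall>x\<in>carrier V. \<forall>y\<in>carrier W. \<forall>y'\<in>carrier W. \<beta> x (y + y') = \<beta> x y + \<beta> x y') \<and>
     (\<forall>c. \<forall>x\<in>carrier V. \<forall>y\<in>carrier W. \<beta> (smul V c x) y = c * \<beta> x y \<and> \<beta> x (smul W c y) = c * \<beta> x y)"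

type_synonym ('a, 'b) tens = "('a \<Rightarrow> 'b \<Rightarrow> complex) \<Rightarrow> complex"

definition tens_smul :: "complex \<Rightarrow> ('a, 'b) tens \<Rightarrow> ('a, 'b) tens" where
  "tens_smul c t = (\<lambda>\<beta>. c * t \<beta>)"

definition pure_tensor ::
  "('a::ab_group_add, 'm) superspace_scheme \<Rightarrow> ('b::ab_group_add, 'k) superspace_scheme \<Rightarrow>
   'a \<Rightarrow> 'b \<Rightarrow> ('a, 'b) tens" where
  "pure_tensor V W r b = (\<lambda>\<beta>. if bilinear_form V W \<beta> then \<beta> r b else 0)"

text \<open>The Lie conformal superalgebra \<open>S \<otimes> B\<close>. The two structure maps are the linear (bilinear)
  extensions of their values on pure tensors given in \<open>tensor_der_pure\<close> and \<open>tensor_nprod_pure\<close>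
  below; for instance \<open>t (\<lambda>r b. \<beta> (\<partial>r) b)\<close> is the value at \<open>\<beta>\<close> of the image of \<open>t\<close> under \<open>\<partial> \<otimes> id\<close>.\<close>

definition tensor_lcs ::
  "('a::ab_group_add) lcs \<Rightarrow> ('b::ab_group_add) superalg \<Rightarrow> ('a, 'b) tens lcs" where
  "tensor_lcs S B = \<lparr>
     smul = tens_smul,
     carrier = module.span tens_smul {pure_tensor S B r b |r b. r \<in> carrier S \<and> b \<in> carrier B},
     gr = (\<lambda>s. module.span tens_smul
       {pure_tensor S B r b |r b p q. r \<in> gr S p \<and> b \<in> gr B q \<and> p + q = s}),
     der = (\<lambda>t \<beta>. if bilinear_form S B \<beta> then t (\<lambda>r b. \<beta> (der S r) b) else 0),
     nprod = (\<lambda>n t u \<beta>. if bilinear_form S B \<beta> then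
       t (\<lambda>r b. u (\<lambda>r' b'. \<Sum>p\<in>UNIV. \<Sum>q\<in>UNIV.
         koszul p q * \<beta> (nprod S n r (proj S q r')) (mul B (proj B p b) b'))) else 0)\<rparr>"


section \<open>Basic facts\<close>

lemma bit_cases: "(p::bit) = 0 \<or> p = 1"
  by (cases p) auto

context super_space begin

lemma gr_add: "x \<in> gr V p \<Longrightarrow> y \<in> gr V p \<Longrightarrow> x + y \<in> gr V p"
  and gr_smul: "x \<in> gr V p \<Longrightarrow> smul V c x \<in> gr V p"
  and gr_zero: "0 \<in> gr V p"
  and gr_diff: "x \<in> gr V p \<Longrightarrow> y \<in> gr V p \<Longrightarrow> x - y \<in> gr V p"
proof -
  interpret vector_space "smul V" by (rule vector_space_smul)
  show "x \<in> gr V p \<Longrightarrow> y \<in> gr V p \<Longrightarrow> x + y \<in> gr V p" by (rule subspace_add[OF subspace_gr])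
  show "x \<in> gr V p \<Longrightarrow> smul V c x \<in> gr V p" by (rule subspace_scale[OF subspace_gr])
  show "0 \<in> gr V p" by (rule subspace_0[OF subspace_gr])
  show "x \<in> gr V p \<Longrightarrow> y \<in> gr V p \<Longrightarrow> x - y \<in> gr V p" by (rule subspace_diff[OF subspace_gr])
qed

lemma proj_eq:
  assumes "y \<in> gr V p" "z \<in> gr V (p + 1)"
  shows "proj V p (y + z) = y"
  unfolding proj_def
proof (rule the_equality)
  show "y \<in> gr V p \<and> y + z - y \<in> gr V (p + 1)" using assms by simp
  fix w assume w: "w \<in> gr V p \<and> y + z - w \<in> gr V (p + 1)"
  have "y - w \<in> gr V p" using assms w gr_diff by blast
  moreover have "y - w \<in> gr V (p + 1)"
    using gr_diff[of "y + z - w" "p + 1" z] assms w by (simp add: algebra_simps)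
  ultimately have "y - w \<in> gr V 0 \<inter> gr V 1" using bit_cases[of p] by auto
  then show "w = y" using gr_disjoint by simp
qed

lemma carrier_split:
  assumes "x \<in> carrier V"
  obtains y z where "x = y + z" "y \<in> gr V p" "z \<in> gr V (p + 1)"
proof -
  obtain y z where yz: "x = y + z" "y \<in> gr V 0" "z \<in> gr V 1"
    using assms carrier_eq by auto
  show thesis
    using bit_cases[of p] that[of y z] that[of z y] yz by (auto simp: add.commute)
qed

lemma gr_carrier: "x \<in> gr V p \<Longrightarrow> x \<in> carrier V"
  using bit_cases[of p] gr_zero unfolding carrier_eq
  by (metis (mono_tags, lifting) add_0 add_0_right mem_Collect_eq)

lemma smul_add: "smul V c (x + y) = smul V c x + smul V c y"
proof -
  interpret vector_space "smul V" by (rule vector_space_smul)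
  show ?thesis by (rule scale_right_distrib)
qed

lemma carrier_add: "x \<in> carrier V \<Longrightarrow> y \<in> carrier V \<Longrightarrow> x + y \<in> carrier V"
proof -
  assume "x \<in> carrier V" "y \<in> carrier V"
  then obtain x0 x1 y0 y1 where "x = x0 + x1" "y = y0 + y1" "x0 \<in> gr V 0" "x1 \<in> gr V 1"
     "y0 \<in> gr V 0" "y1 \<in> gr V 1" unfolding carrier_eq by auto
  then show ?thesis unfolding carrier_eq
    by (intro CollectI exI[of _ "x0 + y0"] exI[of _ "x1 + y1"]) (auto intro: gr_add simp: algebra_simps)
qed

lemma carrier_smul: "x \<in> carrier V \<Longrightarrow> smul V c x \<in> carrier V"
  using smul_add gr_smul unfolding carrier_eq by blast

lemma proj_gr: "x \<in> gr V q \<Longrightarrow> proj V p x = (if p = q then x else 0)"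
proof (cases "p = q")
  case True
  assume "x \<in> gr V q"
  then show ?thesis using True proj_eq[of x p 0] gr_zero by simp
next
  case False
  assume x: "x \<in> gr V q"
  have "q = p + 1" using False bit_cases[of p] bit_cases[of q] by auto
  then show ?thesis using False x proj_eq[of 0 p x] gr_zero by simp
qed

lemma proj_carrier: "x \<in> carrier V \<Longrightarrow> proj V p x \<in> carrier V"
  by (metis carrier_split proj_eq gr_carrier)

lemma proj_add:
  assumes "x \<in> carrier V" "y \<in> carrier V"
  shows "proj V p (x + y) = proj V p x + proj V p y"
proof -
  obtain a b where 1: "x = a + b" "a \<in> gr V p" "b \<in> gr V (p + 1)" by (rule carrier_split[OF assms(1)])
  obtain c d where 2: "y = c + d" "c \<in> gr V p" "d \<in> gr V (p + 1)" by (rule carrier_split[OF assms(2)])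
  have "x + y = (a + c) + (b + d)" using 1 2 by (simp add: algebra_simps)
  then have "proj V p (x + y) = a + c"
    using proj_eq[OF gr_add[OF 1(2) 2(2)] gr_add[OF 1(3) 2(3)]] by simp
  moreover have "proj V p x = a" "proj V p y = c"
    using proj_eq 1 2 by auto
  ultimately show ?thesis by simp
qed

lemma proj_smul:
  assumes "x \<in> carrier V"
  shows "proj V p (smul V c x) = smul V c (proj V p x)"
proof -
  obtain a b where 1: "x = a + b" "a \<in> gr V p" "b \<in> gr V (p + 1)" by (rule carrier_split[OF assms(1)])
  then show ?thesis by (simp add: smul_add proj_eq gr_smul)
qed

end

lemma UNIV_bit: "(UNIV :: bit set) = {0, 1}"
  using bit_cases by auto

lemma vector_space_tens: "vector_space tens_smul"
  by unfold_locales (auto simp: tens_smul_def fun_eq_iff algebra_simps)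

lemma pure_tensor_bilinear:
  assumes "super_space V" "super_space W" 
    "x \<in> carrier V" "x' \<in> carrier V" "y \<in> carrier W" "y' \<in> carrier W"
  shows "pure_tensor V W (x + x') y = pure_tensor V W x y + pure_tensor V W x' y"
    "pure_tensor V W x (y + y') = pure_tensor V W x y + pure_tensor V W x y'"
    "pure_tensor V W (smul V c x) y = tens_smul c (pure_tensor V W x y)"
    "pure_tensor V W x (smul W c y) = tens_smul c (pure_tensor V W x y)"
  using assms by (auto simp: pure_tensor_def tens_smul_def bilinear_form_def fun_eq_iff)

lemma tensor_der_pure:
  assumes "lie_conformal_superalgebra S" "comm_superalgebra B"
    and "r \<in> carrier S" "b \<in> carrier B"
  shows "der (tensor_lcs S B) (pure_tensor S B r b) = pure_tensor S B (der S r) b"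
proof -
  interpret S: lie_conformal_superalgebra S by fact
  have "bilinear_form S B (\<lambda>r. \<beta> (der S r))" if "bilinear_form S B \<beta>" for \<beta>
    using that S.der_linear unfolding bilinear_form_def linear_map_def by simp
  then show ?thesis by (auto simp: tensor_lcs_def pure_tensor_def fun_eq_iff)
qed

lemma bilinear_form_cong:
  assumes "super_space V" "super_space W" "bilinear_form V W \<beta>"
    and "\<And>x y. x \<in> carrier V \<Longrightarrow> y \<in> carrier W \<Longrightarrow> \<gamma> x y = \<beta> x y"
  shows "bilinear_form V W \<gamma>"
proof -
  interpret V: super_space V by fact
  interpret W: super_space W by fact
  show ?thesis
    using assms(3) unfolding bilinear_form_def
    by (simp add: assms(4) V.carrier_add V.carrier_smul W.carrier_add W.carrier_smul)
qed

lemma tensor_nprod_pure: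
  assumes "lie_conformal_superalgebra S" "comm_superalgebra B"
    and r: "r \<in> carrier S" and b: "b \<in> gr B p" and r': "r' \<in> gr S q" and b': "b' \<in> carrier B"
  shows "nprod (tensor_lcs S B) n (pure_tensor S B r b) (pure_tensor S B r' b') =
    tens_smul (koszul p q) (pure_tensor S B (nprod S n r r') (mul B b b'))"
proof
  fix \<beta>
  interpret S: lie_conformal_superalgebra S by fact
  interpret B: comm_superalgebra B by fact
  define G where "G = (\<lambda>r b r' b'. \<Sum>p\<in>UNIV. \<Sum>q\<in>UNIV.
         koszul p q * \<beta> (nprod S n r (proj S q r')) (mul B (proj B p b) b'))"
  have b0: "b \<in> carrier B" and r0: "r' \<in> carrier S" using b r' B.gr_carrier S.gr_carrier by auto
  show "nprod (tensor_lcs S B) n (pure_tensor S B r b) (pure_tensor S B r' b') \<beta> =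
    tens_smul (koszul p q) (pure_tensor S B (nprod S n r r') (mul B b b')) \<beta>"
  proof (cases "bilinear_form S B \<beta>")
    case False
    then show ?thesis by (simp add: tensor_lcs_def tens_smul_def pure_tensor_def)
  next
    case True
    note S' = S.proj_carrier S.proj_add S.proj_smul S.carrier_add S.carrier_smul
    note B' = B.proj_carrier B.proj_add B.proj_smul B.carrier_add B.carrier_smul
    have Sl: "nprod S n x y \<in> carrier S"
      "nprod S n (x + x') y = nprod S n x y + nprod S n x' y"
      "nprod S n (smul S c x) y = smul S c (nprod S n x y)"
      "nprod S n x (y + y') = nprod S n x y + nprod S n x y'"
      "nprod S n x (smul S c y) = smul S c (nprod S n x y)"
      if "x \<in> carrier S" "x' \<in> carrier S" "y \<in> carrier S" "y' \<in> carrier S" for x x' y y' c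
      using that S.nprod_linear_left[of y n] S.nprod_linear_right[of x n] by (auto simp: linear_map_def)
    have Bl: "mul B x y \<in> carrier B"
      "mul B (x + x') y = mul B x y + mul B x' y"
      "mul B (smul B c x) y = smul B c (mul B x y)"
      "mul B x (y + y') = mul B x y + mul B x y'"
      "mul B x (smul B c y) = smul B c (mul B x y)"
      if "x \<in> carrier B" "x' \<in> carrier B" "y \<in> carrier B" "y' \<in> carrier B" for x x' y y' c
      using that B.mul_linear_left[of y] B.mul_linear_right[of x] by (auto simp: linear_map_def)
    have bl: "\<beta> (x + x') y = \<beta> x y + \<beta> x' y" "\<beta> x (y + y') = \<beta> x y + \<beta> x y'"
      "\<beta> (smul S c x) y = c * \<beta> x y" "\<beta> x (smul B c y) = c * \<beta> x y"
      if "x \<in> carrier S" "x' \<in> carrier S" "y \<in> carrier B" "y' \<in> carrier B" for x x' y y' c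
      using True that by (auto simp: bilinear_form_def)
    have inner: "bilinear_form S B (G r b)" if "r \<in> carrier S" "b \<in> carrier B" for r b
      unfolding bilinear_form_def G_def UNIV_bit
      using that by (auto simp: S' B' Sl Bl bl algebra_simps)
    have outer: "bilinear_form S B (\<lambda>r b. pure_tensor S B r' b' (G r b))"
    proof -
      have "bilinear_form S B (\<lambda>r b. G r b r' b')"
        unfolding bilinear_form_def G_def UNIV_bit
        using r0 b' by (auto simp: S' B' Sl Bl bl algebra_simps)
      then show ?thesis
        by (rule bilinear_form_cong[OF S.super_space_axioms B.super_space_axioms]) (simp add: pure_tensor_def inner)
    qed
    have z: "\<beta> 0 y = 0" if "y \<in> carrier B" for y
      using bl(1)[of 0 0 y y] that S.gr_zero S.gr_carrier by fastforce
    have z': "\<beta> x 0 = 0" if "x \<in> carrier S" for x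
      using bl(2)[of x x 0 0] that B.gr_zero B.gr_carrier by fastforce
    have z0: "\<beta> 0 0 = 0" using z B.gr_zero B.gr_carrier by blast
    have z1: "nprod S n r 0 = 0"
      using Sl(4)[of r r 0 0] r S.gr_zero S.gr_carrier by fastforce
    have z2: "mul B 0 b' = 0"
      using Bl(2)[of 0 0 b' b'] b' B.gr_zero B.gr_carrier by fastforce
    have "nprod (tensor_lcs S B) n (pure_tensor S B r b) (pure_tensor S B r' b') \<beta> =
      pure_tensor S B r b (\<lambda>r b. pure_tensor S B r' b' (G r b))"
      using True by (simp add: tensor_lcs_def G_def)
    also have "\<dots> = G r b r' b'"
      using outer inner[OF r b0] by (simp add: pure_tensor_def)
    also have "\<dots> = koszul p q * \<beta> (nprod S n r r') (mul B b b')"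
      unfolding G_def UNIV_bit using bit_cases[of p] bit_cases[of q]
      by (auto simp: B.proj_gr[OF b] S.proj_gr[OF r'] z0 z1 z2 z z' Sl(1)[OF r r r0 r0] Bl(1)[OF b0 b0 b' b'])
    finally show ?thesis using True by (simp add: tens_smul_def pure_tensor_def)
  qed
qed

lemma grass_sign_Un_left:
  assumes "finite I" "finite J" "finite K" "I \<inter> J = {}"
  shows "grass_sign (I \<union> J) K = grass_sign I K * grass_sign J K"
proof -
  let ?U = "{(i, j). i \<in> I \<union> J \<and> j \<in> K \<and> j < i}"
  let ?P = "{(i, j). i \<in> I \<and> j \<in> K \<and> j < i}" and ?Q = "{(i, j). i \<in> J \<and> j \<in> K \<and> j < i}"
  have "?U = ?P \<union> ?Q" by auto
  moreover have "finite {(i, j). i \<in> I \<and> j \<in> K \<and> j < i}"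
    by (rule finite_subset[of _ "I \<times> K"]) (use assms in auto)
  moreover have "finite {(i, j). i \<in> J \<and> j \<in> K \<and> j < i}"
    by (rule finite_subset[of _ "J \<times> K"]) (use assms in auto)
  moreover have "?P \<inter> ?Q = {}" using assms(4) by blast
  ultimately have "card ?U = card ?P + card ?Q" by (simp only: card_Un_disjoint)
  then show ?thesis by (simp only: grass_sign_def power_add)
qed

lemma grass_sign_Un_right:
  assumes "finite I" "finite J" "finite K" "J \<inter> K = {}"
  shows "grass_sign I (J \<union> K) = grass_sign I J * grass_sign I K"
proof -
  let ?U = "{(i, j). i \<in> I \<and> j \<in> J \<union> K \<and> j < i}"
  let ?P = "{(i, j). i \<in> I \<and> j \<in> J \<and> j < i}" and ?Q = "{(i, j). i \<in> I \<and> j \<in> K \<and> j < i}"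
  have "?U = ?P \<union> ?Q" by auto
  moreover have "finite {(i, j). i \<in> I \<and> j \<in> J \<and> j < i}"
    by (rule finite_subset[of _ "I \<times> J"]) (use assms in auto)
  moreover have "finite {(i, j). i \<in> I \<and> j \<in> K \<and> j < i}"
    by (rule finite_subset[of _ "I \<times> K"]) (use assms in auto)
  moreover have "?P \<inter> ?Q = {}" using assms(4) by blast
  ultimately have "card ?U = card ?P + card ?Q" by (simp only: card_Un_disjoint)
  then show ?thesis by (simp only: grass_sign_def power_add)
qed

lemma grass_sign_swap:
  assumes "finite I" "finite J" "I \<inter> J = {}"
  shows "grass_sign I J = (- 1) ^ (card I * card J) * grass_sign J I"
proof -
  let ?A = "{(i, j). i \<in> I \<and> j \<in> J \<and> j < i}" and ?B = "{(i, j). i \<in> I \<and> j \<in> J \<and> i < j}"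
  have fin: "finite ?A" "finite ?B"
    by (rule finite_subset[of _ "I \<times> J"], use assms in auto)+
  have "?A \<union> ?B = I \<times> J" using assms(3)
  proof -
    have "i < j \<or> j < i" if "i \<in> I" "j \<in> J" for i j
      using that assms(3) by (metis disjoint_iff linorder_neqE_nat)
    then show ?thesis by fast
  qed
  moreover have "?A \<inter> ?B = {}" by auto
  ultimately have "card I * card J = card ?A + card ?B"
    using card_Un_disjoint[OF fin] by (simp only: card_cartesian_product)
  moreover have "card {(i, j). i \<in> J \<and> j \<in> I \<and> j < i} = card ?B"
    by (rule bij_betw_same_card[of prod.swap], rule bij_betw_byWitness[of _ prod.swap]) auto
  moreover have "(- 1 :: complex) ^ card ?B * (- 1) ^ card ?B = 1"
    by (simp add: power_mult_distrib[symmetric])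
  ultimately show ?thesis unfolding grass_sign_def by (simp add: power_add)
qed

lemma koszul_card: "koszul (of_nat a) (of_nat b) = (- 1) ^ (a * b)"
proof -
  have "(of_nat c = (1 :: bit)) = odd c" for c by (induction c) auto
  then show ?thesis by (auto simp: koszul_def)
qed

lemma grassmann_mul_assoc:
  "mul (grassmann n) (mul (grassmann n) f g) h = mul (grassmann n) f (mul (grassmann n) g h)"
proof
  fix K :: "nat set"
  show "mul (grassmann n) (mul (grassmann n) f g) h K = mul (grassmann n) f (mul (grassmann n) g h) K"
  proof (cases "finite K")
    case False
    then show ?thesis by (simp add: grassmann_def)
  next
    case True
    then have fin: "finite I" if "I \<subseteq> K" for I using that finite_subset by blast
    have "mul (grassmann n) (mul (grassmann n) f g) h K =
      (\<Sum>L\<in>Pow K. \<Sum>I\<in>Pow L. grass_sign L (K - L) * (grass_sign I (L - I) * f I * g (L - I)) * h (K - L))"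
      by (simp add: grassmann_def sum_distrib_left sum_distrib_right)
    also have "\<dots> = (\<Sum>(L, I)\<in>Sigma (Pow K) Pow.
        grass_sign L (K - L) * (grass_sign I (L - I) * f I * g (L - I)) * h (K - L))"
      by (rule sum.Sigma) (use True fin in auto)
    also have "\<dots> = (\<Sum>(I, J)\<in>Sigma (Pow K) (\<lambda>I. Pow (K - I)).
        grass_sign I (K - I) * f I * (grass_sign J (K - I - J) * g J * h (K - I - J)))"
    proof (rule sum.reindex_bij_witness[of _ "\<lambda>(I, J). (I \<union> J, I)" "\<lambda>(L, I). (I, L - I)"])
      fix x assume "x \<in> Sigma (Pow K) Pow"
      then obtain L I where x: "x = (L, I)" "L \<subseteq> K" "I \<subseteq> L" by auto
      define J M where JM: "J = L - I" "M = K - L"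
      have e: "L = I \<union> J" "K - I = J \<union> M" "K - L = M" "L - I = J" "K - I - (L - I) = M"
        using x JM by auto
      have f: "finite I" "finite J" "finite M" using x JM True fin by auto
      have "grass_sign L M * grass_sign I J = grass_sign I (J \<union> M) * grass_sign J M"
        using x f unfolding e(1)
        by (subst grass_sign_Un_left, simp_all add: JM) (subst grass_sign_Un_right, auto)
      then show "(case case x of (L, I) \<Rightarrow> (I, L - I) of (I, J) \<Rightarrow>
          grass_sign I (K - I) * f I * (grass_sign J (K - I - J) * g J * h (K - I - J))) =
         (case x of (L, I) \<Rightarrow> grass_sign L (K - L) * (grass_sign I (L - I) * f I * g (L - I)) * h (K - L))"
        using x(1) e by (simp add: algebra_simps)
    qed auto
    also have "\<dots> = (\<Sum>I\<in>Pow K. \<Sum>J\<in>Pow (K - I).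
        grass_sign I (K - I) * f I * (grass_sign J (K - I - J) * g J * h (K - I - J)))"
      by (rule sum.Sigma[symmetric]) (use True in auto)
    also have "\<dots> = mul (grassmann n) f (mul (grassmann n) g h) K"
      by (simp add: grassmann_def sum_distrib_left)
    finally show ?thesis .
  qed
qed

lemma grassmann_mul_nonzero:
  assumes "mul (grassmann n) f g K \<noteq> 0"
  obtains I J where "finite K" "K = I \<union> J" "I \<inter> J = {}" "f I \<noteq> 0" "g J \<noteq> 0"
proof -
  have "finite K" using assms by (rule contrapos_np) (simp add: grassmann_def)
  obtain I where "I \<in> Pow K" "grass_sign I (K - I) * f I * g (K - I) \<noteq> 0"
    by (rule sum.not_neutral_contains_not_neutral[of "\<lambda>I. grass_sign I (K - I) * f I * g (K - I)" "Pow K"])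
      (use assms in \<open>simp add: grassmann_def\<close>)
  then show thesis using \<open>finite K\<close> that[of I "K - I"] by auto
qed

lemma grassmann_comm_superalgebra: "comm_superalgebra (grassmann n)"
proof -
  let ?B = "grassmann n"
  have vs: "vector_space (smul ?B)"
    by unfold_locales (auto simp: grassmann_def fun_eq_iff algebra_simps)
  interpret vector_space "smul ?B" by (rule vs)
  have car: "f \<in> carrier ?B \<longleftrightarrow> (\<forall>I. f I \<noteq> 0 \<longrightarrow> I \<subseteq> {..<n})" for f by (simp add: grassmann_def)
  have grd: "f \<in> gr ?B p \<longleftrightarrow> (\<forall>I. f I \<noteq> 0 \<longrightarrow> I \<subseteq> {..<n} \<and> of_nat (card I) = p)" for f p
    by (simp add: grassmann_def)
  have smul: "smul ?B c f = (\<lambda>I. c * f I)" for c f by (simp add: grassmann_def)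
  have mulc: "mul ?B f g \<in> carrier ?B" if "f \<in> carrier ?B" "g \<in> carrier ?B" for f g
    using that unfolding car by (blast elim: grassmann_mul_nonzero)
  have dist: "mul ?B (f + f') g = mul ?B f g + mul ?B f' g" "mul ?B f (g + g') = mul ?B f g + mul ?B f g'"
    "mul ?B (smul ?B c f) g = smul ?B c (mul ?B f g)" "mul ?B f (smul ?B c g) = smul ?B c (mul ?B f g)" for f f' g g' c
    by (auto simp: grassmann_def fun_eq_iff algebra_simps sum.distrib sum_distrib_left)
  show ?thesis
  proof
    show "subspace (gr ?B p)" for p
    proof (rule subspaceI)
      fix x y assume xy: "x \<in> gr ?B p" "y \<in> gr ?B p"
      have "x I \<noteq> 0 \<or> y I \<noteq> 0" if "(x + y) I \<noteq> 0" for I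
        using that by (cases "x I = 0") auto
      then show "x + y \<in> gr ?B p" using xy unfolding grd by blast
    qed (auto simp: grd smul)
    show "carrier ?B = {x + y |x y. x \<in> gr ?B 0 \<and> y \<in> gr ?B 1}"
    proof (intro equalityI subsetI)
      fix f assume f: "f \<in> carrier ?B"
      define a where "a = (\<lambda>p I. if (of_nat (card I) :: bit) = p then f I else 0)"
      have "f = a 0 + a 1" using bit_cases by (auto simp: a_def fun_eq_iff)
      moreover have "a p \<in> gr ?B p" for p using f by (auto simp: a_def grd car)
      ultimately show "f \<in> {x + y |x y. x \<in> gr ?B 0 \<and> y \<in> gr ?B 1}" by blast
    next
      fix f assume "f \<in> {x + y |x y. x \<in> gr ?B 0 \<and> y \<in> gr ?B 1}"
      then obtain x y where f: "f = x + y" "x \<in> gr ?B 0" "y \<in> gr ?B 1" by blast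
      have "x I \<noteq> 0 \<or> y I \<noteq> 0" if "f I \<noteq> 0" for I
        using that f(1) by (cases "x I = 0") auto
      then show "f \<in> carrier ?B" using f(2,3) unfolding grd car by blast
    qed
    show "gr ?B 0 \<inter> gr ?B 1 = {0}"
      by (fastforce simp: grd fun_eq_iff)
    show "linear_map ?B ?B (\<lambda>x. mul ?B x y)" if "y \<in> carrier ?B" for y
      using that by (simp add: linear_map_def mulc dist)
    show "linear_map ?B ?B (\<lambda>y. mul ?B x y)" if "x \<in> carrier ?B" for x
      using that by (simp add: linear_map_def mulc dist)
    show "mul ?B x y \<in> gr ?B (p + q)" if x: "x \<in> gr ?B p" and y: "y \<in> gr ?B q" for x y p q
      unfolding grd
    proof (intro allI impI)
      fix K assume "mul ?B x y K \<noteq> 0"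
      then obtain I J where "finite K" "K = I \<union> J" "I \<inter> J = {}" "x I \<noteq> 0" "y J \<noteq> 0"
        by (rule grassmann_mul_nonzero)
      then show "K \<subseteq> {..<n} \<and> of_nat (card K) = p + q"
        using x y by (auto simp: grd card_Un_disjoint)
    qed
    show "mul ?B (mul ?B x y) z = mul ?B x (mul ?B y z)" for x y z by (rule grassmann_mul_assoc)
    show "mul ?B x y = smul ?B (koszul p q) (mul ?B y x)" if x: "x \<in> gr ?B p" and y: "y \<in> gr ?B q" for x y p q
    proof
      fix K :: "nat set"
      show "mul ?B x y K = smul ?B (koszul p q) (mul ?B y x) K"
      proof (cases "finite K")
        case False
        then show ?thesis by (simp add: grassmann_def)
      next
        case True
        have "mul ?B x y K = (\<Sum>I\<in>Pow K. grass_sign I (K - I) * x I * y (K - I))" by (simp add: grassmann_def)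
        also have "\<dots> = (\<Sum>J\<in>Pow K. koszul p q * (grass_sign J (K - J) * y J * x (K - J)))"
        proof (rule sum.reindex_bij_witness[of _ "\<lambda>J. K - J" "\<lambda>J. K - J"])
          fix I assume "I \<in> Pow K"
          then have I: "K - (K - I) = I" "finite I" "finite (K - I)" "I \<inter> (K - I) = {}"
            using True finite_subset by auto
          show "koszul p q * (grass_sign (K - I) (K - (K - I)) * y (K - I) * x (K - (K - I))) =
              grass_sign I (K - I) * x I * y (K - I)"
          proof (cases "x I = 0 \<or> y (K - I) = 0")
            case True
            then show ?thesis using I by auto
          next
            case False
            then have "p = of_nat (card I)" "q = of_nat (card (K - I))"
              using x y by (auto simp: grd)
            then have "koszul p q = (- 1) ^ (card I * card (K - I))" by (simp only: koszul_card)
            then show ?thesis using grass_sign_swap[OF I(2,3,4)] I(1) by simp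
          qed
        qed auto
        finally show ?thesis by (simp add: grassmann_def sum_distrib_left)
      qed
    qed
    show "unit ?B \<in> gr ?B 0" unfolding grd by (simp add: grassmann_def)
    show "mul ?B (unit ?B) x = x" if x: "x \<in> carrier ?B" for x
    proof
      fix K
      show "mul ?B (unit ?B) x K = x K"
      proof (cases "finite K")
        case True
        have "mul ?B (unit ?B) x K = (\<Sum>I\<in>Pow K. if I = {} then x K else 0)"
          unfolding grassmann_def by (auto intro!: sum.cong simp: grass_sign_def)
        then show ?thesis using True by simp
      next
        case False
        then have "x K = 0" using x unfolding car by (meson finite_lessThan finite_subset)
        then show ?thesis using False by (simp add: grassmann_def)
      qed
    qed
  qed
qed

end

theory Submission
  imports Defs
begin

text \<open>The sign rule is carried by the parity automorphism \<open>parity_map R s\<close>, which is the identity for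
  \<open>s = 0\<close> and \<open>x \<mapsto> (-1)\<^bsup>p(x)\<^esup> x\<close> for \<open>s = 1\<close>. For a number \<open>l\<close>, a centroid map of degree \<open>l\<close> commutes
  with all brackets and intertwines \<open>\<partial>\<close> and \<open>\<partial> + l\<close>; the value of a conformal derivation at \<open>l\<close> is a
  derivation of degree \<open>l\<close>.

  Finite rank and triviality of the center give a minimal ideal \<open>I\<close>, and the annihilator \<open>M\<close> of \<open>I\<close>
  contains every proper ideal. Hence centroid maps with image outside \<open>M\<close> are invertible. A
  composition of derivations identifies \<open>I\<close> with \<open>R/M\<close>; if \<open>M \<noteq> 0\<close>, this gives a nonzero noninvertible
  centroid map, and differential simplicity gives a noninvertible \<open>\<xi>\<close> and a derivation whose commutator
  with \<open>\<xi>\<close> is invertible. Because conformal derivations are polynomial in \<open>l\<close>, there are invertible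
  centroid maps of every degree, so one can achieve degree \<open>0\<close> and \<open>[\<delta>, \<xi>] = 1\<close>. Both maps are then odd
  (an even \<open>\<xi>\<close> would be nilpotent, which is impossible in characteristic \<open>0\<close>), \<open>\<delta>\<^sup>2 = 0\<close> can be
  achieved, and \<open>R = ker \<delta> \<oplus> \<xi> ker \<delta>\<close> is the tensor product of \<open>ker \<delta>\<close> with a Grassmann algebra in one
  variable. Induction on the rank finishes the proof.\<close>

text \<open>Two obstacles shape the proof. There is no descending chain condition to start from:
  nested \<complex>[\<partial>]-submodules of equal rank can descend forever. Brackets repair this.
  Since bracketing turns \<open>D\<close> into \<open>D + l\<close>, an element that is torsion
  modulo an ideal is moved into that ideal by every bracket; so an ideal of least rank becomes
  minimal after being replaced by the span of its brackets. This replacement costs nothing in a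
  perfect algebra without center, and it returns wherever a chain condition would be used. The
  second obstacle is the parameter. Evaluating it at numbers turns everything into ordinary linear
  maps, but maps of different degrees cannot be added, so degrees have to be carried along until
  units of every degree are available to remove them. The pattern is that of Block's theorem on
  differentiably simple algebras. Truncated polynomials do not occur, since in characteristic 0 a
  nilpotent variable with an invertible derivative has to be odd.\<close>

section \<open>Superspaces and parity\<close>

text \<open>These simplification rules turn sums of parities into bitwise operations.\<close>

declare add_bit_eq_xor [simp del] mult_bit_eq_and [simp del]

lemma koszul_simps [simp]:
  "koszul 0 t = 1" "koszul t 0 = 1" "koszul 1 1 = -1"
  "koszul s t * koszul s t = 1" "koszul s t * (koszul s t * z) = z" "koszul s t \<noteq> 0"
  by (auto simp: koszul_def)

lemma koszul_add:
  "koszul (s + t) p = koszul s p * koszul t p" "koszul p (s + t) = koszul p s * koszul p t"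
  using bit_cases[of s] bit_cases[of t] bit_cases[of p] by (auto simp: koszul_def)

lemma koszul_commute: "koszul s t = koszul t s"
  by (auto simp: koszul_def)

lemma bit_add_self [simp]: "(s::bit) + s = 0" "s + (s + t) = t"
  by (cases s; cases t; simp)+

text \<open>The Koszul sign of moving a map of parity \<open>s\<close> past \<open>x\<close>, as a
  linear operator. Sign rules then hold for arbitrary elements, without splitting them into
  homogeneous parts.\<close>

definition parity_map :: "('a::ab_group_add, 'm) superspace_scheme \<Rightarrow> bit \<Rightarrow> 'a \<Rightarrow> 'a" where
  "parity_map V s x = proj V 0 x + smul V (koszul s 1) (proj V 1 x)"

definition homogeneous_map :: "('a::ab_group_add, 'm) superspace_scheme \<Rightarrow> bit \<Rightarrow> ('a \<Rightarrow> 'a) \<Rightarrow> bool" where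
  "homogeneous_map V s f \<longleftrightarrow> linear_map V V f \<and> (\<forall>p. \<forall>x\<in>gr V p. f x \<in> gr V (s + p))"

sublocale super_space \<subseteq> vs: vector_space "smul V"
  by (rule vector_space_smul)

context super_space begin

lemma subspace_carrier: "vs.subspace (carrier V)"
  by (rule vs.subspaceI) (use gr_zero[of 0] gr_carrier carrier_add carrier_smul in blast)+

lemma carrier_zero [simp, intro]: "0 \<in> carrier V"
  and carrier_diff: "x \<in> carrier V \<Longrightarrow> y \<in> carrier V \<Longrightarrow> x - y \<in> carrier V"
  and carrier_uminus: "x \<in> carrier V \<Longrightarrow> - x \<in> carrier V"
  and carrier_sum: "(\<And>i. i \<in> A \<Longrightarrow> f i \<in> carrier V) \<Longrightarrow> sum f A \<in> carrier V"
  using subspace_carrier by (auto intro: vs.subspace_0 vs.subspace_diff vs.subspace_neg vs.subspace_sum)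

lemmas closed = carrier_add carrier_smul carrier_zero carrier_diff carrier_uminus carrier_sum proj_carrier

lemma proj_decomp: "x \<in> carrier V \<Longrightarrow> x = proj V 0 x + proj V 1 x"
  by (metis carrier_split proj_eq add.commute bit_add_self(1) add_0)

lemma proj_mem_gr: "x \<in> carrier V \<Longrightarrow> proj V p x \<in> gr V p"
  by (metis carrier_split proj_eq)

lemma parity_map_gr: "x \<in> gr V p \<Longrightarrow> parity_map V s x = smul V (koszul s p) x"
  unfolding parity_map_def using proj_gr[of x p] bit_cases[of p] by auto

lemma parity_map_closed: "x \<in> carrier V \<Longrightarrow> parity_map V s x \<in> carrier V"
  unfolding parity_map_def by (intro closed)

lemma parity_map_gr_closed: "x \<in> gr V p \<Longrightarrow> parity_map V s x \<in> gr V p"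
  by (simp add: parity_map_gr gr_smul)

lemma parity_map_add: "x \<in> carrier V \<Longrightarrow> y \<in> carrier V \<Longrightarrow>
    parity_map V s (x + y) = parity_map V s x + parity_map V s y"
  unfolding parity_map_def by (simp add: proj_add smul_add)

lemma parity_map_smul: "x \<in> carrier V \<Longrightarrow> parity_map V s (smul V c x) = smul V c (parity_map V s x)"
  unfolding parity_map_def by (simp add: proj_smul smul_add mult.commute)

lemma parity_map_0: "x \<in> carrier V \<Longrightarrow> parity_map V 0 x = x"
  unfolding parity_map_def using proj_decomp[of x] by simp

lemma linear_ext:
  assumes "x \<in> carrier V" "linear_map V W f" "linear_map V W g"
    and "\<And>p x. x \<in> gr V p \<Longrightarrow> f x = g x"
  shows "f x = g x"
proof -
  have "f (proj V 0 x + proj V 1 x) = g (proj V 0 x + proj V 1 x)"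
    using assms proj_mem_gr proj_carrier unfolding linear_map_def by metis
  then show ?thesis using proj_decomp[OF assms(1)] by simp
qed

lemma linear_parity_map: "linear_map V V (parity_map V s)"
  by (simp add: linear_map_def parity_map_closed parity_map_add parity_map_smul)

lemma linear_comp: "linear_map V V f \<Longrightarrow> linear_map V V g \<Longrightarrow> linear_map V V (\<lambda>x. f (g x))"
  by (simp add: linear_map_def)

lemma linear_scale: "linear_map V V f \<Longrightarrow> linear_map V V (\<lambda>x. smul V c (f x))"
  by (simp add: linear_map_def smul_add carrier_smul mult.commute)

lemma linear_plus: "linear_map V V f \<Longrightarrow> linear_map V V g \<Longrightarrow> linear_map V V (\<lambda>x. f x + g x)"
  by (simp add: linear_map_def smul_add carrier_add algebra_simps)

lemma linear_minus: "linear_map V V f \<Longrightarrow> linear_map V V g \<Longrightarrow> linear_map V V (\<lambda>x. f x - g x)"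
  by (simp add: linear_map_def vs.scale_right_diff_distrib carrier_diff algebra_simps)

lemma linear_id: "linear_map V V (\<lambda>x. x)"
  by (simp add: linear_map_def)

lemma linear_zero:
  assumes "linear_map V V f" shows "f 0 = 0"
proof -
  have "f (smul V 0 0) = smul V 0 (f 0)" using assms carrier_zero unfolding linear_map_def by blast
  then show ?thesis by simp
qed

lemma linear_diff:
  assumes "linear_map V V f" "x \<in> carrier V" "y \<in> carrier V"
  shows "f (x - y) = f x - f y"
proof -
  have "f (x + smul V (-1) y) = f x + smul V (-1) (f y)"
    using assms carrier_smul[OF assms(3)] unfolding linear_map_def by metis
  then show ?thesis by simp
qed

lemma linear_uminus:
  assumes "linear_map V V f" "x \<in> carrier V"
  shows "f (- x) = - f x"
  using linear_diff[OF assms(1) carrier_zero assms(2)] linear_zero[OF assms(1)] by simp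

lemma linear_sum:
  assumes "linear_map V V f" "\<And>i. i \<in> A \<Longrightarrow> g i \<in> carrier V"
  shows "f (sum g A) = (\<Sum>i\<in>A. f (g i))"
  using assms(2)
proof (induction A rule: infinite_finite_induct)
  case (insert x F)
  then have "f (g x + sum g F) = f (g x) + f (sum g F)"
    using assms(1) by (simp add: linear_map_def carrier_sum)
  then show ?case using insert by simp
qed (auto simp: linear_zero[OF assms(1)])

lemma parity_map_parity_map:
  assumes "x \<in> carrier V"
  shows "parity_map V s (parity_map V t x) = parity_map V (s + t) x"
  by (rule linear_ext[OF assms linear_comp[OF linear_parity_map linear_parity_map] linear_parity_map])
    (simp add: parity_map_gr parity_map_smul gr_carrier koszul_add mult.commute)

lemma homogeneous_map_parity_map:
  assumes f: "homogeneous_map V s f" and x: "x \<in> carrier V"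
  shows "f (parity_map V t x) = smul V (koszul s t) (parity_map V t (f x))"
proof (rule linear_ext[OF x])
  have l: "linear_map V V f" using f by (simp add: homogeneous_map_def)
  show "linear_map V V (\<lambda>x. f (parity_map V t x))"
    "linear_map V V (\<lambda>x. smul V (koszul s t) (parity_map V t (f x)))"
    by (intro linear_comp[OF l linear_parity_map] linear_scale linear_comp[OF linear_parity_map l])+
  fix p x assume x: "x \<in> gr V p"
  then have fx: "f x \<in> gr V (s + p)" using f by (simp add: homogeneous_map_def)
  show "f (parity_map V t x) = smul V (koszul s t) (parity_map V t (f x))"
    using l gr_carrier[OF x] koszul_commute[of t s]
    by (simp add: parity_map_gr[OF x] parity_map_gr[OF fx] linear_map_def koszul_add)
qed

text \<open>The case \<open>t = 1\<close> makes \<open>f x\<close> an eigenvector of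
  \<open>parity_map V 1\<close> with eigenvalue 1 or -1, and as 2 is invertible the eigenspaces are
  the two graded parts. Maps obtained by choice or inversion are shown homogeneous this way.\<close>

lemma homogeneous_mapI:
  assumes "linear_map V V f"
    and "\<And>x t. x \<in> carrier V \<Longrightarrow> f (parity_map V t x) = smul V (koszul s t) (parity_map V t (f x))"
  shows "homogeneous_map V s f"
proof -
  have "f x \<in> gr V (s + p)" if x: "x \<in> gr V p" for p x
  proof -
    have c: "x \<in> carrier V" "f x \<in> carrier V"
      using x gr_carrier assms(1) by (auto simp: linear_map_def)
    have "smul V (koszul s 1) (parity_map V 1 (f x)) = smul V (koszul 1 p) (f x)"
      using assms(2)[OF c(1), of 1] assms(1) c(1) by (simp add: parity_map_gr[OF x] linear_map_def)
    then have "smul V (koszul s 1) (smul V (koszul s 1) (parity_map V 1 (f x))) =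
      smul V (koszul s 1 * koszul 1 p) (f x)" by simp
    then have e: "parity_map V 1 (f x) = smul V (koszul (s + p) 1) (f x)"
      using koszul_commute by (simp add: koszul_add)
    let ?a = "proj V 0 (f x)" and ?b = "proj V 1 (f x)"
    have fx: "f x = ?a + ?b" by (rule proj_decomp[OF c(2)])
    have e': "?a - ?b = smul V (koszul (s + p) 1) (?a + ?b)"
      using e fx by (simp add: parity_map_def)
    have g: "?a \<in> gr V 0" "?b \<in> gr V 1" using proj_mem_gr[OF c(2)] by auto
    show ?thesis
    proof (cases "s + p = 0")
      case True
      then have "?a - ?b = ?a + ?b" using e' by simp
      then have "?b + ?b = 0" by (simp add: algebra_simps)
      then have "smul V 2 ?b = 0" using vs.scale_left_distrib[of 1 1 ?b] by simp
      then show ?thesis using True g fx by simp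
    next
      case False
      then have sp: "s + p = 1" using bit_cases[of "s + p"] by auto
      then have "?a - ?b = - ?a - ?b" using e' by simp
      then have "?a = - ?a" by simp
      then have "?a + ?a = 0" by (metis add.right_inverse)
      then have "smul V 2 ?a = 0" using vs.scale_left_distrib[of 1 1 ?a] by simp
      then show ?thesis using sp g fx by simp
    qed
  qed
  then show ?thesis using assms(1) by (simp add: homogeneous_map_def)
qed

lemma parity_map_involution: "x \<in> carrier V \<Longrightarrow> parity_map V s (parity_map V s x) = x"
  by (simp add: parity_map_parity_map parity_map_0)

lemma proj_eq_parity_map:
  assumes "x \<in> carrier V"
  shows "proj V 0 x = smul V (1/2) (x + parity_map V 1 x)"
    "proj V 1 x = smul V (1/2) (x - parity_map V 1 x)"
proof -
  let ?a = "proj V 0 x" and ?b = "proj V 1 x"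
  have s: "parity_map V 1 x = ?a - ?b" by (simp add: parity_map_def)
  have "x + parity_map V 1 x = (?a + ?b) + (?a - ?b)" using proj_decomp[OF assms] s by metis
  also have "\<dots> = smul V 2 ?a" using vs.scale_left_distrib[of 1 1 ?a] by simp
  finally have "x + parity_map V 1 x = smul V 2 ?a" .
  then show "?a = smul V (1/2) (x + parity_map V 1 x)" by simp
  have "x - parity_map V 1 x = (?a + ?b) - (?a - ?b)" using proj_decomp[OF assms] s by metis
  also have "\<dots> = smul V 2 ?b" using vs.scale_left_distrib[of 1 1 ?b] by simp
  finally show "?b = smul V (1/2) (x - parity_map V 1 x)" by simp
qed

text \<open>Gradedness as invariance under the parity automorphism, a closure property like all
  others. Dividing by 2 recovers the components, see \<open>graded_subspace_proj\<close>.\<close>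

definition graded_subspace :: "'a set \<Rightarrow> bool" where
  "graded_subspace J \<longleftrightarrow> vs.subspace J \<and> J \<subseteq> carrier V \<and> (\<forall>x\<in>J. parity_map V 1 x \<in> J)"

lemma graded_subspaceI:
  assumes "vs.subspace J" "J \<subseteq> carrier V" "\<And>x. x \<in> J \<Longrightarrow> parity_map V 1 x \<in> J"
  shows "graded_subspace J"
  using assms by (simp add: graded_subspace_def)

lemma graded_subspace_parity_map:
  assumes "graded_subspace J" "x \<in> J" shows "parity_map V s x \<in> J"
  using assms bit_cases[of s] parity_map_0[of x] by (auto simp: graded_subspace_def)

lemma graded_subspace_proj:
  assumes "graded_subspace J" "x \<in> J" shows "proj V p x \<in> J"
proof -
  have "x \<in> carrier V" "parity_map V 1 x \<in> J" and s: "vs.subspace J"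
    using assms by (auto simp: graded_subspace_def)
  then have "smul V (1/2) (x + parity_map V 1 x) \<in> J" "smul V (1/2) (x - parity_map V 1 x) \<in> J"
    using assms(2) by (blast intro: vs.subspace_scale vs.subspace_add vs.subspace_diff)+
  then show ?thesis using bit_cases[of p] proj_eq_parity_map[OF \<open>x \<in> carrier V\<close>] by auto
qed

lemma homogeneous_map_comp:
  assumes "homogeneous_map V s f" "homogeneous_map V t g"
  shows "homogeneous_map V (s + t) (\<lambda>x. f (g x))"
  using assms linear_comp unfolding homogeneous_map_def
  by (metis (mono_tags, lifting) add.assoc)

lemma homogeneous_map_diff:
  assumes "homogeneous_map V s f" "homogeneous_map V s g"
  shows "homogeneous_map V s (\<lambda>x. f x - g x)"
  using assms linear_minus gr_diff unfolding homogeneous_map_def by metis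

lemma homogeneous_map_scale:
  assumes "homogeneous_map V s f"
  shows "homogeneous_map V s (\<lambda>x. smul V c (f x))"
  using assms linear_scale gr_smul unfolding homogeneous_map_def by metis

lemma homogeneous_map_linear: "homogeneous_map V s f \<Longrightarrow> linear_map V V f"
  by (simp add: homogeneous_map_def)

end

lemma linear_mapD:
  assumes "linear_map V W f"
  shows "x \<in> carrier V \<Longrightarrow> f x \<in> carrier W"
    and "x \<in> carrier V \<Longrightarrow> y \<in> carrier V \<Longrightarrow> f (x + y) = f x + f y"
    and "x \<in> carrier V \<Longrightarrow> f (smul V c x) = smul W c (f x)"
  using assms by (auto simp: linear_map_def)

section \<open>Polynomial functions\<close>

text \<open>Reduces statements about vector-valued polynomials to scalar ones; it also separates
  tensors at the end.\<close>

lemma (in vector_space) functional_separating_subspace: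
  assumes "subspace J" "w \<notin> J"
  obtains g :: "'b \<Rightarrow> 'a" where "\<And>x y. g (x + y) = g x + g y" "\<And>c x. g (scale c x) = c * g x"
    "\<And>x. x \<in> J \<Longrightarrow> g x = 0" "g w = 1"
proof -
  obtain B where B: "B \<subseteq> J" "independent B" "J \<subseteq> span B"
    using maximal_independent_subset[of J] by blast
  have "w \<notin> span B" using span_minimal[OF B(1) assms(1)] assms(2) by blast
  then have ind: "independent (insert w B)" using B(2) by (simp add: independent_insert)
  interpret p: vector_space_pair scale "(*) :: 'a \<Rightarrow> 'a \<Rightarrow> 'a"
    by unfold_locales (auto simp: algebra_simps)
  obtain g where g: "Vector_Spaces.linear scale (*) g" "\<forall>x\<in>insert w B. g x = (if x = w then 1 else 0)"
    using p.linear_independent_extend[OF ind, of "\<lambda>x. if x = w then 1 else 0"] by blast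
  interpret g: Vector_Spaces.linear scale "(*)" g by (rule g(1))
  have "g x = 0" if "x \<in> J" for x
  proof -
    have "x \<in> span B" using B(3) that by blast
    moreover have "g y = 0" if "y \<in> B" for y using g(2) B(1) assms(2) that by auto
    ultimately show ?thesis by (rule g.eq_0_on_span[rotated])
  qed
  then show thesis using that[of g] g(2) g.add g.scale by simp
qed

text \<open>A functional vanishing on \<open>J\<close> but not at \<open>w n\<close> would give a
  nonzero scalar polynomial with infinitely many roots.\<close>

lemma (in super_space) polynomial_coefficients_in_subspace:
  assumes J: "vs.subspace J" and inf: "infinite L" and mem: "\<And>l. l \<in> L \<Longrightarrow> (\<Sum>n\<le>N. smul V (l ^ n) (w n)) \<in> J"
    and n: "n \<le> N"
  shows "w n \<in> J"
proof (rule ccontr)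
  assume "w n \<notin> J"
  then obtain g where g: "\<And>x y. g (x + y) = g x + g y" "\<And>c x. g (smul V c x) = c * g x"
    "\<And>x. x \<in> J \<Longrightarrow> g x = 0" "g (w n) = 1"
    using vs.functional_separating_subspace[OF J] by metis
  have g0: "g 0 = 0" using J g(3) vs.subspace_0 by blast
  have "g (\<Sum>n\<in>A. smul V (l ^ n) (w n)) = (\<Sum>n\<in>A. g (w n) * l ^ n)" for l A
    by (induction A rule: infinite_finite_induct) (auto simp: g g0)
  then have "L \<subseteq> {l. (\<Sum>n\<le>N. g (w n) * l ^ n) = 0}" using g(3)[OF mem] by fastforce
  then have "infinite {l. (\<Sum>n\<le>N. g (w n) * l ^ n) = 0}" using inf finite_subset by blast
  moreover have "finite {l. (\<Sum>n\<le>N. g (w n) * l ^ n) = 0}"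
    by (rule polyfun_roots_finite[of "\<lambda>n. g (w n)" n N]) (use g(4) n in auto)
  ultimately show False by blast
qed

text \<open>The coefficients beyond \<open>N\<close> are required to vanish so that two families can
  be brought to a common length.\<close>

definition polynomial_family :: "('a::ab_group_add, 'm) superspace_scheme \<Rightarrow> (complex \<Rightarrow> 'a) \<Rightarrow> bool" where
  "polynomial_family V f \<longleftrightarrow> (\<exists>N w. (\<forall>n. w n \<in> carrier V) \<and> (\<forall>n>N. w n = 0) \<and>
     (\<forall>l. f l = (\<Sum>n\<le>N. smul V (l ^ n) (w n))))"

context super_space begin

lemma polynomial_family_linear:
  assumes f: "polynomial_family V f" and g: "linear_map V V g"
  shows "polynomial_family V (\<lambda>l. g (f l))"
proof -
  obtain N w where w: "\<And>n. w n \<in> carrier V" "\<And>n. n > N \<Longrightarrow> w n = 0"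
    "\<And>l. f l = (\<Sum>n\<le>N. smul V (l ^ n) (w n))"
    using f unfolding polynomial_family_def by blast
  have "g (f l) = (\<Sum>n\<le>N. smul V (l ^ n) (g (w n)))" for l
    unfolding w(3) using w(1) by (simp add: linear_sum[OF g] carrier_smul linear_mapD(3)[OF g])
  moreover have "g (w n) \<in> carrier V" for n using linear_mapD(1)[OF g w(1)] .
  ultimately show ?thesis unfolding polynomial_family_def
    using w(2) linear_zero[OF g] by (intro exI[of _ N] exI[of _ "\<lambda>n. g (w n)"]) simp
qed

lemma polynomial_family_add:
  assumes f: "polynomial_family V f" and g: "polynomial_family V g"
  shows "polynomial_family V (\<lambda>l. f l + g l)"
proof -
  obtain N w where w: "\<And>n. w n \<in> carrier V" "\<And>n. n > N \<Longrightarrow> w n = 0"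
    "\<And>l. f l = (\<Sum>n\<le>N. smul V (l ^ n) (w n))"
    using f unfolding polynomial_family_def by blast
  obtain M v where v: "\<And>n. v n \<in> carrier V" "\<And>n. n > M \<Longrightarrow> v n = 0"
    "\<And>l. g l = (\<Sum>n\<le>M. smul V (l ^ n) (v n))"
    using g unfolding polynomial_family_def by blast
  let ?K = "max N M"
  have "f l = (\<Sum>n\<le>?K. smul V (l ^ n) (w n))" for l
    unfolding w(3) by (rule sum.mono_neutral_left) (auto simp: w(2))
  moreover have "g l = (\<Sum>n\<le>?K. smul V (l ^ n) (v n))" for l
    unfolding v(3) by (rule sum.mono_neutral_left) (auto simp: v(2))
  ultimately have "f l + g l = (\<Sum>n\<le>?K. smul V (l ^ n) (w n + v n))" for l
    by (simp add: smul_add sum.distrib)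
  then show ?thesis unfolding polynomial_family_def
    using w v carrier_add by (intro exI[of _ ?K] exI[of _ "\<lambda>n. w n + v n"]) simp
qed

lemma polynomial_family_diff:
  assumes f: "polynomial_family V f" and g: "polynomial_family V g"
  shows "polynomial_family V (\<lambda>l. f l - g l)"
proof -
  have "polynomial_family V (\<lambda>l. f l + smul V (-1) (g l))"
    by (intro polynomial_family_add f polynomial_family_linear[OF g] linear_scale linear_id)
  then show ?thesis by simp
qed

lemma polynomial_family_scale:
  "polynomial_family V f \<Longrightarrow> polynomial_family V (\<lambda>l. smul V c (f l))"
  by (rule polynomial_family_linear[OF _ linear_scale[OF linear_id]])

text \<open>Turns an escape from \<open>J\<close> at one parameter into a generic one, which later
  leaves room to choose parameters.\<close>

lemma polynomial_family_cofinite: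
  assumes "polynomial_family V f" "vs.subspace J" "f l \<notin> J"
  shows "finite {l. f l \<in> J}"
proof (rule ccontr)
  assume inf: "infinite {l. f l \<in> J}"
  obtain N w where w: "\<And>l. f l = (\<Sum>n\<le>N. smul V (l ^ n) (w n))"
    using assms(1) unfolding polynomial_family_def by blast
  have "w n \<in> J" if "n \<le> N" for n
    by (rule polynomial_coefficients_in_subspace[OF assms(2) inf _ that]) (use w in auto)
  then have "f l \<in> J" unfolding w using assms(2) by (auto intro: vs.subspace_sum vs.subspace_scale)
  then show False using assms(3) by simp
qed

section \<open>Generating polynomials: values and coefficients\<close>

lemma gen_poly_superset:
  assumes "finite A" "{n. u n \<noteq> 0} \<subseteq> A"
  shows "gen_poly V u l = (\<Sum>n\<in>A. smul V (l ^ n / fact n) (u n))"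
  unfolding gen_poly_def using assms by (intro sum.mono_neutral_left) auto

lemma gen_poly_atMost:
  assumes "finite {n. u n \<noteq> 0}"
  obtains N where "\<And>n. n > N \<Longrightarrow> u n = 0"
    "\<And>l. gen_poly V u l = (\<Sum>n\<le>N. smul V (l ^ n) (smul V (1 / fact n) (u n)))"
proof -
  obtain N where N: "{n. u n \<noteq> 0} \<subseteq> {..N}" using assms finite_nat_set_iff_bounded_le by auto
  have "u n = 0" if "n > N" for n using N that by force
  moreover have "gen_poly V u l = (\<Sum>n\<le>N. smul V (l ^ n) (smul V (1 / fact n) (u n)))" for l
    using gen_poly_superset[OF _ N] by simp
  ultimately show thesis using that by blast
qed

lemma gen_poly_polynomial_family:
  assumes "finite {n. u n \<noteq> 0}" "\<And>n. u n \<in> carrier V"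
  shows "polynomial_family V (gen_poly V u)"
proof -
  obtain N where N: "\<And>n. n > N \<Longrightarrow> u n = 0"
    "\<And>l. gen_poly V u l = (\<Sum>n\<le>N. smul V (l ^ n) (smul V (1 / fact n) (u n)))"
    using gen_poly_atMost[OF assms(1)] by blast
  then show ?thesis unfolding polynomial_family_def
    using assms(2) carrier_smul by (intro exI[of _ N] exI[of _ "\<lambda>n. smul V (1 / fact n) (u n)"]) simp
qed

text \<open>The way back from values at all \<open>l\<close> to single \<open>n\<close>-products and
  to single coefficients of conformal derivations.\<close>

lemma gen_poly_coefficients:
  assumes fin: "finite {n. u n \<noteq> 0}" and J: "vs.subspace J" and mem: "\<And>l. gen_poly V u l \<in> J"
  shows "u n \<in> J"
proof -
  obtain N where N: "\<And>n. n > N \<Longrightarrow> u n = 0"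
    "\<And>l. gen_poly V u l = (\<Sum>n\<le>N. smul V (l ^ n) (smul V (1 / fact n) (u n)))"
    using gen_poly_atMost[OF fin] by blast
  show ?thesis
  proof (cases "n \<le> N")
    case True
    have "smul V (1 / fact n) (u n) \<in> J"
      by (rule polynomial_coefficients_in_subspace[OF J infinite_UNIV_char_0 _ True]) (use mem N(2) in auto)
    then have "smul V (fact n) (smul V (1 / fact n) (u n)) \<in> J" by (rule vs.subspace_scale[OF J])
    then show ?thesis by simp
  next
    case False
    then show ?thesis using N(1) vs.subspace_0[OF J] by simp
  qed
qed

lemma gen_poly_add:
  assumes "finite {n. u n \<noteq> 0}" "finite {n. v n \<noteq> 0}"
  shows "gen_poly V (\<lambda>n. u n + v n) l = gen_poly V u l + gen_poly V v l"
proof -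
  let ?A = "{n. u n \<noteq> 0} \<union> {n. v n \<noteq> 0}"
  have A: "finite ?A" using assms by simp
  have "{n. u n + v n \<noteq> 0} \<subseteq> ?A" by auto
  then show ?thesis using A
    by (simp add: gen_poly_superset[of ?A] smul_add sum.distrib)
qed

lemma gen_poly_linear_image:
  assumes "finite {n. u n \<noteq> 0}" "\<And>n. u n \<in> carrier V" "linear_map V V f"
  shows "gen_poly V (\<lambda>n. f (u n)) l = f (gen_poly V u l)"
proof -
  have s: "{n. f (u n) \<noteq> 0} \<subseteq> {n. u n \<noteq> 0}" using linear_zero[OF assms(3)] by auto
  show ?thesis unfolding gen_poly_superset[OF assms(1) s]
    unfolding gen_poly_superset[OF assms(1) order_refl]
    using assms(2) by (simp add: linear_sum[OF assms(3)] carrier_smul linear_mapD(3)[OF assms(3)])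
qed

lemma gen_poly_eqD:
  assumes "finite {n. u n \<noteq> 0}" "finite {n. v n \<noteq> 0}" "\<And>l. gen_poly V u l = gen_poly V v l"
  shows "u n = v n"
proof -
  have fin: "finite {n. - v n \<noteq> 0}" using assms(2) by simp
  have s: "finite {n. u n + - v n \<noteq> 0}"
    by (rule finite_subset[of _ "{n. u n \<noteq> 0} \<union> {n. v n \<noteq> 0}"]) (use assms in auto)
  have "gen_poly V (\<lambda>n. - v n) l = - gen_poly V v l" for l
    unfolding gen_poly_def by (simp add: sum_negf)
  then have "gen_poly V (\<lambda>n. u n + - v n) l \<in> {0}" for l
    using gen_poly_add[OF assms(1) fin] assms(3) by simp
  then have "u n + - v n \<in> {0}"
    by (rule gen_poly_coefficients[OF s vs.subspace_single_0])
  then show ?thesis by simp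
qed

end

section \<open>Brackets and ideals\<close>

context lie_conformal_superalgebra begin

abbreviation "B \<equiv> bracket R"
abbreviation "D \<equiv> der R"
abbreviation "C \<equiv> carrier R"
abbreviation "sg \<equiv> parity_map R"

lemma D_closed: "x \<in> C \<Longrightarrow> D x \<in> C"
  and D_add: "x \<in> C \<Longrightarrow> y \<in> C \<Longrightarrow> D (x + y) = D x + D y"
  and D_smul: "x \<in> C \<Longrightarrow> D (smul R c x) = smul R c (D x)"
  using linear_mapD[OF der_linear] by auto

lemma nprod_closed: "a \<in> C \<Longrightarrow> b \<in> C \<Longrightarrow> nprod R n a b \<in> C"
  using linear_mapD(1)[OF nprod_linear_left] .

lemma B_linear_right: assumes "a \<in> C" shows "linear_map R R (\<lambda>b. B l a b)"
proof -
  note n = linear_mapD[OF nprod_linear_right[OF assms]]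
  have fin: "finite {n. nprod R n a b \<noteq> 0}" if "b \<in> C" for b by (rule nprod_finite[OF assms that])
  have "B l a (smul R c b) = smul R c (B l a b)" if "b \<in> C" for b c
    unfolding bracket_def using that
    by (simp add: n(3) gen_poly_linear_image[OF fin _ linear_scale[OF linear_id]] n(1))
  moreover have "B l a b \<in> C" if "b \<in> C" for b
    unfolding bracket_def gen_poly_def using that n(1) by (intro carrier_sum carrier_smul) auto
  ultimately show ?thesis
    unfolding linear_map_def using n(2) fin by (simp add: bracket_def gen_poly_add)
qed

lemma B_linear_left: assumes "b \<in> C" shows "linear_map R R (\<lambda>a. B l a b)"
proof -
  note n = linear_mapD[OF nprod_linear_left[OF assms]]
  have fin: "finite {n. nprod R n a b \<noteq> 0}" if "a \<in> C" for a by (rule nprod_finite[OF that assms])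
  have "B l (smul R c a) b = smul R c (B l a b)" if "a \<in> C" for a c
    unfolding bracket_def using that
    by (simp add: n(3) gen_poly_linear_image[OF fin _ linear_scale[OF linear_id]] n(1))
  moreover have "B l a b \<in> C" if "a \<in> C" for a
    using linear_mapD(1)[OF B_linear_right[OF that] assms] .
  ultimately show ?thesis
    unfolding linear_map_def using n(2) fin by (simp add: bracket_def gen_poly_add)
qed

lemmas B_closed = linear_mapD(1)[OF B_linear_right]
  and B_add_right = linear_mapD(2)[OF B_linear_right]
  and B_smul_right = linear_mapD(3)[OF B_linear_right]
  and B_zero_right = linear_zero[OF B_linear_right]
  and B_diff_right = linear_diff[OF B_linear_right]
  and B_uminus_right = linear_uminus[OF B_linear_right]
  and B_add_left = linear_mapD(2)[OF B_linear_left]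
  and B_smul_left = linear_mapD(3)[OF B_linear_left]
  and B_zero_left = linear_zero[OF B_linear_left]
  and B_diff_left = linear_diff[OF B_linear_left]
  and B_uminus_left = linear_uminus[OF B_linear_left]

lemma B_polynomial_family: "a \<in> C \<Longrightarrow> b \<in> C \<Longrightarrow> polynomial_family R (\<lambda>l. B l a b)"
  unfolding bracket_def by (rule gen_poly_polynomial_family) (auto intro: nprod_finite nprod_closed)

lemma B_gr: "a \<in> gr R p \<Longrightarrow> b \<in> gr R q \<Longrightarrow> B l a b \<in> gr R (p + q)"
  unfolding bracket_def gen_poly_def
  by (intro vs.subspace_sum[OF subspace_gr] gr_smul nprod_parity)

lemma D_homogeneous: "homogeneous_map R 0 D"
  using der_linear der_even by (simp add: homogeneous_map_def)

lemma D_sg: "x \<in> C \<Longrightarrow> D (sg s x) = sg s (D x)"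
  using homogeneous_map_parity_map[OF D_homogeneous] by simp

lemma B_sg: assumes "a \<in> C" "b \<in> C" shows "sg s (B l a b) = B l (sg s a) (sg s b)"
proof (rule linear_ext[OF assms(1)])
  have sb: "sg s b \<in> C" by (rule parity_map_closed[OF assms(2)])
  show "linear_map R R (\<lambda>a. sg s (B l a b))" "linear_map R R (\<lambda>a. B l (sg s a) (sg s b))"
    using linear_comp[OF linear_parity_map B_linear_left[OF assms(2)]]
      linear_comp[OF B_linear_left[OF sb] linear_parity_map] .
  fix a p assume a: "a \<in> gr R p"
  then have aC: "a \<in> C" "sg s a \<in> C" using gr_carrier parity_map_closed by auto
  show "sg s (B l a b) = B l (sg s a) (sg s b)"
  proof (rule linear_ext[OF assms(2)])
    show "linear_map R R (\<lambda>b. sg s (B l a b))" "linear_map R R (\<lambda>b. B l (sg s a) (sg s b))"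
      using linear_comp[OF linear_parity_map B_linear_right[OF aC(1)]]
        linear_comp[OF B_linear_right[OF aC(2)] linear_parity_map] .
    fix b q assume b: "b \<in> gr R q"
    then show "sg s (B l a b) = B l (sg s a) (sg s b)"
      using a aC gr_carrier[OF b] by (simp add: parity_map_gr[OF a] parity_map_gr[OF b]
          parity_map_gr[OF B_gr[OF a b]] B_smul_left B_smul_right B_closed carrier_smul koszul_add)
  qed
qed

text \<open>The Koszul sign can be attached to \<open>a\<close>, but it depends on the parity of
  \<open>b\<close>. So only \<open>b\<close> is split in the result, and the odd summand carries
  \<open>sg 1 a\<close>.\<close>

lemma B_jacobi:
  assumes "a \<in> C" "b \<in> C" "c \<in> C"
  shows "B l a (B m b c) = B (l + m) (B l a b) c
    + (B m (proj R 0 b) (B l a c) + B m (proj R 1 b) (B l (sg 1 a) c))"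
proof -
  have J: "B l a (B m b c) = B (l + m) (B l a b) c + B m b (B l (sg q a) c)"
    if a: "a \<in> gr R p" and b: "b \<in> gr R q" for a b p q
    using jacobi[OF a b assms(3), of l m] assms(3) gr_carrier[OF a] gr_carrier[OF b]
    by (simp add: parity_map_gr[OF a] B_smul_left B_smul_right B_closed koszul_commute)
  define a0 a1 b0 b1 where ab: "a0 = proj R 0 a" "a1 = proj R 1 a" "b0 = proj R 0 b" "b1 = proj R 1 b"
  have g: "a0 \<in> gr R 0" "a1 \<in> gr R 1" "b0 \<in> gr R 0" "b1 \<in> gr R 1"
    using proj_mem_gr assms unfolding ab by auto
  have c: "a0 \<in> C" "a1 \<in> C" "b0 \<in> C" "b1 \<in> C" using g gr_carrier by auto
  have s: "sg 1 a0 \<in> C" "sg 1 a1 \<in> C" using c parity_map_closed by auto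
  have a: "a = a0 + a1" and b: "b = b0 + b1" using proj_decomp assms unfolding ab by auto
  have p: "proj R 0 b = b0" "proj R 1 b = b1" by (simp_all add: ab)
  note lin = B_closed B_add_left B_add_right carrier_add parity_map_add
  show ?thesis unfolding p unfolding a b using c s assms(3)
    by (simp add: lin J[OF g(1,3)] J[OF g(1,4)] J[OF g(2,3)] J[OF g(2,4)] parity_map_0 algebra_simps)
qed

lemma B_D_left: "a \<in> C \<Longrightarrow> b \<in> C \<Longrightarrow> B l (D a) b = - smul R l (B l a b)"
  and B_D_right: "a \<in> C \<Longrightarrow> b \<in> C \<Longrightarrow> B l a (D b) = D (B l a b) + smul R l (B l a b)"
  by (rule sesquilinear_left, assumption+) (rule sesquilinear_right)

text \<open>Bracket values replace \<open>n\<close>-products and the parity automorphism replaces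
  components; by \<open>lcs_ideal_iff\<close> the notion is the same.\<close>

definition conformal_ideal :: "'a set \<Rightarrow> bool" where
  "conformal_ideal J \<longleftrightarrow> graded_subspace J \<and> (\<forall>x\<in>J. D x \<in> J) \<and> (\<forall>l. \<forall>a\<in>C. \<forall>x\<in>J. B l a x \<in> J)"

lemma conformal_idealD:
  assumes "conformal_ideal J"
  shows "graded_subspace J" "vs.subspace J" "J \<subseteq> C" "x \<in> J \<Longrightarrow> x \<in> C" "x \<in> J \<Longrightarrow> D x \<in> J"
    "a \<in> C \<Longrightarrow> x \<in> J \<Longrightarrow> B l a x \<in> J" "x \<in> J \<Longrightarrow> sg s x \<in> J" "x \<in> J \<Longrightarrow> proj R p x \<in> J"
    "0 \<in> J" "x \<in> J \<Longrightarrow> y \<in> J \<Longrightarrow> x + y \<in> J" "x \<in> J \<Longrightarrow> y \<in> J \<Longrightarrow> x - y \<in> J"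
    "x \<in> J \<Longrightarrow> smul R c x \<in> J" "x \<in> J \<Longrightarrow> - x \<in> J"
proof -
  show g: "graded_subspace J" using assms by (simp add: conformal_ideal_def)
  then show s: "vs.subspace J" and "J \<subseteq> C" by (simp_all add: graded_subspace_def)
  then show "x \<in> J \<Longrightarrow> x \<in> C" by blast
  show "x \<in> J \<Longrightarrow> D x \<in> J" "a \<in> C \<Longrightarrow> x \<in> J \<Longrightarrow> B l a x \<in> J"
    using assms by (simp_all add: conformal_ideal_def)
  show "x \<in> J \<Longrightarrow> sg s x \<in> J" "x \<in> J \<Longrightarrow> proj R p x \<in> J"
    by (rule graded_subspace_parity_map[OF g] graded_subspace_proj[OF g], assumption)+
  show "0 \<in> J" "x \<in> J \<Longrightarrow> y \<in> J \<Longrightarrow> x + y \<in> J" "x \<in> J \<Longrightarrow> y \<in> J \<Longrightarrow> x - y \<in> J"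
    "x \<in> J \<Longrightarrow> smul R c x \<in> J" "x \<in> J \<Longrightarrow> - x \<in> J"
    using vs.subspace_0[OF s] vs.subspace_add[OF s] vs.subspace_diff[OF s] vs.subspace_scale[OF s]
      vs.subspace_neg[OF s] by blast+
qed

lemma conformal_ideal_carrier: "conformal_ideal C"
  by (simp add: conformal_ideal_def graded_subspace_def subspace_carrier parity_map_closed D_closed B_closed)

text \<open>Skew-symmetry substitutes \<open>- l - D\<close> for the parameter, and \<open>J\<close>
  is stable under this operator.\<close>

lemma conformal_ideal_left:
  assumes J: "conformal_ideal J" and x: "x \<in> J" and b: "b \<in> C"
  shows "B l x b \<in> J"
proof -
  note I = conformal_idealD[OF J]
  have T: "((\<lambda>x. - smul R l x - D x) ^^ n) y \<in> J" if "y \<in> J" for n y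
    by (induction n) (use that I in auto)
  have nJ: "nprod R n b y \<in> J" if "b \<in> C" "y \<in> J" for b y n
    using gen_poly_coefficients[OF nprod_finite[OF that(1) I(4)[OF that(2)]] I(2)] I(6)[OF that]
    unfolding bracket_def by blast
  have h: "B l x b \<in> J" if "x \<in> J" "x \<in> gr R p" "b \<in> gr R q" for x b p q
  proof -
    have "gen_poly_op R (\<lambda>n. nprod R n b x) (\<lambda>x. - smul R l x - D x) \<in> J"
      unfolding gen_poly_op_def using that gr_carrier
      by (intro vs.subspace_sum[OF I(2)] I(12) T nJ) auto
    then show ?thesis unfolding skew[OF that(3,2)] using I(12,13) by simp
  qed
  have p: "proj R p x \<in> J" "proj R p x \<in> gr R p" "proj R p b \<in> gr R p" for p
    using I(8)[OF x] proj_mem_gr I(4)[OF x] b by auto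
  have c: "proj R p x \<in> C" "proj R p b \<in> C" for p using I(4)[OF x] b proj_carrier by auto
  have "B l (proj R 0 x + proj R 1 x) (proj R 0 b + proj R 1 b) \<in> J"
    using h[OF p(1,2) p(3)] c by (simp add: B_add_left B_add_right carrier_add I(10))
  then show ?thesis using proj_decomp I(4)[OF x] b by simp
qed

lemma lcs_ideal_iff: "lcs_ideal R J \<longleftrightarrow> conformal_ideal J"
proof
  assume L: "lcs_ideal R J"
  then have s: "vs.subspace J" "J \<subseteq> C"
    and split: "\<And>x. x \<in> J \<Longrightarrow> \<exists>y\<in>J \<inter> gr R 0. \<exists>z\<in>J \<inter> gr R 1. x = y + z"
    and d: "\<And>x. x \<in> J \<Longrightarrow> D x \<in> J" and n: "\<And>n a x. a \<in> C \<Longrightarrow> x \<in> J \<Longrightarrow> nprod R n a x \<in> J"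
    by (simp_all add: lcs_ideal_def)
  have "sg 1 x \<in> J" if x: "x \<in> J" for x
  proof -
    obtain y z where yz: "x = y + z" "y \<in> J" "y \<in> gr R 0" "z \<in> J" "z \<in> gr R 1"
      using split[OF x] by blast
    have "sg 1 x = y - z"
      unfolding yz(1) using parity_map_gr[OF yz(3)] parity_map_gr[OF yz(5)] yz(3,5)
      by (simp add: parity_map_add[OF gr_carrier gr_carrier])
    then show ?thesis using vs.subspace_diff[OF s(1) yz(2,4)] by simp
  qed
  moreover have "B l a x \<in> J" if "a \<in> C" "x \<in> J" for a x l
    unfolding bracket_def gen_poly_def
    using n[OF that] by (intro vs.subspace_sum[OF s(1)] vs.subspace_scale[OF s(1)])
  ultimately show "conformal_ideal J"
    using s d by (simp add: conformal_ideal_def graded_subspace_def)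
next
  assume J: "conformal_ideal J"
  note I = conformal_idealD[OF J]
  have "nprod R n b y \<in> J" if "b \<in> C" "y \<in> J" for b y n
    using gen_poly_coefficients[OF nprod_finite[OF that(1) I(4)[OF that(2)]] I(2)] I(6)[OF that]
    unfolding bracket_def by blast
  moreover have "\<exists>y\<in>J \<inter> gr R 0. \<exists>z\<in>J \<inter> gr R 1. x = y + z" if "x \<in> J" for x
    using I(8)[OF that] proj_decomp[OF I(4)[OF that]] proj_mem_gr[OF I(4)[OF that]] by blast
  ultimately show "lcs_ideal R J" using I(2,3,5) by (simp add: lcs_ideal_def)
qed

end

section \<open>Centroid and derivations of arbitrary degree\<close>

text \<open>The model, in degree 0, is left multiplication by an element of a supercommutative
  algebra \<open>B\<close> on \<open>S \<otimes> B\<close>; the twist of \<open>x\<close> is the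
  sign of moving that element past \<open>x\<close>.\<close>

definition centroid_map ::
  "('a::ab_group_add, 'm) lcs_scheme \<Rightarrow> bit \<Rightarrow> complex \<Rightarrow> ('a \<Rightarrow> 'a) \<Rightarrow> bool" where
  "centroid_map R s l f \<longleftrightarrow> homogeneous_map R s f \<and>
     (\<forall>x\<in>carrier R. f (der R x) = der R (f x) + smul R l (f x)) \<and>
     (\<forall>m. \<forall>x\<in>carrier R. \<forall>y\<in>carrier R.
        f (bracket R m x y) = bracket R m (parity_map R s x) (f y))"

definition derivation_at ::
  "('a::ab_group_add, 'm) lcs_scheme \<Rightarrow> bit \<Rightarrow> complex \<Rightarrow> ('a \<Rightarrow> 'a) \<Rightarrow> bool" where
  "derivation_at R s l f \<longleftrightarrow> homogeneous_map R s f \<and>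
     (\<forall>x\<in>carrier R. f (der R x) = der R (f x) + smul R l (f x)) \<and>
     (\<forall>m. \<forall>x\<in>carrier R. \<forall>y\<in>carrier R.
        f (bracket R m x y) = bracket R (l + m) (f x) y + bracket R m (parity_map R s x) (f y))"

text \<open>Of a conformal derivation only the values and their polynomial dependence on
  \<open>l\<close> are kept. Each value is a linear map that can be composed with centroid
  maps.\<close>

definition derivation_family ::
  "('a::ab_group_add, 'm) lcs_scheme \<Rightarrow> bit \<Rightarrow> (complex \<Rightarrow> 'a \<Rightarrow> 'a) \<Rightarrow> bool" where
  "derivation_family R s \<phi> \<longleftrightarrow> (\<forall>l. derivation_at R s l (\<phi> l)) \<and>
     (\<forall>x\<in>carrier R. polynomial_family R (\<lambda>l. \<phi> l x))"

definition supercommutator ::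
  "('a::ab_group_add, 'm) superspace_scheme \<Rightarrow> bit \<Rightarrow> bit \<Rightarrow> ('a \<Rightarrow> 'a) \<Rightarrow> ('a \<Rightarrow> 'a) \<Rightarrow> 'a \<Rightarrow> 'a" where
  "supercommutator V s t f g = (\<lambda>x. f (g x) - smul V (koszul s t) (g (f x)))"

definition bracket_span :: "('a::ab_group_add, 'm) lcs_scheme \<Rightarrow> 'a set \<Rightarrow> 'a set" where
  "bracket_span R X = module.span (smul R) {bracket R m a x |m a x. a \<in> carrier R \<and> x \<in> X}"

context super_space begin

lemma homogeneous_map_supercommutator:
  assumes "homogeneous_map V s f" "homogeneous_map V t g"
  shows "homogeneous_map V (s + t) (supercommutator V s t f g)"
  unfolding supercommutator_def
  using homogeneous_map_comp[OF assms] homogeneous_map_comp[OF assms(2,1)]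
  by (intro homogeneous_map_diff homogeneous_map_scale) (simp_all add: add.commute)

lemma homogeneous_mapD:
  assumes "homogeneous_map V s f"
  shows "x \<in> carrier V \<Longrightarrow> f x \<in> carrier V"
    "x \<in> carrier V \<Longrightarrow> y \<in> carrier V \<Longrightarrow> f (x + y) = f x + f y"
    "x \<in> carrier V \<Longrightarrow> f (smul V c x) = smul V c (f x)"
    "x \<in> carrier V \<Longrightarrow> y \<in> carrier V \<Longrightarrow> f (x - y) = f x - f y"
    "x \<in> carrier V \<Longrightarrow> f (- x) = - f x"
    "f 0 = 0"
    "x \<in> carrier V \<Longrightarrow> f (parity_map V t x) = smul V (koszul s t) (parity_map V t (f x))"
  using homogeneous_map_linear[OF assms] homogeneous_map_parity_map[OF assms]
  by (auto intro: linear_mapD linear_diff linear_uminus linear_zero)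

lemma homogeneous_map_0_id: "homogeneous_map V 0 (\<lambda>x. x)"
  by (simp add: homogeneous_map_def linear_id)

end

context lie_conformal_superalgebra begin

lemmas ops = B_closed B_add_left B_add_right B_smul_left B_smul_right B_zero_left B_zero_right
  B_diff_left B_diff_right B_uminus_left B_uminus_right D_closed D_add D_smul
  linear_diff[OF der_linear]
  carrier_add carrier_smul carrier_diff carrier_uminus parity_map_closed parity_map_add parity_map_smul

lemma centroid_mapD:
  assumes "centroid_map R s l f"
  shows "homogeneous_map R s f" "x \<in> C \<Longrightarrow> f (D x) = D (f x) + smul R l (f x)"
    "x \<in> C \<Longrightarrow> y \<in> C \<Longrightarrow> f (B m x y) = B m (sg s x) (f y)"
  using assms by (auto simp: centroid_map_def)

lemma derivation_atD:
  assumes "derivation_at R s l f"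
  shows "homogeneous_map R s f" "x \<in> C \<Longrightarrow> f (D x) = D (f x) + smul R l (f x)"
    "x \<in> C \<Longrightarrow> y \<in> C \<Longrightarrow> f (B m x y) = B (l + m) (f x) y + B m (sg s x) (f y)"
  using assms by (auto simp: derivation_at_def)

lemma centroid_map_nprod:
  assumes f: "centroid_map R s l f" and a: "a \<in> C" and b: "b \<in> C"
  shows "f (nprod R n a b) = nprod R n (sg s a) (f b)"
proof (rule gen_poly_eqD)
  note h = homogeneous_mapD[OF centroid_mapD(1)[OF f]]
  have lin: "linear_map R R f" by (rule homogeneous_map_linear[OF centroid_mapD(1)[OF f]])
  have fin: "finite {n. nprod R n a b \<noteq> 0}" by (rule nprod_finite[OF a b])
  show "finite {n. f (nprod R n a b) \<noteq> 0}"
    by (rule finite_subset[OF _ fin]) (use h(6) in auto)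
  show "finite {n. nprod R n (sg s a) (f b) \<noteq> 0}"
    by (rule nprod_finite) (use a b h(1) parity_map_closed in auto)
  show "gen_poly R (\<lambda>n. f (nprod R n a b)) m = gen_poly R (\<lambda>n. nprod R n (sg s a) (f b)) m" for m
    using centroid_mapD(3)[OF f a b, of m] gen_poly_linear_image[OF fin _ lin] nprod_closed[OF a b]
    by (simp add: bracket_def)
qed

lemma gen_poly_op_superset:
  assumes "finite A" "{n. u n \<noteq> 0} \<subseteq> A" "T 0 = 0"
  shows "gen_poly_op R u T = (\<Sum>n\<in>A. smul R (1 / fact n) ((T ^^ n) (u n)))"
proof -
  have "(T ^^ n) 0 = 0" for n by (induction n) (simp_all add: assms(3))
  then show ?thesis unfolding gen_poly_op_def using assms(1,2) by (intro sum.mono_neutral_left) auto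
qed

text \<open>The defining condition concerns the second argument; skew-symmetry transfers it to the first.\<close>

lemma centroid_map_left:
  assumes f: "centroid_map R s l f" and y: "y \<in> C" and b: "b \<in> C"
  shows "f (B m y b) = B (l + m) (f y) b"
proof -
  note h = homogeneous_mapD[OF centroid_mapD(1)[OF f]]
  have lin: "linear_map R R f" by (rule homogeneous_map_linear[OF centroid_mapD(1)[OF f]])
  have main: "f (B m y b) = B (l + m) (f y) b" if yp: "y \<in> gr R p" and bq: "b \<in> gr R q" for y b p q
  proof -
    have yb: "y \<in> C" "b \<in> C" "f y \<in> C" using yp bq gr_carrier h(1) by auto
    have fy: "f y \<in> gr R (s + p)" using centroid_mapD(1)[OF f] yp by (simp add: homogeneous_map_def)
    let ?T = "\<lambda>x. - smul R m x - D x" and ?T' = "\<lambda>x. - smul R (l + m) x - D x"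
    let ?u = "\<lambda>n. nprod R n b y" and ?v = "\<lambda>n. nprod R n b (f y)"
    let ?A = "{n. ?u n \<noteq> 0} \<union> {n. ?v n \<noteq> 0}"
    have A: "finite ?A" using nprod_finite yb by simp
    have D0: "D 0 = 0" by (rule linear_zero[OF der_linear])
    have TC: "(?T ^^ n) x \<in> C" if "x \<in> C" for n x
      by (induction n) (use that in \<open>simp_all add: ops\<close>)
    have TC': "(?T' ^^ n) x \<in> C" if "x \<in> C" for n x
      by (induction n) (use that in \<open>simp_all add: ops\<close>)
    \<comment> \<open>\<open>f\<close> intertwines the two substituted operators; here the bracket
      parameter acquires the shift \<open>l\<close>.\<close>
    have fT: "f ((?T ^^ n) x) = (?T' ^^ n) (f x)" if "x \<in> C" for n x
    proof (induction n)
      case (Suc n)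
      let ?z = "(?T ^^ n) x"
      have z: "?z \<in> C" by (rule TC[OF that])
      have "f (- smul R m ?z - D ?z) = - smul R (l + m) (f ?z) - D (f ?z)"
        using z by (simp add: h ops centroid_mapD(2)[OF f] vs.scale_left_distrib algebra_simps)
      then show ?case using Suc by simp
    qed simp
    have T'k: "(?T' ^^ n) (smul R c x) = smul R c ((?T' ^^ n) x)" if "x \<in> C" for c n x
    proof (induction n)
      case (Suc n)
      then show ?case using TC'[OF that, of n]
        by (simp add: D_smul vs.scale_right_diff_distrib mult.commute)
    qed simp
    have fu: "f (?u n) = smul R (koszul s q) (?v n)" for n
      unfolding centroid_map_nprod[OF f yb(2,1)] parity_map_gr[OF bq]
      using linear_mapD(3)[OF nprod_linear_left[OF yb(3)] yb(2)] .
    have "f (gen_poly_op R ?u ?T) = (\<Sum>n\<in>?A. smul R (1 / fact n) (f ((?T ^^ n) (?u n))))"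
      using A yb D0
      by (subst gen_poly_op_superset[of ?A]) (auto simp: linear_sum[OF lin] h carrier_smul TC nprod_closed)
    also have "\<dots> = (\<Sum>n\<in>?A. smul R (koszul s q) (smul R (1 / fact n) ((?T' ^^ n) (?v n))))"
      using yb by (simp add: fT nprod_closed fu T'k mult.commute)
    also have "\<dots> = smul R (koszul s q) (gen_poly_op R ?v ?T')"
      using A D0 by (subst gen_poly_op_superset[of ?A ?v]) (auto simp: vs.scale_sum_right)
    finally have g: "f (gen_poly_op R ?u ?T) = smul R (koszul s q) (gen_poly_op R ?v ?T')" .
    have gC: "gen_poly_op R ?u ?T \<in> C"
      using A D0 yb by (subst gen_poly_op_superset[of ?A]) (auto intro!: carrier_sum carrier_smul TC nprod_closed)
    show ?thesis
      unfolding skew[OF bq yp] skew[OF bq fy] using gC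
      by (simp add: h ops g koszul_add koszul_commute[of q s] mult.commute)
  qed
  let ?y = "\<lambda>p. proj R p y" and ?b = "\<lambda>p. proj R p b"
  have g: "?y p \<in> gr R p" "?b p \<in> gr R p" "?y p \<in> C" "?b p \<in> C" for p
    using proj_mem_gr proj_carrier y b by auto
  have "f (B m (?y 0 + ?y 1) (?b 0 + ?b 1)) = B (l + m) (f (?y 0 + ?y 1)) (?b 0 + ?b 1)"
    using g(3,4) by (simp add: ops h main[OF g(1,2)])
  then show ?thesis using proj_decomp y b by simp
qed

lemma centroid_map_id: "centroid_map R 0 0 (\<lambda>x. x)"
  by (simp add: centroid_map_def homogeneous_map_0_id parity_map_0)

lemma centroid_map_comp:
  assumes f: "centroid_map R s l f" and g: "centroid_map R t m g"
  shows "centroid_map R (s + t) (l + m) (\<lambda>x. f (g x))"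
proof -
  note F = homogeneous_mapD[OF centroid_mapD(1)[OF f]] and G = homogeneous_mapD[OF centroid_mapD(1)[OF g]]
  show ?thesis unfolding centroid_map_def
    using homogeneous_map_comp[OF centroid_mapD(1)[OF f] centroid_mapD(1)[OF g]]
    by (simp add: F G ops centroid_mapD(2,3)[OF f] centroid_mapD(2,3)[OF g] parity_map_parity_map
        vs.scale_left_distrib algebra_simps)
qed

text \<open>Derivations form a module over the centroid. The Leibniz term with \<open>g x\<close> in
  the first slot is treated by \<open>centroid_map_left\<close>, which supplies the additional
  degree.\<close>

lemma derivation_at_centroid_comp:
  assumes f: "centroid_map R s l f" and g: "derivation_at R t m g"
  shows "derivation_at R (s + t) (l + m) (\<lambda>x. f (g x))"
proof -
  note F = homogeneous_mapD[OF centroid_mapD(1)[OF f]] and G = homogeneous_mapD[OF derivation_atD(1)[OF g]]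
  have "f (B k (g x) y) = B (l + k) (f (g x)) y" if "x \<in> C" "y \<in> C" for k x y
    using centroid_map_left[OF f _ that(2)] G(1)[OF that(1)] by blast
  then show ?thesis unfolding derivation_at_def
    using homogeneous_map_comp[OF centroid_mapD(1)[OF f] derivation_atD(1)[OF g]]
    by (simp add: F G ops centroid_mapD(2,3)[OF f] derivation_atD(2,3)[OF g] parity_map_parity_map
        vs.scale_left_distrib add.assoc)
qed

text \<open>In both composites one Leibniz term pairs a derivative of \<open>x\<close> with
  \<open>g y\<close>. These terms agree up to the sign \<open>koszul s t\<close> and cancel, so no
  derivative of \<open>x\<close> survives.\<close>

lemma centroid_map_supercommutator:
  assumes f: "derivation_at R s l f" and g: "centroid_map R t m g"
  shows "centroid_map R (s + t) (l + m) (supercommutator R s t f g)"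
proof -
  note F = homogeneous_mapD[OF derivation_atD(1)[OF f]] and G = homogeneous_mapD[OF centroid_mapD(1)[OF g]]
  have gl: "g (B k (f x) y) = B (m + k) (f (g x)) y" if "x \<in> C" "y \<in> C" "f (g x) = g (f x)" for k x y
    using centroid_map_left[OF g _ that(2)] F(1)[OF that(1)] that(3) by simp
  have "supercommutator R s t f g (B k x y) = B k (sg (s + t) x) (supercommutator R s t f g y)"
    if "x \<in> C" "y \<in> C" for k x y
  proof -
    have 1: "f (g (B k x y)) = B (l + k) (f (sg t x)) (g y) + B k (sg (s + t) x) (f (g y))"
      using that by (simp add: centroid_mapD(3)[OF g] derivation_atD(3)[OF f] ops F G parity_map_parity_map)
    have 2: "g (f (B k x y)) = B (l + k) (sg t (f x)) (g y) + B k (sg (s + t) x) (g (f y))"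
      using that by (simp add: centroid_mapD(3)[OF g] derivation_atD(3)[OF f] ops F G parity_map_parity_map
          add.commute[of t s])
    show ?thesis unfolding supercommutator_def 1 2 using that
      by (simp add: ops F G smul_add)
  qed
  then show ?thesis unfolding centroid_map_def
    using homogeneous_map_supercommutator[OF derivation_atD(1)[OF f] centroid_mapD(1)[OF g]]
    by (simp add: supercommutator_def F G ops centroid_mapD(2)[OF g] derivation_atD(2)[OF f]
        vs.scale_left_distrib smul_add vs.scale_right_diff_distrib distrib_left mult.commute)
qed

text \<open>The mixed Leibniz terms cancel in pairs. For an odd \<open>f = g\<close> this yields
  twice the square, so squares of odd derivations are derivations.\<close>

lemma derivation_at_supercommutator:
  assumes f: "derivation_at R s l f" and g: "derivation_at R t m g"
  shows "derivation_at R (s + t) (l + m) (supercommutator R s t f g)"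
proof -
  note F = homogeneous_mapD[OF derivation_atD(1)[OF f]] and G = homogeneous_mapD[OF derivation_atD(1)[OF g]]
  have "supercommutator R s t f g (B k x y) = B (l + m + k) (supercommutator R s t f g x) y
      + B k (sg (s + t) x) (supercommutator R s t f g y)"
    if "x \<in> C" "y \<in> C" for k x y
  proof -
    have 1: "f (g (B k x y)) = B (l + m + k) (f (g x)) y + B (m + k) (sg s (g x)) (f y)
        + (B (l + k) (f (sg t x)) (g y) + B k (sg (s + t) x) (f (g y)))"
      using that by (simp add: derivation_atD(3)[OF f] derivation_atD(3)[OF g] ops F G parity_map_parity_map add.assoc)
    have 2: "g (f (B k x y)) = B (l + m + k) (g (f x)) y + B (l + k) (sg t (f x)) (g y)
        + (B (m + k) (g (sg s x)) (f y) + B k (sg (s + t) x) (g (f y)))"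
      using that by (simp add: derivation_atD(3)[OF f] derivation_atD(3)[OF g] ops F G parity_map_parity_map
          add.commute[of t s] add.assoc add.left_commute)
    show ?thesis unfolding supercommutator_def 1 2 using that koszul_commute[of t s]
      by (simp add: ops F G smul_add)
  qed
  then show ?thesis unfolding derivation_at_def
    using homogeneous_map_supercommutator[OF derivation_atD(1)[OF f] derivation_atD(1)[OF g]]
    by (simp add: supercommutator_def F G ops derivation_atD(2)[OF g] derivation_atD(2)[OF f]
        vs.scale_left_distrib smul_add vs.scale_right_diff_distrib distrib_left mult.commute)
qed

lemma derivation_at_diff:
  assumes f: "derivation_at R s l f" and g: "derivation_at R s l g"
  shows "derivation_at R s l (\<lambda>x. f x - g x)"
proof -
  note F = homogeneous_mapD[OF derivation_atD(1)[OF f]] and G = homogeneous_mapD[OF derivation_atD(1)[OF g]]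
  show ?thesis unfolding derivation_at_def
    using homogeneous_map_diff[OF derivation_atD(1)[OF f] derivation_atD(1)[OF g]]
    by (simp add: F G ops derivation_atD(2,3)[OF f] derivation_atD(2,3)[OF g] vs.scale_right_diff_distrib)
qed

text \<open>The degree shift and the sign twist can be undone inside the argument of
  \<open>f\<close>.\<close>

lemma centroid_map_image_ideal:
  assumes f: "centroid_map R s l f" and J: "conformal_ideal J"
  shows "conformal_ideal (f ` J)"
proof -
  note F = homogeneous_mapD[OF centroid_mapD(1)[OF f]] and I = conformal_idealD[OF J]
  have sub: "vs.subspace (f ` J)"
  proof (rule vs.subspaceI)
    show "0 \<in> f ` J" using F(6) I(9) by force
    show "x + y \<in> f ` J" if "x \<in> f ` J" "y \<in> f ` J" for x y
      using that F(2) I(4,10) by (smt (verit, best) image_iff)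
    show "smul R c x \<in> f ` J" if "x \<in> f ` J" for c x
      using that F(3) I(4,12) by (smt (verit, best) image_iff)
  qed
  have c: "f ` J \<subseteq> C" using F(1) I(4) by blast
  have "sg 1 (f x) \<in> f ` J" if "x \<in> J" for x
  proof -
    have "f (smul R (koszul s 1) (sg 1 x)) = sg 1 (f x)"
      using I(4)[OF that] by (simp add: F ops)
    then show ?thesis using I(7,12) that by (metis imageI)
  qed
  then have g: "graded_subspace (f ` J)" using sub c by (auto intro: graded_subspaceI)
  have "D (f x) \<in> f ` J" if "x \<in> J" for x
  proof -
    have "D (f x) = f (D x - smul R l x)"
      using I(4)[OF that] by (simp add: F ops centroid_mapD(2)[OF f])
    then show ?thesis using that I(5,11,12) by blast
  qed
  moreover have "B m a (f x) \<in> f ` J" if "a \<in> C" "x \<in> J" for m a x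
  proof -
    have "B m a (f x) = f (B m (sg s a) x)"
      using I(4)[OF that(2)] that(1) by (simp add: centroid_mapD(3)[OF f] ops parity_map_involution)
    then show ?thesis using that I(6) parity_map_closed by blast
  qed
  ultimately show ?thesis using g by (auto simp: conformal_ideal_def)
qed

lemma centroid_map_kernel_ideal:
  assumes f: "centroid_map R s l f"
  shows "conformal_ideal {x \<in> C. f x = 0}"
proof -
  note F = homogeneous_mapD[OF centroid_mapD(1)[OF f]]
  have D0: "D 0 = 0" by (rule linear_zero[OF der_linear])
  have s0: "sg s 0 = 0" for s by (rule linear_zero[OF linear_parity_map])
  have "vs.subspace {x \<in> C. f x = 0}"
    by (rule vs.subspaceI) (auto simp: F ops)
  then show ?thesis
    by (auto simp: conformal_ideal_def graded_subspace_def F ops centroid_mapD(2,3)[OF f] D0 s0)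
qed

section \<open>Ideals spanned by brackets, and stability\<close>

lemma bracket_span_superset: "a \<in> C \<Longrightarrow> x \<in> X \<Longrightarrow> B m a x \<in> bracket_span R X"
  unfolding bracket_span_def by (rule vs.span_base) blast

lemma subspace_bracket_span: "vs.subspace (bracket_span R X)"
  unfolding bracket_span_def by (rule vs.subspace_span)

lemma bracket_span_induct:
  assumes y: "y \<in> bracket_span R X" and P: "vs.subspace P"
    and "\<And>m a x. a \<in> C \<Longrightarrow> x \<in> X \<Longrightarrow> B m a x \<in> P"
  shows "y \<in> P"
  using vs.span_minimal[OF _ P, of "{B m a x |m a x. a \<in> C \<and> x \<in> X}"] y assms(3)
  unfolding bracket_span_def by blast

lemma subspace_preimage:
  assumes "linear_map R R f" "vs.subspace P"
  shows "vs.subspace {x \<in> C. f x \<in> P}"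
  by (rule vs.subspaceI) (use linear_mapD[OF assms(1)] linear_zero[OF assms(1)] vs.subspace_0[OF assms(2)]
    vs.subspace_add[OF assms(2)] vs.subspace_scale[OF assms(2)] carrier_add carrier_smul in auto)

lemma bracket_span_map:
  assumes y: "y \<in> bracket_span R X" and X: "X \<subseteq> C" and f: "linear_map R R f" and P: "vs.subspace P"
    and "\<And>m a x. a \<in> C \<Longrightarrow> x \<in> X \<Longrightarrow> f (B m a x) \<in> P"
  shows "f y \<in> P"
proof -
  have "y \<in> {x \<in> C. f x \<in> P}"
    by (rule bracket_span_induct[OF y subspace_preimage[OF f P]]) (use assms(5) X B_closed in auto)
  then show ?thesis by simp
qed

text \<open>Closure under \<open>B l b\<close> is the Jacobi identity: each resulting term again has
  its right factor in \<open>J\<close>.\<close>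

lemma bracket_span_ideal:
  assumes J: "conformal_ideal J"
  shows "conformal_ideal (bracket_span R J)" "bracket_span R J \<subseteq> J"
proof -
  note I = conformal_idealD[OF J]
  show sub: "bracket_span R J \<subseteq> J"
    using bracket_span_induct[OF _ I(2)] I(6) by blast
  note S = subspace_bracket_span[of J] and sup = bracket_span_superset[of _ _ J]
  have "sg 1 y \<in> bracket_span R J" if "y \<in> bracket_span R J" for y
    by (rule bracket_span_map[OF that I(3) linear_parity_map S])
      (use I(4,7) parity_map_closed in \<open>auto simp: B_sg intro!: sup\<close>)
  moreover have "D y \<in> bracket_span R J" if "y \<in> bracket_span R J" for y
  proof (rule bracket_span_map[OF that I(3) der_linear S])
    fix m a x assume ax: "a \<in> C" "x \<in> J"
    have "D (B m a x) = B m a (D x) - smul R m (B m a x)"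
      using ax I(4) by (simp add: B_D_right)
    then show "D (B m a x) \<in> bracket_span R J"
      using ax I(5) sup S by (simp add: vs.subspace_diff vs.subspace_scale)
  qed
  moreover have "B l b y \<in> bracket_span R J" if b: "b \<in> C" and y: "y \<in> bracket_span R J" for l b y
  proof (rule bracket_span_map[OF y I(3) B_linear_right[OF b] S])
    fix m a x assume ax: "a \<in> C" "x \<in> J"
    show "B l b (B m a x) \<in> bracket_span R J"
      unfolding B_jacobi[OF b ax(1) I(4)[OF ax(2)]]
      by (intro vs.subspace_add[OF S] sup B_closed proj_carrier parity_map_closed b ax I(6))
  qed
  ultimately show "conformal_ideal (bracket_span R J)"
    using S sub I(3) by (auto simp: conformal_ideal_def graded_subspace_def)
qed

text \<open>Stability is tested against all derivation families at once. More derivations leave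
  fewer stable ideals, so simplicity relative to any one set implies
  \<open>derivation_simple\<close>, and derivations constructed later are covered
  automatically.\<close>

definition stable :: "'a set \<Rightarrow> bool" where
  "stable J \<longleftrightarrow> (\<forall>s \<phi> l. \<forall>x\<in>J. derivation_family R s \<phi> \<longrightarrow> \<phi> l x \<in> J)"

definition derivation_simple :: bool where
  "derivation_simple \<longleftrightarrow> (\<forall>J. conformal_ideal J \<and> stable J \<longrightarrow> J = {0} \<or> J = C)"

lemma derivation_familyD:
  assumes "derivation_family R s \<phi>"
  shows "derivation_at R s l (\<phi> l)" "homogeneous_map R s (\<phi> l)" "x \<in> C \<Longrightarrow> polynomial_family R (\<lambda>l. \<phi> l x)"
    "x \<in> C \<Longrightarrow> \<phi> l x \<in> C"
proof -
  show d: "derivation_at R s l (\<phi> l)" and "x \<in> C \<Longrightarrow> polynomial_family R (\<lambda>l. \<phi> l x)"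
    using assms by (simp_all add: derivation_family_def)
  show h: "homogeneous_map R s (\<phi> l)" by (rule derivation_atD(1)[OF d])
  show "x \<in> C \<Longrightarrow> \<phi> l x \<in> C" by (rule homogeneous_mapD(1)[OF h])
qed

lemma bracket_span_stable:
  assumes J: "conformal_ideal J" "stable J"
  shows "stable (bracket_span R J)"
  unfolding stable_def
proof (intro allI ballI impI)
  fix s \<phi> l x assume x: "x \<in> bracket_span R J" and p: "derivation_family R s \<phi>"
  note P = derivation_familyD[OF p] and S = subspace_bracket_span[of J] and I = conformal_idealD[OF J(1)]
  show "\<phi> l x \<in> bracket_span R J"
  proof (rule bracket_span_map[OF x I(3) homogeneous_map_linear[OF P(2)] S])
    fix m a x assume ax: "a \<in> C" "x \<in> J"
    have "\<phi> l x \<in> J" using J(2) ax(2) p unfolding stable_def by blast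
    then show "\<phi> l (B m a x) \<in> bracket_span R J"
      unfolding derivation_atD(3)[OF P(1) ax(1) I(4)[OF ax(2)]]
      by (intro vs.subspace_add[OF S] bracket_span_superset parity_map_closed P(4) ax)
  qed
qed

section \<open>The center and abelian algebras\<close>

definition center :: "'a set" where
  "center = {x \<in> C. \<forall>m. \<forall>a\<in>C. B m a x = 0}"

lemma center_ideal: "conformal_ideal center"
proof -
  have "vs.subspace center"
    by (rule vs.subspaceI) (auto simp: center_def ops)
  moreover have "B m a (sg 1 x) = 0" if x: "x \<in> C" "\<forall>m. \<forall>a\<in>C. B m a x = 0" and a: "a \<in> C" for m a x
  proof -
    have "B m a (sg 1 x) = sg 1 (B m (sg 1 a) x)" using x(1) a by (simp add: B_sg ops parity_map_involution)
    then show ?thesis using x(2) parity_map_closed[OF a] linear_zero[OF linear_parity_map] by simp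
  qed
  moreover have "D 0 = 0" by (rule linear_zero[OF der_linear])
  ultimately show ?thesis
    unfolding conformal_ideal_def graded_subspace_def by (auto simp: center_def ops B_D_right)
qed

lemma center_stable: "stable center"
  unfolding stable_def
proof (intro allI ballI impI)
  fix s \<phi> l x assume x: "x \<in> center" and p: "derivation_family R s \<phi>"
  note P = derivation_familyD[OF p]
  have xC: "x \<in> C" and z: "\<And>m a. a \<in> C \<Longrightarrow> B m a x = 0" using x by (auto simp: center_def)
  have "B m a (\<phi> l x) = 0" if a: "a \<in> C" for m a
  proof -
    \<comment> \<open>Starting from \<open>sg s a\<close> makes the Leibniz twist cancel, so the
      last term is the bracket in question.\<close>
    have "\<phi> l (B m (sg s a) x) = B (l + m) (\<phi> l (sg s a)) x + B m (sg s (sg s a)) (\<phi> l x)"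
      by (rule derivation_atD(3)[OF P(1) parity_map_closed[OF a] xC])
    then show ?thesis
      using z a P(4) parity_map_closed homogeneous_mapD(6)[OF P(2)] by (simp add: parity_map_involution)
  qed
  then show "\<phi> l x \<in> center" using P(4)[OF xC] by (simp add: center_def)
qed

lemma abelian_iff: "abelian R \<longleftrightarrow> (\<forall>a\<in>C. \<forall>b\<in>C. \<forall>m. B m a b = 0)"
proof
  show "abelian R \<Longrightarrow> \<forall>a\<in>C. \<forall>b\<in>C. \<forall>m. B m a b = 0"
    by (simp add: abelian_def bracket_def gen_poly_def)
  assume z: "\<forall>a\<in>C. \<forall>b\<in>C. \<forall>m. B m a b = 0"
  show "abelian R"
    unfolding abelian_def
  proof (intro ballI allI)
    fix a b n assume ab: "a \<in> C" "b \<in> C"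
    have "nprod R n a b \<in> {0}"
      by (rule gen_poly_coefficients[OF nprod_finite[OF ab] vs.subspace_single_0])
        (use z ab in \<open>simp add: bracket_def\<close>)
    then show "nprod R n a b = 0" by simp
  qed
qed

end

section \<open>Rank\<close>

text \<open>Linear independence over \<open>\<complex>[\<partial>]\<close> of \<open>x 0, \<dots>, x (m - 1)\<close>.\<close>

definition free_family :: "('a::ab_group_add, 'm) lcs_scheme \<Rightarrow> nat \<Rightarrow> (nat \<Rightarrow> 'a) \<Rightarrow> bool" where
  "free_family R m x \<longleftrightarrow> (\<forall>d c. (\<Sum>i<m. \<Sum>k\<le>d. smul R (c i k) ((der R ^^ k) (x i))) = 0 \<longrightarrow>
     (\<forall>i<m. \<forall>k\<le>d. c i k = 0))"

text \<open>Only upper bounds are ever used; they pass to subsets and require no rank as a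
  number.\<close>

definition rank_le :: "('a::ab_group_add, 'm) lcs_scheme \<Rightarrow> nat \<Rightarrow> 'a set \<Rightarrow> bool" where
  "rank_le R b X \<longleftrightarrow> (\<forall>m x. (\<forall>i<m. x i \<in> X) \<and> free_family R m x \<longrightarrow> m \<le> b)"

lemma rank_le_subset: "rank_le R b Y \<Longrightarrow> X \<subseteq> Y \<Longrightarrow> rank_le R b X"
  unfolding rank_le_def by blast

context lie_conformal_superalgebra begin

lemma span_map:
  assumes y: "y \<in> vs.span X" and X: "X \<subseteq> C" and f: "linear_map R R f" and P: "vs.subspace P"
    and "\<And>x. x \<in> X \<Longrightarrow> f x \<in> P"
  shows "f y \<in> P"
proof -
  have "vs.span X \<subseteq> {x \<in> C. f x \<in> P}"
    by (rule vs.span_minimal[OF _ subspace_preimage[OF f P]]) (use assms(5) X in auto)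
  then show ?thesis using y by blast
qed

lemma Dpow_linear: "linear_map R R (\<lambda>x. (D ^^ k) x)"
  by (induction k) (simp_all add: linear_id linear_comp[OF der_linear])

lemmas Dpow_closed = linear_mapD(1)[OF Dpow_linear]

text \<open>Dimension count: the derivatives up to order \<open>d\<close> of \<open>m\<close> free
  elements are \<open>m * (d + 1)\<close> independent vectors in a space of dimension at most
  \<open>(E + d + 1) * card F\<close>, where \<open>E\<close> bounds the orders of the derivatives
  of generators that express the elements. For \<open>m > card F\<close> this fails once
  \<open>d\<close> is large.\<close>

lemma finite_rank:
  assumes "finite_lcs R"
  obtains b where "rank_le R b C"
proof -
  obtain F where F: "finite F" "F \<subseteq> C" "C = vs.span {(D ^^ k) f |k f. f \<in> F}"
    using assms unfolding finite_lcs_def by blast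
  define G where "G e = (\<lambda>(k, f). (D ^^ k) f) ` ({..e} \<times> F)" for e :: nat
  have finG: "finite (G e)" for e unfolding G_def using F(1) by simp
  have GC: "G e \<subseteq> C" for e unfolding G_def using F(2) Dpow_closed by auto
  have cardG: "card (G e) \<le> Suc e * card F" for e
    unfolding G_def using card_image_le[of "{..e} \<times> F" "\<lambda>(k, f). (D ^^ k) f"] F(1)
    by (simp add: card_cartesian_product)
  have mono: "vs.span (G e) \<subseteq> vs.span (G e')" if "e \<le> e'" for e e'
    by (rule vs.span_mono) (use that in \<open>auto simp: G_def\<close>)
  have ex: "\<exists>e. x \<in> vs.span (G e)" if "x \<in> C" for x
  proof -
    let ?U = "{x. \<exists>e. x \<in> vs.span (G e)}"
    have "vs.subspace ?U"
    proof (rule vs.subspaceI)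
      show "0 \<in> ?U" using vs.span_zero by blast
      show "smul R c x \<in> ?U" if "x \<in> ?U" for c x using that vs.span_scale by blast
      fix x y assume "x \<in> ?U" "y \<in> ?U"
      then obtain e e' where "x \<in> vs.span (G e)" "y \<in> vs.span (G e')" by blast
      then have "x \<in> vs.span (G (max e e'))" "y \<in> vs.span (G (max e e'))"
        using mono[of e "max e e'"] mono[of e' "max e e'"] by auto
      then show "x + y \<in> ?U" using vs.span_add by blast
    qed
    moreover have "(D ^^ k) f \<in> ?U" if "f \<in> F" for k f
    proof -
      have "(D ^^ k) f \<in> G k" unfolding G_def using that by force
      then show ?thesis using vs.span_base by blast
    qed
    ultimately show ?thesis using that vs.span_minimal[of "{(D ^^ k) f |k f. f \<in> F}" ?U]
      unfolding F(3) by blast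
  qed
  have Dk: "(D ^^ k) x \<in> vs.span (G (e + k))" if "x \<in> vs.span (G e)" for x e k
  proof (rule span_map[OF that GC Dpow_linear vs.subspace_span])
    fix x assume "x \<in> G e"
    then obtain j f where jf: "j \<le> e" "f \<in> F" "x = (D ^^ j) f" unfolding G_def by auto
    then have "(D ^^ k) x = (D ^^ (k + j)) f" by (simp add: funpow_add)
    then have "(D ^^ k) x \<in> G (e + k)" unfolding G_def using jf by force
    then show "(D ^^ k) x \<in> vs.span (G (e + k))" by (rule vs.span_base)
  qed
  have "m \<le> card F" if x: "\<forall>i<m. x i \<in> C" and free: "free_family R m x" for m x
  proof (rule ccontr)
    assume "\<not> m \<le> card F"
    then have m: "Suc (card F) \<le> m" by simp
    have "\<forall>i\<in>{..<m}. \<exists>e. x i \<in> vs.span (G e)" using x ex by blast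
    then obtain e where e: "\<And>i. i < m \<Longrightarrow> x i \<in> vs.span (G (e i))" by (metis lessThan_iff)
    define E where "E = Max (e ` {..<m})"
    have E: "x i \<in> vs.span (G E)" if "i < m" for i
      using e[OF that] mono[of "e i" E] that unfolding E_def by auto
    \<comment> \<open>The least order for which \<open>(card F + 1) * (d + 1)\<close> exceeds
      \<open>(E + d + 1) * card F\<close>.\<close>
    define d where "d = card F * E"
    define t where "t = (\<lambda>(i, k). (D ^^ k) (x i))"
    define A where "A = {..<m} \<times> {..d}"
    have finA: "finite A" by (simp add: A_def)
    have rel: "c p = 0" if "(\<Sum>p\<in>A. smul R (c p) (t p)) = 0" "p \<in> A" for c p
    proof -
      have "(\<Sum>i<m. \<Sum>k\<le>d. smul R (c (i, k)) ((D ^^ k) (x i))) = 0"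
        using that(1) by (simp add: A_def t_def sum.cartesian_product case_prod_unfold)
      then have "\<forall>i<m. \<forall>k\<le>d. c (i, k) = 0"
        using free[unfolded free_family_def, THEN spec[of _ d], THEN spec[of _ "\<lambda>i k. c (i, k)"]] by blast
      then show ?thesis using that(2) by (auto simp: A_def)
    qed
    have inj: "inj_on t A"
    proof (rule inj_onI, rule ccontr)
      fix p q assume pq: "p \<in> A" "q \<in> A" "t p = t q" "p \<noteq> q"
      let ?c = "\<lambda>r. if r = p then 1 else if r = q then - 1 else 0 :: complex"
      have "(\<Sum>r\<in>A. smul R (?c r) (t r)) = (\<Sum>r\<in>{p, q}. smul R (?c r) (t r))"
        by (rule sum.mono_neutral_right) (use pq(1,2) finA in auto)
      also have "\<dots> = 0" using pq(3,4) by simp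
      finally show False using rel[of ?c p] pq(1) by simp
    qed
    have "vs.independent (t ` A)"
    proof (rule vs.independent_if_scalars_zero)
      fix f y assume "(\<Sum>y\<in>t ` A. smul R (f y) y) = 0" "y \<in> t ` A"
      then show "f y = 0"
        using rel[of "\<lambda>p. f (t p)"] by (auto simp: sum.reindex[OF inj])
    qed (use finA in simp)
    moreover have "t ` A \<subseteq> vs.span (G (E + d))"
    proof
      fix y assume "y \<in> t ` A"
      then obtain i k where ik: "i < m" "k \<le> d" "y = (D ^^ k) (x i)" by (auto simp: A_def t_def)
      then show "y \<in> vs.span (G (E + d))" using Dk[OF E[OF ik(1)], of k] mono[of "E + k" "E + d"] by auto
    qed
    ultimately have "card (t ` A) \<le> card (G (E + d))"
      using vs.independent_span_bound[OF finG] by blast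
    then have "m * Suc d \<le> Suc (E + d) * card F"
      using cardG[of "E + d"] unfolding card_image[OF inj] by (simp add: A_def card_cartesian_product)
    moreover have "Suc (card F) * Suc d \<le> m * Suc d" using m by (rule mult_le_mono1)
    ultimately have "Suc (card F) * Suc d \<le> Suc (E + d) * card F" by (rule order_trans[rotated])
    then show False unfolding d_def by (simp add: algebra_simps)
  qed
  then show thesis using that[of "card F"] unfolding rank_le_def by blast
qed

section \<open>Torsion modulo an ideal\<close>

text \<open>\<open>z\<close> is the coefficient of \<open>l ^ N\<close> and may be zero, so that
  polynomials of smaller degree can be padded and added.\<close>

definition poly_with_top :: "nat \<Rightarrow> (complex \<Rightarrow> 'a) \<Rightarrow> 'a \<Rightarrow> bool" where
  "poly_with_top N f z \<longleftrightarrow> (\<exists>w. (\<forall>n\<le>N. w n \<in> C) \<and> w N = z \<and> (\<forall>l. f l = (\<Sum>n\<le>N. smul R (l ^ n) (w n))))"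

lemma poly_with_top_pad:
  assumes "poly_with_top N f z" "N < M"
  shows "poly_with_top M f 0"
proof -
  obtain w where w: "\<And>n. n \<le> N \<Longrightarrow> w n \<in> C" "\<And>l. f l = (\<Sum>n\<le>N. smul R (l ^ n) (w n))"
    using assms(1) unfolding poly_with_top_def by blast
  let ?w = "\<lambda>n. if n \<le> N then w n else 0"
  have "f l = (\<Sum>n\<le>M. smul R (l ^ n) (?w n))" for l
    unfolding w(2) using assms(2) by (intro sum.mono_neutral_cong_left) auto
  then show ?thesis unfolding poly_with_top_def using w(1) assms(2) by (intro exI[of _ ?w]) auto
qed

lemma poly_with_top_add:
  assumes "poly_with_top N f z" "poly_with_top N g y"
  shows "poly_with_top N (\<lambda>l. f l + g l) (z + y)"
proof -
  obtain w where w: "\<And>n. n \<le> N \<Longrightarrow> w n \<in> C" "w N = z" "\<And>l. f l = (\<Sum>n\<le>N. smul R (l ^ n) (w n))"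
    using assms(1) unfolding poly_with_top_def by blast
  obtain v where v: "\<And>n. n \<le> N \<Longrightarrow> v n \<in> C" "v N = y" "\<And>l. g l = (\<Sum>n\<le>N. smul R (l ^ n) (v n))"
    using assms(2) unfolding poly_with_top_def by blast
  show ?thesis unfolding poly_with_top_def
    using w v by (intro exI[of _ "\<lambda>n. w n + v n"]) (simp add: carrier_add smul_add sum.distrib)
qed

lemma poly_with_top_scale:
  assumes "poly_with_top N f z"
  shows "poly_with_top N (\<lambda>l. smul R c (f l)) (smul R c z)"
proof -
  obtain w where w: "\<And>n. n \<le> N \<Longrightarrow> w n \<in> C" "w N = z" "\<And>l. f l = (\<Sum>n\<le>N. smul R (l ^ n) (w n))"
    using assms(1) unfolding poly_with_top_def by blast
  show ?thesis unfolding poly_with_top_def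
    using w by (intro exI[of _ "\<lambda>n. smul R c (w n)"]) (simp add: carrier_smul vs.scale_sum_right mult.commute)
qed

text \<open>\<open>D\<close> keeps the degree in \<open>l\<close> while multiplication by
  \<open>l\<close> raises it, so the new top coefficient comes from the latter alone.\<close>

lemma poly_with_top_shift:
  assumes "poly_with_top N f z"
  shows "poly_with_top (Suc N) (\<lambda>l. D (f l) + smul R l (f l)) z"
proof -
  obtain w where w: "\<And>n. n \<le> N \<Longrightarrow> w n \<in> C" "w N = z" "\<And>l. f l = (\<Sum>n\<le>N. smul R (l ^ n) (w n))"
    using assms(1) unfolding poly_with_top_def by blast
  have D: "D (f l) = (\<Sum>n\<le>N. smul R (l ^ n) (D (w n)))" for l
    unfolding w(3) by (subst linear_sum[OF der_linear]) (auto intro!: sum.cong w(1) carrier_smul D_smul)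
  let ?w = "\<lambda>n. (if n \<le> N then D (w n) else 0) + (case n of 0 \<Rightarrow> 0 | Suc k \<Rightarrow> w k)"
  have "D (f l) + smul R l (f l) = (\<Sum>n\<le>Suc N. smul R (l ^ n) (?w n))" for l
  proof -
    have "smul R l (f l) = (\<Sum>n\<le>N. smul R (l ^ Suc n) (w n))"
      unfolding w(3) by (simp add: vs.scale_sum_right)
    also have "\<dots> = (\<Sum>n\<le>Suc N. smul R (l ^ n) (case n of 0 \<Rightarrow> 0 | Suc k \<Rightarrow> w k))"
      by (simp add: sum.atMost_Suc_shift del: power_Suc sum.atMost_Suc)
    finally show ?thesis unfolding D
      by (simp add: smul_add sum.distrib sum.atMost_Suc_shift del: power_Suc)
  qed
  moreover have "?w n \<in> C" if "n \<le> Suc N" for n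
    using w(1) that by (auto simp: D_closed intro!: carrier_add split: nat.split)
  moreover have "?w (Suc N) = z" using w(2) by simp
  ultimately show ?thesis unfolding poly_with_top_def by (intro exI[of _ ?w]) blast
qed

lemma poly_with_top_sum:
  assumes "\<And>k. k \<in> A \<Longrightarrow> poly_with_top N (f k) (z k)"
  shows "poly_with_top N (\<lambda>l. \<Sum>k\<in>A. f k l) (\<Sum>k\<in>A. z k)"
  using assms
proof (induction A rule: infinite_finite_induct)
  case (insert k A)
  then show ?case using poly_with_top_add[of N "f k" "z k" "\<lambda>l. \<Sum>k\<in>A. f k l"] by simp
qed (auto simp: poly_with_top_def intro!: exI[of _ "\<lambda>n. 0"])

lemma poly_with_top_mem:
  assumes "poly_with_top N f z" "vs.subspace J" "\<And>l. f l \<in> J"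
  shows "z \<in> J"
proof -
  obtain w where w: "w N = z" "\<And>l. f l = (\<Sum>n\<le>N. smul R (l ^ n) (w n))"
    using assms(1) unfolding poly_with_top_def by blast
  have "w N \<in> J"
    by (rule polynomial_coefficients_in_subspace[OF assms(2) infinite_UNIV_char_0])
      (use w(2) assms(3) in auto)
  then show ?thesis using w(1) by simp
qed

text \<open>A polynomial vector annihilated modulo \<open>J\<close> by a nonzero polynomial in \<open>\<partial> + l\<close> lies in \<open>J\<close>,
  since \<open>\<partial> + l\<close> raises the degree in \<open>l\<close> and preserves the leading coefficient.\<close>

lemma shifted_torsion:
  assumes J: "conformal_ideal J" and cd: "c d \<noteq> 0"
    and w: "\<And>n. n \<le> N \<Longrightarrow> w n \<in> C" and f: "\<And>l. f l = (\<Sum>n\<le>N. smul R (l ^ n) (w n))"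
    and tor: "\<And>l. (\<Sum>k\<le>d. smul R (c k) (((\<lambda>z. D z + smul R l z) ^^ k) (f l))) \<in> J"
  shows "f l \<in> J"
  using w f tor
proof (induction N arbitrary: f l)
  note I = conformal_idealD[OF J]
  {
    fix N f assume "\<And>n. n \<le> N \<Longrightarrow> w n \<in> C" "\<And>l. f l = (\<Sum>n\<le>N. smul R (l ^ n) (w n))"
      and t: "\<And>l. (\<Sum>k\<le>d. smul R (c k) (((\<lambda>z. D z + smul R l z) ^^ k) (f l))) \<in> J"
    then have f: "poly_with_top N f (w N)" unfolding poly_with_top_def by blast
    have k: "poly_with_top (N + k) (\<lambda>l. ((\<lambda>z. D z + smul R l z) ^^ k) (f l)) (w N)" for k
      by (induction k) (simp_all add: f poly_with_top_shift)
    \<comment> \<open>Only the term \<open>k = d\<close> reaches degree \<open>N + d\<close>; the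
      others are padded with top coefficient 0.\<close>
    have "poly_with_top (N + d) (\<lambda>l. smul R (c k) (((\<lambda>z. D z + smul R l z) ^^ k) (f l)))
        (if k = d then smul R (c d) (w N) else 0)" if "k \<in> {..d}" for k
    proof (cases "k = d")
      case True
      then show ?thesis using poly_with_top_scale[OF k] by simp
    next
      case False
      then have "N + k < N + d" using that by simp
      then show ?thesis using False poly_with_top_pad[OF poly_with_top_scale[OF k]] by simp
    qed
    then have "poly_with_top (N + d) (\<lambda>l. \<Sum>k\<le>d. smul R (c k) (((\<lambda>z. D z + smul R l z) ^^ k) (f l)))
        (\<Sum>k\<le>d. if k = d then smul R (c d) (w N) else 0)"
      by (rule poly_with_top_sum)
    then have "smul R (c d) (w N) \<in> J" using poly_with_top_mem[OF _ I(2)] t by simp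
    then have "smul R (1 / c d) (smul R (c d) (w N)) \<in> J" by (rule I(12))
    then have "w N \<in> J" using cd by simp
  } note top = this
  {
    case 0
    then show ?case using top[of 0 f] by simp
  next
    case (Suc N)
    have z: "w (Suc N) \<in> J" by (rule top[OF Suc.prems])
    \<comment> \<open>Remove the top term, already known to lie in \<open>J\<close>; the relation
      persists for the rest because \<open>J\<close> is closed under \<open>D\<close> and
      scalars.\<close>
    define g where "g l = (\<Sum>n\<le>N. smul R (l ^ n) (w n))" for l
    have fg: "f l = g l + smul R (l ^ Suc N) (w (Suc N))" for l
      unfolding g_def Suc.prems(2) by simp
    have gC: "g l \<in> C" for l unfolding g_def using Suc.prems(1) by (intro carrier_sum carrier_smul) simp
    have E: "((\<lambda>z. D z + smul R l z) ^^ k) x \<in> C" if "x \<in> C" for k l x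
      by (induction k) (use that in \<open>auto simp: ops\<close>)
    have EJ: "((\<lambda>z. D z + smul R l z) ^^ k) x \<in> J" if "x \<in> J" for k l x
      by (induction k) (use that I in auto)
    have Eadd: "((\<lambda>z. D z + smul R l z) ^^ k) (x + y) =
        ((\<lambda>z. D z + smul R l z) ^^ k) x + ((\<lambda>z. D z + smul R l z) ^^ k) y"
      if "x \<in> C" "y \<in> C" for k l x y
      by (induction k) (use E that in \<open>auto simp: ops smul_add\<close>)
    have "(\<Sum>k\<le>d. smul R (c k) (((\<lambda>z. D z + smul R l z) ^^ k) (g l))) \<in> J" for l
    proof -
      let ?y = "smul R (l ^ Suc N) (w (Suc N))"
      have y: "?y \<in> J" using z I(12) by simp
      have "(\<Sum>k\<le>d. smul R (c k) (((\<lambda>z. D z + smul R l z) ^^ k) (f l))) =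
        (\<Sum>k\<le>d. smul R (c k) (((\<lambda>z. D z + smul R l z) ^^ k) (g l))) +
        (\<Sum>k\<le>d. smul R (c k) (((\<lambda>z. D z + smul R l z) ^^ k) ?y))"
        unfolding fg using gC I(4)[OF y] by (simp add: Eadd smul_add sum.distrib)
      moreover have "(\<Sum>k\<le>d. smul R (c k) (((\<lambda>z. D z + smul R l z) ^^ k) ?y)) \<in> J"
        by (intro vs.subspace_sum[OF I(2)] I(12) EJ y)
      ultimately show ?thesis using I(11)[OF Suc.prems(3)[of l]] by (metis (no_types, lifting) add_diff_cancel_right')
    qed
    moreover have "w n \<in> C" if "n \<le> N" for n using Suc.prems(1) that by simp
    ultimately have "g l \<in> J" using Suc.IH[of g l] g_def by blast
    then show ?case unfolding fg by (intro I(10) I(12) z)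
  }
qed

text \<open>Bracketing with \<open>a\<close> turns \<open>D\<close> into \<open>D + l\<close>, so a
  relation for \<open>y\<close> modulo \<open>J\<close> becomes a relation for a polynomial vector,
  to which \<open>shifted_torsion\<close> applies. Brackets annihilate torsion.\<close>

lemma torsion_action:
  assumes J: "conformal_ideal J" and y: "y \<in> C" and a: "a \<in> C"
    and tor: "(\<Sum>k\<le>d. smul R (c k) ((D ^^ k) y)) \<in> J" and c: "k \<le> d" "c k \<noteq> 0"
  shows "B l a y \<in> J"
proof -
  note I = conformal_idealD[OF J]
  \<comment> \<open>The true degree of the relation, as \<open>shifted_torsion\<close> needs a
    nonzero leading coefficient.\<close>
  define d' where "d' = Max {k. k \<le> d \<and> c k \<noteq> 0}"
  have "d' \<in> {k. k \<le> d \<and> c k \<noteq> 0}" unfolding d'_def by (rule Max_in) (use c in auto)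
  then have d': "d' \<le> d" "c d' \<noteq> 0" by auto
  have "c k = 0" if "d' < k" "k \<le> d" for k
  proof (rule ccontr)
    assume "c k \<noteq> 0"
    then have "k \<le> d'" unfolding d'_def using that(2) by (intro Max_ge) auto
    then show False using that(1) by simp
  qed
  then have "(\<Sum>k\<le>d'. smul R (c k) ((D ^^ k) y)) = (\<Sum>k\<le>d. smul R (c k) ((D ^^ k) y))"
    using d'(1) by (intro sum.mono_neutral_left) auto
  then have t: "(\<Sum>k\<le>d'. smul R (c k) ((D ^^ k) y)) \<in> J" using tor by simp
  have Dy: "(D ^^ k) y \<in> C" for k by (rule Dpow_closed[OF y])
  have E: "((\<lambda>z. D z + smul R l z) ^^ k) (B l a y) = B l a ((D ^^ k) y)" for k l
    by (induction k) (simp_all add: B_D_right[OF a Dy])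
  obtain N w where w: "\<And>n. w n \<in> C" "\<And>l. B l a y = (\<Sum>n\<le>N. smul R (l ^ n) (w n))"
    using B_polynomial_family[OF a y] unfolding polynomial_family_def by metis
  show ?thesis
  proof (rule shifted_torsion[where f = "\<lambda>l. B l a y" and c = c, OF J d'(2) w(1) w(2)])
    fix l
    have "B l a (\<Sum>k\<le>d'. smul R (c k) ((D ^^ k) y)) = (\<Sum>k\<le>d'. smul R (c k) (B l a ((D ^^ k) y)))"
      using Dy a by (simp add: linear_sum[OF B_linear_right[OF a]] carrier_smul B_smul_right)
    then show "(\<Sum>k\<le>d'. smul R (c k) (((\<lambda>z. D z + smul R l z) ^^ k) (B l a y))) \<in> J"
      using I(6)[OF a t, of l] by (simp add: E)
  qed
qed

text \<open>A substitute for the descending chain condition: nested ideals of equal rank have a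
  torsion quotient, and brackets move torsion into the smaller one. The family \<open>P\<close> is
  arbitrary because the lemma is also applied to the images of the powers of a map.\<close>

lemma minimal_rank_ideal:
  assumes b: "rank_le R b C" and P: "X \<in> P" "\<And>J. J \<in> P \<Longrightarrow> conformal_ideal J"
  obtains I where "I \<in> P" "\<And>J. J \<in> P \<Longrightarrow> J \<subseteq> I \<Longrightarrow> bracket_span R I \<subseteq> J"
proof -
  let ?Q = "\<lambda>m. \<exists>I\<in>P. rank_le R m I"
  have Q: "?Q b" using P rank_le_subset[OF b] conformal_idealD(3) by blast
  define m where "m = (LEAST m. ?Q m)"
  obtain I where I: "I \<in> P" "rank_le R m I" using LeastI[of ?Q, OF Q] unfolding m_def by blast
  note id = conformal_idealD[OF P(2)[OF I(1)]]
  have "bracket_span R I \<subseteq> J" if JP: "J \<in> P" and JI: "J \<subseteq> I" for J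
  proof -
    note jd = conformal_idealD[OF P(2)[OF JP]]
    \<comment> \<open>By minimality of \<open>m\<close> the smaller ideal still contains
      \<open>m\<close> free elements.\<close>
    have "\<exists>x. (\<forall>i<m. x i \<in> J) \<and> free_family R m x"
    proof (cases m)
      case (Suc n)
      have "\<not> rank_le R n J"
      proof
        assume "rank_le R n J"
        then have "m \<le> n" using JP unfolding m_def by (intro Least_le) blast
        then show False using Suc by simp
      qed
      then obtain k x where "\<forall>i<k. x i \<in> J" "free_family R k x" "n < k"
        unfolding rank_le_def by (meson not_le)
      moreover have "k \<le> m" using calculation I(2) JI unfolding rank_le_def by blast
      ultimately have "k = m" using Suc by simp
      then show ?thesis using \<open>\<forall>i<k. x i \<in> J\<close> \<open>free_family R k x\<close> by blast
    qed (auto simp: free_family_def)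
    then obtain x where x: "\<And>i. i < m \<Longrightarrow> x i \<in> J" "free_family R m x" by blast
    have "B l a y \<in> J" if a: "a \<in> C" and y: "y \<in> I" for l a y
    proof -
      \<comment> \<open>One element more than the rank of \<open>I\<close> allows; the resulting
        relation involves \<open>y\<close> because the \<open>x i\<close> are free.\<close>
      let ?x = "x(m := y)"
      have "\<not> free_family R (Suc m) ?x"
      proof
        assume "free_family R (Suc m) ?x"
        moreover have "\<forall>i<Suc m. ?x i \<in> I" using x(1) y JI by auto
        ultimately have "Suc m \<le> m" using I(2) unfolding rank_le_def by blast
        then show False by simp
      qed
      then obtain d c i k where
        r: "(\<Sum>i<Suc m. \<Sum>k\<le>d. smul R (c i k) ((D ^^ k) (?x i))) = 0" and ik: "i < Suc m" "k \<le> d" "c i k \<noteq> 0"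
        unfolding free_family_def by blast
      let ?s = "\<Sum>i<m. \<Sum>k\<le>d. smul R (c i k) ((D ^^ k) (x i))" and ?t = "\<Sum>k\<le>d. smul R (c m k) ((D ^^ k) y)"
      have st: "?s + ?t = 0" using r by simp
      have DJ: "(D ^^ k) z \<in> J" if "z \<in> J" for z k by (induction k) (use that jd(5) in auto)
      have "?s \<in> J" by (intro vs.subspace_sum[OF jd(2)] jd(12) DJ x(1)) simp
      moreover have "?t = - ?s" by (rule minus_unique[OF st, symmetric])
      ultimately have t: "?t \<in> J" using jd(13)[of ?s] by (simp only:)
      have "\<exists>k\<le>d. c m k \<noteq> 0"
      proof (rule ccontr)
        assume z: "\<not> (\<exists>k\<le>d. c m k \<noteq> 0)"
        then have t0: "?t = 0" by simp
        have "?s = 0" using st unfolding t0 by (simp only: add.right_neutral)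
        then have "\<forall>i<m. \<forall>k\<le>d. c i k = 0" using x(2) unfolding free_family_def by blast
        then show False using z ik by (metis less_Suc_eq)
      qed
      then obtain k where "k \<le> d" "c m k \<noteq> 0" by blast
      then show ?thesis by (rule torsion_action[OF P(2)[OF JP] id(4)[OF y] a t])
    qed
    then show ?thesis using bracket_span_induct[OF _ jd(2), of _ I] by blast
  qed
  then show thesis using that I(1) by blast
qed

end

section \<open>The maximal ideal of a derivation-simple algebra\<close>

text \<open>A rank bound takes the place of finite generation because subalgebras inherit it, as the
  induction requires.\<close>

locale derivation_simple_lcs = lie_conformal_superalgebra +
  assumes derivation_simple: "derivation_simple"
    and not_abelian: "\<not> abelian R"
    and rank_bounded: "\<exists>b. rank_le R b (carrier R)"

context lie_conformal_superalgebra begin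

lemma conformal_ideal_Int:
  assumes "conformal_ideal I" "conformal_ideal J"
  shows "conformal_ideal (I \<inter> J)"
  using assms vs.subspace_inter[of I J] unfolding conformal_ideal_def graded_subspace_def by blast

lemma stable_carrier: "stable C"
  unfolding stable_def by (intro allI ballI impI) (rule derivation_familyD(4))

lemma conformal_idealI:
  assumes "vs.subspace J" "J \<subseteq> C" "\<And>x. x \<in> J \<Longrightarrow> sg 1 x \<in> J" "\<And>x. x \<in> J \<Longrightarrow> D x \<in> J"
    "\<And>l a x. a \<in> C \<Longrightarrow> x \<in> J \<Longrightarrow> B l a x \<in> J"
  shows "conformal_ideal J"
  unfolding conformal_ideal_def graded_subspace_def
  by (intro conjI ballI allI assms) assumption+

text \<open>For an ideal \<open>J\<close> this chain starts with \<open>C\<close> and \<open>J\<close>; its intersection is the largest stable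
  ideal contained in \<open>J\<close>.\<close>

primrec core_chain :: "'a set \<Rightarrow> nat \<Rightarrow> 'a set" where
  "core_chain J 0 = C"
| "core_chain J (Suc n) = {x \<in> core_chain J n. x \<in> J \<and>
     (\<forall>s \<phi> l. derivation_family R s \<phi> \<longrightarrow> \<phi> l x \<in> core_chain J n)}"

lemma core_chain_ideal:
  assumes J: "conformal_ideal J"
  shows "conformal_ideal (core_chain J n)"
proof (induction n)
  case 0
  then show ?case by (simp add: conformal_ideal_carrier)
next
  case (Suc n)
  note I = conformal_idealD[OF J] and Q = conformal_idealD[OF Suc]
  have mem: "x \<in> core_chain J (Suc n)"
    if "x \<in> core_chain J n" "x \<in> J" "\<And>s \<phi> l. derivation_family R s \<phi> \<Longrightarrow> \<phi> l x \<in> core_chain J n" for x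
    using that by simp
  have ph: "\<phi> l x \<in> core_chain J n" if "x \<in> core_chain J (Suc n)" "derivation_family R s \<phi>" for x s \<phi> l
    using that by auto
  have qj: "x \<in> core_chain J n" "x \<in> J" if "x \<in> core_chain J (Suc n)" for x using that by auto
  have xC: "x \<in> C" if "x \<in> core_chain J (Suc n)" for x using qj(2)[OF that] I(4) by blast
  show ?case
  proof (rule conformal_idealI)
    show "vs.subspace (core_chain J (Suc n))"
    proof (rule vs.subspaceI)
      show "0 \<in> core_chain J (Suc n)"
        by (rule mem) (use Q(9) I(9) homogeneous_mapD(6) derivation_familyD(2) in metis)+
    next
      fix x y assume xy: "x \<in> core_chain J (Suc n)" "y \<in> core_chain J (Suc n)"
      show "x + y \<in> core_chain J (Suc n)"
      proof (rule mem)
        show "x + y \<in> core_chain J n" "x + y \<in> J"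
          using qj[OF xy(1)] qj[OF xy(2)] Q(10) I(10) by blast+
        show "\<phi> l (x + y) \<in> core_chain J n" if "derivation_family R s \<phi>" for s \<phi> l
          unfolding homogeneous_mapD(2)[OF derivation_familyD(2)[OF that] xC[OF xy(1)] xC[OF xy(2)]]
          by (intro Q(10) ph[OF _ that] xy)
      qed
    next
      fix c x assume x: "x \<in> core_chain J (Suc n)"
      show "smul R c x \<in> core_chain J (Suc n)"
      proof (rule mem)
        show "smul R c x \<in> core_chain J n" "smul R c x \<in> J" using qj[OF x] Q(12) I(12) by blast+
        show "\<phi> l (smul R c x) \<in> core_chain J n" if "derivation_family R s \<phi>" for s \<phi> l
          unfolding homogeneous_mapD(3)[OF derivation_familyD(2)[OF that] xC[OF x]]
          by (intro Q(12) ph[OF _ that] x)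
      qed
    qed
    show "core_chain J (Suc n) \<subseteq> C" using xC by blast
    fix x assume x: "x \<in> core_chain J (Suc n)"
    show "sg 1 x \<in> core_chain J (Suc n)"
    proof (rule mem)
      show "sg 1 x \<in> core_chain J n" "sg 1 x \<in> J" using qj[OF x] Q(7) I(7) by blast+
      show "\<phi> l (sg 1 x) \<in> core_chain J n" if "derivation_family R s \<phi>" for s \<phi> l
        unfolding homogeneous_mapD(7)[OF derivation_familyD(2)[OF that] xC[OF x]]
        by (intro Q(7,12) ph[OF _ that] x)
    qed
    show "D x \<in> core_chain J (Suc n)"
    proof (rule mem)
      show "D x \<in> core_chain J n" "D x \<in> J" using qj[OF x] Q(5) I(5) by blast+
      show "\<phi> l (D x) \<in> core_chain J n" if "derivation_family R s \<phi>" for s \<phi> l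
        unfolding derivation_atD(2)[OF derivation_familyD(1)[OF that] xC[OF x]]
        by (intro Q(5,10,12) ph[OF _ that] x)
    qed
    fix m a assume a: "a \<in> C"
    show "B m a x \<in> core_chain J (Suc n)"
    proof (rule mem)
      show "B m a x \<in> core_chain J n" "B m a x \<in> J" using qj[OF x] Q(6) I(6) a by blast+
      show "\<phi> l (B m a x) \<in> core_chain J n" if "derivation_family R s \<phi>" for s \<phi> l
        unfolding derivation_atD(3)[OF derivation_familyD(1)[OF that] a xC[OF x]]
        by (intro Q(6,10) ph[OF _ that] x qj(1) derivation_familyD(4)[OF that] parity_map_closed a)
    qed
  qed
qed

lemma core_chain_1:
  assumes J: "conformal_ideal J"
  shows "core_chain J 1 = J"
proof -
  have "\<phi> l x \<in> C" if "x \<in> J" "derivation_family R s \<phi>" for x \<phi> l s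
    using derivation_familyD(4)[OF that(2)] conformal_idealD(4)[OF J that(1)] .
  then show ?thesis using conformal_idealD(4)[OF J] by auto
qed

lemma core_chain_Suc_subset: "core_chain J (Suc n) \<subseteq> core_chain J n" "core_chain J (Suc n) \<subseteq> J"
  by auto

text \<open>Induction with the Leibniz rule. A derivation lowers \<open>x\<close> by one step of the
  chain, and the bracket with an element of \<open>J\<close> regains it; where the derivation hits
  \<open>a\<close> instead, \<open>x\<close> itself is still deep enough.\<close>

lemma core_chain_bracket:
  assumes J: "conformal_ideal J" and a: "a \<in> J" and x: "x \<in> core_chain J n"
  shows "B m a x \<in> core_chain J (Suc n)"
  using a x
proof (induction n arbitrary: a x m)
  note I = conformal_idealD[OF J]
  case 0
  then have "B m a x \<in> J" using conformal_ideal_left[OF J, of a x m] by simp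
  then show ?case using core_chain_1[OF J] by simp
next
  note I = conformal_idealD[OF J]
  case (Suc n)
  note Q = conformal_idealD[OF core_chain_ideal[OF J, of "Suc n"]]
  have xC: "x \<in> C" and aC: "a \<in> C" using Suc.prems Q(4) I(4) by auto
  have "\<phi> l (B m a x) \<in> core_chain J (Suc n)" if p: "derivation_family R s \<phi>" for s \<phi> l
  proof -
    have "\<phi> l x \<in> core_chain J n" using Suc.prems(2) p by simp
    then have "B m (sg s a) (\<phi> l x) \<in> core_chain J (Suc n)"
      using Suc.IH I(7) Suc.prems(1) by blast
    moreover have "B (l + m) (\<phi> l a) x \<in> core_chain J (Suc n)"
      using Q(6) derivation_familyD(4)[OF p aC] Suc.prems(2) by blast
    ultimately show ?thesis
      unfolding derivation_atD(3)[OF derivation_familyD(1)[OF p] aC xC] by (rule Q(10)[rotated])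
  qed
  moreover have "B m a x \<in> core_chain J (Suc n)" by (rule Q(6)[OF aC Suc.prems(2)])
  moreover have "B m a x \<in> J" using calculation(2) by simp
  ultimately show ?case by simp
qed

lemma annihilator_ideal:
  assumes I: "conformal_ideal I"
  shows "conformal_ideal {a \<in> C. \<forall>m. \<forall>x\<in>I. B m a x = 0}"
proof (rule conformal_idealI)
  let ?A = "{a \<in> C. \<forall>m. \<forall>x\<in>I. B m a x = 0}"
  note Id = conformal_idealD[OF I]
  show "vs.subspace ?A"
    by (rule vs.subspaceI) (use Id(4) in \<open>auto simp: ops\<close>)
  show "?A \<subseteq> C" by blast
  show "D x \<in> ?A" if "x \<in> ?A" for x using that Id(4) by (auto simp: ops B_D_left)
  show sg: "sg 1 a \<in> ?A" if a: "a \<in> ?A" for a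
  proof -
    have "B m (sg 1 a) x = 0" if "x \<in> I" for m x
    proof -
      have "B m (sg 1 a) x = sg 1 (B m a (sg 1 x))"
        using a Id(4)[OF that] by (simp add: B_sg ops parity_map_involution)
      then show ?thesis using a Id(7)[OF that] linear_zero[OF linear_parity_map] by simp
    qed
    then show ?thesis using a by (auto simp: ops)
  qed
  fix l b a assume b: "b \<in> C" and a: "a \<in> ?A"
  have z: "B m a x = 0" if "x \<in> I" for m x using a that by blast
  have aC: "a \<in> C" using a by blast
  have pz: "B m (proj R p a) x = 0" if x: "x \<in> I" for m p x
  proof -
    have s: "B m (sg 1 a) x = 0" for m using sg[OF a] x by blast
    show ?thesis
      using bit_cases[of p] proj_eq_parity_map[OF aC] z[OF x] s aC Id(4)[OF x]
      by (auto simp: ops)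
  qed
  \<comment> \<open>The Jacobi identity is used with inner parameter \<open>m - l\<close>, so that
    the outer parameter of the double bracket is \<open>m\<close>.\<close>
  have "B m (B l b a) x = 0" if x: "x \<in> I" for m x
    using B_jacobi[OF b aC Id(4)[OF x], of l "m - l"] z[OF x] B_zero_right[OF b]
      pz[OF Id(6)[OF b x]] pz[OF Id(6)[OF parity_map_closed[OF b] x]] by simp
  then show "B l b a \<in> ?A" using B_closed[OF b aC] by blast
qed

end

context derivation_simple_lcs begin

lemma carrier_nontrivial: "C \<noteq> {0}"
proof
  assume "C = {0}"
  then have "B m a b = 0" if "a \<in> C" "b \<in> C" for m a b using B_closed[OF that] by blast
  then show False using not_abelian abelian_iff by blast
qed

lemma center_trivial: "center = {0}"
proof -
  have "center \<noteq> C" using not_abelian unfolding abelian_iff center_def by blast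
  then show ?thesis using derivation_simple center_ideal center_stable unfolding derivation_simple_def by blast
qed

lemma centralI: "x \<in> C \<Longrightarrow> (\<And>m a. a \<in> C \<Longrightarrow> B m a x = 0) \<Longrightarrow> x = 0"
  using center_trivial unfolding center_def by blast

text \<open>Identities between linear maps can from now on be checked on brackets.\<close>

lemma perfect: "bracket_span R C = C"
proof -
  have "bracket_span R C \<noteq> {0}"
    using not_abelian bracket_span_superset unfolding abelian_iff by blast
  then show ?thesis
    using derivation_simple bracket_span_ideal[OF conformal_ideal_carrier]
      bracket_span_stable[OF conformal_ideal_carrier stable_carrier]
    unfolding derivation_simple_def by blast
qed

text \<open>An ideal of least rank need not be minimal, but the span of its brackets lies in every
  nonzero ideal below it. That span is nonzero because the center is trivial.\<close>

lemma minimal_ideal: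
  obtains I where "conformal_ideal I" "I \<noteq> {0}"
    "\<And>J. conformal_ideal J \<Longrightarrow> J \<subseteq> I \<Longrightarrow> J \<noteq> {0} \<Longrightarrow> J = I"
proof -
  obtain b where b: "rank_le R b C" using rank_bounded by blast
  let ?P = "{J. conformal_ideal J \<and> J \<noteq> {0}}"
  have CP: "C \<in> ?P" using conformal_ideal_carrier carrier_nontrivial by blast
  obtain I where IP: "I \<in> ?P" and min: "\<And>J. J \<in> ?P \<Longrightarrow> J \<subseteq> I \<Longrightarrow> bracket_span R I \<subseteq> J"
    using minimal_rank_ideal[OF b CP] by blast
  have I: "conformal_ideal I" "I \<noteq> {0}" using IP by auto
  have "bracket_span R I \<noteq> {0}"
  proof
    assume "bracket_span R I = {0}"
    then have z: "B m a x = 0" if "a \<in> C" "x \<in> I" for m a x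
      using bracket_span_superset[OF that] by simp
    have "x = 0" if "x \<in> I" for x
      by (rule centralI[OF conformal_idealD(4)[OF I(1) that] z[OF _ that]])
    then show False using I(2) conformal_idealD(9)[OF I(1)] by blast
  qed
  then show thesis
    using that[of "bracket_span R I"] bracket_span_ideal[OF I(1)] min by blast
qed

text \<open>The intersection of the chain is a stable ideal inside the proper ideal
  \<open>J\<close>, hence zero. So the chain cannot contain \<open>I\<close> forever, and at the
  first term that does not contain it, minimality forces zero intersection.\<close>

lemma core_chain_separates:
  assumes I: "conformal_ideal I" "I \<noteq> {0}"
    "\<And>J. conformal_ideal J \<Longrightarrow> J \<subseteq> I \<Longrightarrow> J \<noteq> {0} \<Longrightarrow> J = I"
    and J: "conformal_ideal J" "J \<noteq> C"
  obtains k where "I \<subseteq> core_chain J k" "I \<inter> core_chain J (Suc k) = {0}"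
proof -
  let ?U = "\<Inter>n. core_chain J n"
  note Q = conformal_idealD[OF core_chain_ideal[OF J(1)]]
  have UJ: "?U \<subseteq> J" using core_chain_Suc_subset(2) by blast
  have "conformal_ideal ?U"
    by (rule conformal_idealI) (use Q in \<open>auto simp del: core_chain.simps intro!: vs.subspace_Inter\<close>)
  moreover have "stable ?U"
    unfolding stable_def
  proof (intro allI ballI impI)
    fix s \<phi> l x assume x: "x \<in> ?U" and p: "derivation_family R s \<phi>"
    have "\<phi> l x \<in> core_chain J n" for n
    proof -
      have "x \<in> core_chain J (Suc n)" using x by blast
      then show ?thesis using p by simp
    qed
    then show "\<phi> l x \<in> ?U" by blast
  qed
  moreover have "?U \<noteq> C" using UJ J conformal_idealD(3)[OF J(1)] by blast
  ultimately have U: "?U = {0}" using derivation_simple unfolding derivation_simple_def by blast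
  have "\<exists>n. \<not> I \<subseteq> core_chain J n"
  proof (rule ccontr)
    assume "\<not> ?thesis"
    then have "I \<subseteq> ?U" by blast
    then show False using U I(2) conformal_idealD(9)[OF I(1)] by blast
  qed
  then obtain n where n: "\<not> I \<subseteq> core_chain J n" "\<forall>k<n. I \<subseteq> core_chain J k"
    using exists_least_iff[of "\<lambda>n. \<not> I \<subseteq> core_chain J n"] by blast
  have "n \<noteq> 0" using n(1) conformal_idealD(3)[OF I(1)] by (metis core_chain.simps(1))
  then obtain k where k: "n = Suc k" by (cases n) auto
  have "I \<inter> core_chain J n = {0}"
    using I(3)[OF conformal_ideal_Int[OF I(1) core_chain_ideal[OF J(1)]]] n(1) by blast
  then show thesis using that[of k] n(2) k by blast
qed

text \<open>Every proper ideal annihilates a minimal ideal \<open>I\<close>, so the annihilator of \<open>I\<close> is the largest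
  proper ideal.\<close>

lemma largest_proper_ideal:
  obtains M where "conformal_ideal M" "M \<noteq> C" "\<And>J. conformal_ideal J \<Longrightarrow> J \<noteq> C \<Longrightarrow> J \<subseteq> M"
proof -
  obtain I where I: "conformal_ideal I" "I \<noteq> {0}"
    "\<And>J. conformal_ideal J \<Longrightarrow> J \<subseteq> I \<Longrightarrow> J \<noteq> {0} \<Longrightarrow> J = I"
    using minimal_ideal by metis
  define M where "M = {a \<in> C. \<forall>m. \<forall>x\<in>I. B m a x = 0}"
  have "J \<subseteq> M" if J: "conformal_ideal J" "J \<noteq> C" for J
  proof
    fix a assume a: "a \<in> J"
    obtain k where k: "I \<subseteq> core_chain J k" "I \<inter> core_chain J (Suc k) = {0}"
      using core_chain_separates[OF I J] by blast
    have aC: "a \<in> C" using conformal_idealD(4)[OF J(1) a] .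
    \<comment> \<open>The bracket lies in \<open>I\<close> and, by
      \<open>core_chain_bracket\<close>, in the next term of the chain, which meets \<open>I\<close>
      in 0.\<close>
    have "B m a x = 0" if "x \<in> I" for m x
      using core_chain_bracket[OF J(1) a, of x k m] k that conformal_idealD(6)[OF I(1) aC that, of m] by blast
    then show "a \<in> M" using aC unfolding M_def by blast
  qed
  moreover have "M \<noteq> C"
  proof
    assume "M = C"
    then have "x = 0" if "x \<in> I" for x
      using centralI[OF conformal_idealD(4)[OF I(1) that]] that unfolding M_def by blast
    then show False using I(2) conformal_idealD(9)[OF I(1)] by blast
  qed
  ultimately show thesis by (intro that[OF annihilator_ideal[OF I(1), folded M_def]])
qed

section \<open>Commutation and invertibility of centroid maps\<close>

text \<open>On a bracket, \<open>g\<close> can act on the left factor and \<open>f\<close> on the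
  right one, whereupon their order affects only the sign. Perfectness extends this to all
  elements.\<close>

lemma centroid_maps_supercommute:
  assumes f: "centroid_map R s l f" and g: "centroid_map R t m g" and x: "x \<in> C"
  shows "f (g x) = smul R (koszul s t) (g (f x))"
proof -
  note F = homogeneous_mapD[OF centroid_mapD(1)[OF f]] and G = homogeneous_mapD[OF centroid_mapD(1)[OF g]]
  have lf: "linear_map R R f" and lg: "linear_map R R g"
    using homogeneous_map_linear[OF centroid_mapD(1)[OF f]] homogeneous_map_linear[OF centroid_mapD(1)[OF g]] .
  have "f (g x) - smul R (koszul s t) (g (f x)) \<in> {0}"
  proof (rule bracket_span_map[where X = C and f = "\<lambda>x. f (g x) - smul R (koszul s t) (g (f x))"])
    show "x \<in> bracket_span R C" using x perfect by simp
    show "linear_map R R (\<lambda>x. f (g x) - smul R (koszul s t) (g (f x)))"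
      by (rule linear_minus[OF linear_comp[OF lf lg] linear_scale[OF linear_comp[OF lg lf]]])
    fix k a b assume ab: "a \<in> C" "b \<in> C"
    have 1: "f (g (B k a b)) = B (m + k) (sg s (g a)) (f b)"
      using ab by (simp add: centroid_map_left[OF g] centroid_mapD(3)[OF f] G F)
    have 2: "g (f (B k a b)) = smul R (koszul s t) (B (m + k) (sg s (g a)) (f b))"
      using ab by (simp add: centroid_map_left[OF g] centroid_mapD(3)[OF f] G F ops koszul_commute)
    show "f (g (B k a b)) - smul R (koszul s t) (g (f (B k a b))) \<in> {0}"
      unfolding 1 2 by simp
  qed auto
  then show ?thesis by simp
qed

text \<open>If \<open>g x = 0\<close>, then \<open>x\<close> has zero bracket with every
  \<open>g b\<close>, hence with everything, and is central. An odd \<open>g\<close> supercommutes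
  with itself, so twice its square vanishes, which is impossible for an injective map on a nonzero
  space.\<close>

lemma surjective_centroid_map:
  assumes g: "centroid_map R s l g" and surj: "g ` C = C"
  shows "s = 0" "\<exists>h. centroid_map R s (- l) h \<and> (\<forall>x\<in>C. g (h x) = x \<and> h (g x) = x)"
proof -
  note G = homogeneous_mapD[OF centroid_mapD(1)[OF g]]
  have ker: "x = 0" if x: "x \<in> C" "g x = 0" for x
  proof (rule centralI[OF x(1)])
    fix m a assume "a \<in> C"
    then obtain b where b: "b \<in> C" "a = g b" using surj by blast
    have "B m (g b) x = g (B (m - l) b x)" using centroid_map_left[OF g b(1) x(1), of "m - l"] by simp
    also have "\<dots> = B (m - l) (sg s b) (g x)" by (rule centroid_mapD(3)[OF g b(1) x(1)])
    finally show "B m a x = 0" using x b parity_map_closed B_zero_right by simp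
  qed
  have inj: "inj_on g C"
  proof (rule inj_onI)
    fix x y assume "x \<in> C" "y \<in> C" "g x = g y"
    then have "x - y = 0" by (intro ker[of "x - y"]) (simp_all add: G ops)
    then show "x = y" by simp
  qed
  show "s = 0"
  proof (rule ccontr)
    assume "s \<noteq> 0"
    then have s: "s = 1" using bit_cases[of s] by auto
    have "x = 0" if x: "x \<in> C" for x
    proof -
      have "g (g x) = - g (g x)" using centroid_maps_supercommute[OF g g x] s by simp
      then have "g (g x) + g (g x) = 0" by (metis add.right_inverse)
      then have "smul R 2 (g (g x)) = 0" using vs.scale_left_distrib[of 1 1 "g (g x)"] by simp
      then show "x = 0" using x ker G(1) by simp
    qed
    then show False using carrier_nontrivial by blast
  qed
  define h where "h = inv_into C g"
  have gh: "g (h x) = x" "h x \<in> C" if "x \<in> C" for x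
    using that surj unfolding h_def by (auto intro: f_inv_into_f inv_into_into)
  have hg: "h (g x) = x" if "x \<in> C" for x using that inj unfolding h_def by simp
  have eq: "h y = x" if "x \<in> C" "g x = y" for x y using hg that by blast
  have "homogeneous_map R s h"
  proof (rule homogeneous_mapI)
    show "linear_map R R h"
      unfolding linear_map_def by (auto intro!: eq simp: gh G ops)
    show "h (sg t x) = smul R (koszul s t) (sg t (h x))" if "x \<in> C" for t x
      by (rule eq) (use that in \<open>simp_all add: gh G ops\<close>)
  qed
  moreover have "h (D x) = D (h x) + smul R (- l) (h x)" if "x \<in> C" for x
    by (rule eq) (use that in \<open>simp_all add: gh G ops centroid_mapD(2)[OF g]\<close>)
  moreover have "h (B m x y) = B m (sg s x) (h y)" if "x \<in> C" "y \<in> C" for m x y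
    by (rule eq) (use that in \<open>simp_all add: gh G ops centroid_mapD(3)[OF g] parity_map_involution\<close>)
  ultimately have "centroid_map R s (- l) h" unfolding centroid_map_def by blast
  then show "\<exists>h. centroid_map R s (- l) h \<and> (\<forall>x\<in>C. g (h x) = x \<and> h (g x) = x)" using gh hg by blast
qed

end

section \<open>An odd derivation inverting an odd centroid map\<close>

context lie_conformal_superalgebra begin

lemma derivation_at_cong:
  assumes f: "derivation_at R s l f" and fg: "\<And>x. x \<in> C \<Longrightarrow> f x = g x"
  shows "derivation_at R s l g"
proof -
  have "homogeneous_map R s g"
    using derivation_atD(1)[OF f] fg gr_carrier carrier_add carrier_smul
    by (simp add: homogeneous_map_def linear_map_def)
  moreover have "g (D x) = D (g x) + smul R l (g x)" if "x \<in> C" for x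
    using derivation_atD(2)[OF f that] fg[OF that] fg[OF D_closed[OF that]] by simp
  moreover have "g (B m x y) = B (l + m) (g x) y + B m (sg s x) (g y)" if "x \<in> C" "y \<in> C" for m x y
    using derivation_atD(3)[OF f that] fg[OF that(1)] fg[OF that(2)] fg[OF B_closed[OF that]] by simp
  ultimately show ?thesis by (simp add: derivation_at_def)
qed

end

text \<open>Local as a ring is local: by \<open>unit\<close>, a centroid map that does not land in
  the largest proper ideal is invertible.\<close>

locale local_lcs = derivation_simple_lcs +
  fixes M
  assumes M_ideal: "conformal_ideal M"
    and M_proper: "M \<noteq> carrier R"
    and M_largest: "conformal_ideal J \<Longrightarrow> J \<noteq> carrier R \<Longrightarrow> J \<subseteq> M"
begin

text \<open>The image of a centroid map is an ideal, so if it is not inside \<open>M\<close> it is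
  everything.\<close>

lemma unit:
  assumes g: "centroid_map R s l g" and n: "\<not> g ` C \<subseteq> M"
  shows "s = 0" "g ` C = C" "\<exists>h. centroid_map R 0 (- l) h \<and> (\<forall>x\<in>C. g (h x) = x \<and> h (g x) = x)"
proof -
  show C: "g ` C = C"
    using M_largest[OF centroid_map_image_ideal[OF g conformal_ideal_carrier]] n by blast
  show s: "s = 0" by (rule surjective_centroid_map(1)[OF g C])
  show "\<exists>h. centroid_map R 0 (- l) h \<and> (\<forall>x\<in>C. g (h x) = x \<and> h (g x) = x)"
    using surjective_centroid_map(2)[OF g C] unfolding s by blast
qed

section \<open>Lowering a minimal ideal through the layers of the core chain\<close>

text \<open>\<open>h\<close> represents a nonzero homomorphism of degree \<open>l\<close> from
  \<open>I\<close> to the quotient of \<open>core_chain M i\<close> by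
  \<open>core_chain M (Suc i)\<close>. Forming the quotient is avoided by demanding the identities
  only modulo the next term.\<close>

definition hom_to_layer :: "'a set \<Rightarrow> nat \<Rightarrow> bit \<Rightarrow> complex \<Rightarrow> ('a \<Rightarrow> 'a) \<Rightarrow> bool" where
  "hom_to_layer I i s l h \<longleftrightarrow> homogeneous_map R s h \<and>
     (\<forall>x\<in>I. h x \<in> core_chain M i) \<and> (\<exists>x\<in>I. h x \<notin> core_chain M (Suc i)) \<and>
     (\<forall>x\<in>I. h (D x) - (D (h x) + smul R l (h x)) \<in> core_chain M (Suc i)) \<and>
     (\<forall>x\<in>I. \<forall>a\<in>C. \<forall>m. h (B m a x) - B m (sg s a) (h x) \<in> core_chain M (Suc i))"

text \<open>The definition of the chain supplies a derivation moving some \<open>h x0\<close> out of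
  \<open>core_chain M (Suc i)\<close>; compose with it. The extra Leibniz term is a bracket with
  \<open>h x\<close>, hence stays in that ideal, so the composite is still a homomorphism modulo
  it.\<close>

lemma hom_to_layer_lower:
  assumes I: "conformal_ideal I" and h: "hom_to_layer I (Suc i) s l h"
  shows "\<exists>s l h. hom_to_layer I i s l h"
proof -
  note Id = conformal_idealD[OF I] and Q = conformal_idealD[OF core_chain_ideal[OF M_ideal]]
  have hh: "homogeneous_map R s h" and hQ: "\<And>x. x \<in> I \<Longrightarrow> h x \<in> core_chain M (Suc i)"
    and hD: "\<And>x. x \<in> I \<Longrightarrow> h (D x) - (D (h x) + smul R l (h x)) \<in> core_chain M (Suc (Suc i))"
    and hB: "\<And>x a m. x \<in> I \<Longrightarrow> a \<in> C \<Longrightarrow> h (B m a x) - B m (sg s a) (h x) \<in> core_chain M (Suc (Suc i))"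
    using h by (simp_all add: hom_to_layer_def del: core_chain.simps)
  note H = homogeneous_mapD[OF hh]
  obtain x0 where x0: "x0 \<in> I" "h x0 \<notin> core_chain M (Suc (Suc i))"
    using h unfolding hom_to_layer_def by blast
  have "h x0 \<in> core_chain M (Suc i)" by (rule hQ[OF x0(1)])
  moreover have "h x0 \<in> M" using calculation core_chain_Suc_subset(2) by blast
  ultimately obtain t \<phi> k where \<phi>: "derivation_family R t \<phi>" "\<phi> k (h x0) \<notin> core_chain M (Suc i)"
    using x0(2) unfolding core_chain.simps(2)[of M "Suc i"] by blast
  note P = derivation_familyD[OF \<phi>(1)] and PD = derivation_atD[OF derivation_familyD(1)[OF \<phi>(1)]]
  note F = homogeneous_mapD[OF P(2)]
  have low: "\<phi> k y \<in> core_chain M n" if "y \<in> core_chain M (Suc n)" for y n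
    using that \<phi>(1) by simp
  have "hom_to_layer I i (t + s) (k + l) (\<lambda>x. \<phi> k (h x))"
    unfolding hom_to_layer_def
  proof (intro conjI ballI allI)
    show "homogeneous_map R (t + s) (\<lambda>x. \<phi> k (h x))"
      by (rule homogeneous_map_comp[OF P(2) hh])
    show "\<exists>x\<in>I. \<phi> k (h x) \<notin> core_chain M (Suc i)" using x0(1) \<phi>(2) by blast
    fix x assume x: "x \<in> I"
    have xC: "x \<in> C" "h x \<in> C" "D x \<in> C" "h (D x) \<in> C" using x Id(4) H(1) D_closed by auto
    show "\<phi> k (h x) \<in> core_chain M i" by (rule low[OF hQ[OF x]])
    have "\<phi> k (h (D x) - (D (h x) + smul R l (h x))) \<in> core_chain M (Suc i)"
      by (rule low[OF hD[OF x]])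
    moreover have "\<phi> k (h (D x) - (D (h x) + smul R l (h x))) =
        \<phi> k (h (D x)) - (D (\<phi> k (h x)) + smul R (k + l) (\<phi> k (h x)))"
      using xC by (simp add: F ops PD(2) vs.scale_left_distrib algebra_simps)
    ultimately show "\<phi> k (h (D x)) - (D (\<phi> k (h x)) + smul R (k + l) (\<phi> k (h x))) \<in> core_chain M (Suc i)"
      by simp
    fix a m assume a: "a \<in> C"
    have "\<phi> k (h (B m a x) - B m (sg s a) (h x)) \<in> core_chain M (Suc i)"
      by (rule low[OF hB[OF x a]])
    moreover have "B (k + m) (\<phi> k (sg s a)) (h x) \<in> core_chain M (Suc i)"
      by (rule Q(6)[OF P(4)[OF parity_map_closed[OF a]] hQ[OF x]])
    ultimately have "\<phi> k (h (B m a x) - B m (sg s a) (h x)) + B (k + m) (\<phi> k (sg s a)) (h x) \<in> core_chain M (Suc i)"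
      by (rule Q(10))
    moreover have "\<phi> k (h (B m a x) - B m (sg s a) (h x)) + B (k + m) (\<phi> k (sg s a)) (h x) =
        \<phi> k (h (B m a x)) - B m (sg (t + s) a) (\<phi> k (h x))"
      using xC a by (simp add: F(4) H(1) ops PD(3) parity_map_parity_map)
    ultimately show "\<phi> k (h (B m a x)) - B m (sg (t + s) a) (\<phi> k (h x)) \<in> core_chain M (Suc i)"
      by simp
  qed
  then show ?thesis by blast
qed

text \<open>A composition of derivations identifies a minimal ideal \<open>I\<close> with \<open>C / M\<close>; the inverse of this
  identification is a centroid map of \<open>C\<close> onto \<open>I\<close>.\<close>

lemma nilpotent_centroid_map:
  assumes "M \<noteq> {0}"
  obtains s l f x where "centroid_map R s l f" "f ` C \<subseteq> M" "x \<in> C" "f x \<noteq> 0"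
proof -
  obtain I where I: "conformal_ideal I" "I \<noteq> {0}"
    and Imin: "\<And>J. conformal_ideal J \<Longrightarrow> J \<subseteq> I \<Longrightarrow> J \<noteq> {0} \<Longrightarrow> J = I"
    using minimal_ideal by metis
  note Id = conformal_idealD[OF I(1)] and Md = conformal_idealD[OF M_ideal]
  obtain k where k: "I \<subseteq> core_chain M k" "I \<inter> core_chain M (Suc k) = {0}"
    using core_chain_separates[OF I Imin M_ideal M_proper] by blast
  \<comment> \<open>Start with the inclusion of \<open>I\<close>, which is injective modulo
    \<open>core_chain M (Suc k)\<close>; lowering it \<open>k\<close> times ends in \<open>C\<close>
    modulo \<open>M\<close>.\<close>
  have "hom_to_layer I k 0 0 (\<lambda>x. x)"
  proof -
    have "\<exists>x\<in>I. x \<notin> core_chain M (Suc k)"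
    proof (rule ccontr)
      assume "\<not> ?thesis"
      then have "I \<subseteq> {0}" using k(2) by blast
      then show False using I(2) Id(9) by blast
    qed
    then show ?thesis
      unfolding hom_to_layer_def
      using k(1) Id(4) conformal_idealD(9)[OF core_chain_ideal[OF M_ideal, of "Suc k"]]
      by (simp add: homogeneous_map_0_id parity_map_0 subset_iff del: core_chain.simps)
  qed
  then have "\<exists>s l h. hom_to_layer I k s l h" by blast
  then have "\<exists>s l h. hom_to_layer I 0 s l h"
    by (induction k) (use hom_to_layer_lower[OF I(1)] in blast)+
  then obtain s l h where h: "hom_to_layer I 0 s l h" by blast
  have hh: "homogeneous_map R s h" and hn: "\<exists>x\<in>I. h x \<notin> M"
    and hD: "\<And>x. x \<in> I \<Longrightarrow> h (D x) - (D (h x) + smul R l (h x)) \<in> M"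
    and hB: "\<And>x a m. x \<in> I \<Longrightarrow> a \<in> C \<Longrightarrow> h (B m a x) - B m (sg s a) (h x) \<in> M"
    using h core_chain_1[OF M_ideal] by (simp_all add: hom_to_layer_def del: core_chain.simps)
  note H = homogeneous_mapD[OF hh]
  have diffM: "x \<in> M" if "y \<in> M" "x - y \<in> M" for x y
    using Md(10)[OF that(2,1)] by simp
  \<comment> \<open>\<open>rel y x\<close> says that \<open>h\<close> sends \<open>x\<close> to the
    class of \<open>y\<close> modulo \<open>M\<close>. It will turn out to be the graph of a
    function of \<open>y\<close>.\<close>
  define rel where "rel y x \<longleftrightarrow> x \<in> I \<and> h x - y \<in> M" for y x
  have relI: "rel y x" if "x \<in> I" "h x - y \<in> M" for x y using that by (simp add: rel_def)
  have relI': "rel y x" if "x \<in> I" "h x - y = z" "z \<in> M" for x y z using that by (simp add: rel_def)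
  have r_add: "rel (y + y') (x + x')" if "rel y x" "rel y' x'" for x x' y y'
    by (rule relI'[of _ _ "(h x - y) + (h x' - y')"])
      (use that in \<open>auto simp: rel_def H Id(4) intro!: Id(10) Md(10)\<close>)
  have r_smul: "rel (smul R c y) (smul R c x)" if "rel y x" for c x y
  proof (rule relI'[of _ _ "smul R c (h x - y)"])
    have x: "x \<in> I" "h x - y \<in> M" "x \<in> C" using that Id(4) by (auto simp: rel_def)
    show "smul R c x \<in> I" by (rule Id(12)[OF x(1)])
    show "smul R c (h x - y) \<in> M" by (rule Md(12)[OF x(2)])
    show "h (smul R c x) - smul R c y = smul R c (h x - y)"
      using x(3) by (simp add: H vs.scale_right_diff_distrib)
  qed
  have r_sg: "rel (sg t y) (smul R (koszul s t) (sg t x))" if r: "rel y x" and y: "y \<in> C" for t x y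
  proof (rule relI'[of _ _ "sg t (h x - y)"])
    have x: "x \<in> I" "h x - y \<in> M" "x \<in> C" using r Id(4) by (auto simp: rel_def)
    show "smul R (koszul s t) (sg t x) \<in> I" by (intro Id(12) Id(7) x(1))
    show "sg t (h x - y) \<in> M" by (rule Md(7)[OF x(2)])
    show "h (smul R (koszul s t) (sg t x)) - sg t y = sg t (h x - y)"
      using x(3) y by (simp add: H ops linear_diff[OF linear_parity_map])
  qed
  have r_D: "rel (D y + smul R l y) (D x)" if r: "rel y x" and y: "y \<in> C" for x y
  proof (rule relI'[of _ _ "(h (D x) - (D (h x) + smul R l (h x))) + (D (h x - y) + smul R l (h x - y))"])
    have x: "x \<in> I" "h x - y \<in> M" "x \<in> C" "h x \<in> C" using r Id(4) H(1) by (auto simp: rel_def)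
    show "D x \<in> I" by (rule Id(5)[OF x(1)])
    show "(h (D x) - (D (h x) + smul R l (h x))) + (D (h x - y) + smul R l (h x - y)) \<in> M"
      by (intro Md(10) hD[OF x(1)] Md(5,12) x(2))
    show "h (D x) - (D y + smul R l y) =
      (h (D x) - (D (h x) + smul R l (h x))) + (D (h x - y) + smul R l (h x - y))"
      using x y by (simp add: ops vs.scale_right_diff_distrib)
  qed
  have r_B: "rel (B m a y) (B m (sg s a) x)" if r: "rel y x" and y: "y \<in> C" and a: "a \<in> C" for x y a m
  proof (rule relI'[of _ _ "(h (B m (sg s a) x) - B m (sg s (sg s a)) (h x)) + B m a (h x - y)"])
    have x: "x \<in> I" "h x - y \<in> M" "x \<in> C" "h x \<in> C" using r Id(4) H(1) by (auto simp: rel_def)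
    show "B m (sg s a) x \<in> I" by (rule Id(6)[OF parity_map_closed[OF a] x(1)])
    show "(h (B m (sg s a) x) - B m (sg s (sg s a)) (h x)) + B m a (h x - y) \<in> M"
      by (intro Md(10) hB[OF x(1)] Md(6) x(2) a parity_map_closed)
    show "h (B m (sg s a) x) - B m a y =
      (h (B m (sg s a) x) - B m (sg s (sg s a)) (h x)) + B m a (h x - y)"
      using x y a by (simp add: ops parity_map_involution)
  qed
  \<comment> \<open>The \<open>y\<close> that have a partner form an ideal, not inside
    \<open>M\<close> since \<open>h\<close> is nonzero modulo \<open>M\<close>, hence all of
    \<open>C\<close>.\<close>
  have ex: "\<exists>x. rel y x" if "y \<in> C" for y
  proof -
    let ?Y = "{y \<in> C. \<exists>x. rel y x}"
    have r0: "rel y 0" if "y \<in> M" for y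
      by (rule relI) (use that Id(9) Md(13) H(6) in auto)
    have rh: "rel (h x) x" if "x \<in> I" for x
      by (rule relI) (use that Md(9) in auto)
    have "conformal_ideal ?Y"
    proof (rule conformal_idealI)
      show "vs.subspace ?Y"
        by (rule vs.subspaceI) (use r0[OF Md(9)] r_add r_smul carrier_add carrier_smul in blast)+
      show "D y \<in> ?Y" if y: "y \<in> ?Y" for y
      proof -
        obtain x where x: "rel y x" "y \<in> C" using y by blast
        have "rel (D y + smul R l y + smul R (- l) y) (D x + smul R (- l) x)"
          by (rule r_add[OF r_D[OF x] r_smul[OF x(1)]])
        then have "rel (D y) (D x + smul R (- l) x)" by simp
        then show ?thesis using D_closed[OF x(2)] by blast
      qed
      show "B m a y \<in> ?Y" if "a \<in> C" "y \<in> ?Y" for m a y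
        using that r_B B_closed by blast
      show "sg 1 y \<in> ?Y" if "y \<in> ?Y" for y
        using that r_sg parity_map_closed by blast
    qed blast
    moreover have "\<not> ?Y \<subseteq> M"
      using hn rh H(1) Id(4) by blast
    ultimately have "?Y = C" using M_largest by blast
    then show ?thesis using that by blast
  qed
  \<comment> \<open>The kernel of \<open>h\<close> modulo \<open>M\<close> is an ideal properly
    contained in the minimal ideal \<open>I\<close>.\<close>
  have uniq0: "x = 0" if "x \<in> I" "h x \<in> M" for x
  proof -
    let ?K = "{x \<in> I. h x \<in> M}"
    have "conformal_ideal ?K"
    proof (rule conformal_idealI)
      show "vs.subspace ?K"
        by (rule vs.subspaceI) (use Id(4,9,10,12) Md(9,10,12) H(2,3,6) in auto)
      show "?K \<subseteq> C" using Id(3) by blast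
      show "sg 1 x \<in> ?K" if "x \<in> ?K" for x
        using that Id(4,7) Md(7,12) H(7) by simp
      show "D x \<in> ?K" if "x \<in> ?K" for x
        using that Id(5) diffM[OF _ hD[of x]] Md(5,10,12) by simp
      show "B m a x \<in> ?K" if "a \<in> C" "x \<in> ?K" for m a x
        using that Id(6) diffM[OF _ hB[of x a m]] Md(6) parity_map_closed by simp
    qed
    then have "?K = {0}" using Imin[of ?K] hn by blast
    then show ?thesis using that by blast
  qed
  have uniq: "x = x'" if r: "rel y x" "rel y x'" for x x' y
  proof -
    have "h x - h x' = (h x - y) - (h x' - y)" by simp
    moreover have m: "x \<in> I" "x' \<in> I" "h x - y \<in> M" "h x' - y \<in> M" using r by (simp_all add: rel_def)
    ultimately have "h (x - x') \<in> M" using Md(11)[OF m(3,4)] H(4)[OF Id(4)[OF m(1)] Id(4)[OF m(2)]] by simp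
    then have "x - x' = 0" by (rule uniq0[OF Id(11)[OF m(1,2)]])
    then show ?thesis by simp
  qed
  define f where "f y = (THE x. rel y x)" for y
  have fr: "rel y (f y)" if "y \<in> C" for y
    unfolding f_def using ex[OF that] uniq by (metis theI)
  have fI: "f y = x" if "rel y x" for x y
    unfolding f_def using that uniq by blast
  have fC: "f y \<in> I" "f y \<in> C" if "y \<in> C" for y using fr[OF that] Id(4) by (auto simp: rel_def)
  have "homogeneous_map R s f"
  proof (rule homogeneous_mapI)
    show "linear_map R R f"
      unfolding linear_map_def
      by (intro conjI ballI allI fC fI[OF r_add] fI[OF r_smul] fr)
    show "f (sg t y) = smul R (koszul s t) (sg t (f y))" if "y \<in> C" for t y
      by (rule fI[OF r_sg[OF fr[OF that] that]])
  qed
  moreover have "f (D y) = D (f y) + smul R (- l) (f y)" if y: "y \<in> C" for y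
  proof (rule fI)
    have "rel (D y + smul R l y + smul R (- l) y) (D (f y) + smul R (- l) (f y))"
      by (rule r_add[OF r_D[OF fr[OF y] y] r_smul[OF fr[OF y]]])
    then show "rel (D y) (D (f y) + smul R (- l) (f y))" by simp
  qed
  moreover have "f (B m a y) = B m (sg s a) (f y)" if "a \<in> C" "y \<in> C" for m a y
    by (rule fI[OF r_B[OF fr[OF that(2)] that(2,1)]])
  ultimately have f: "centroid_map R s (- l) f" unfolding centroid_map_def by blast
  \<comment> \<open>\<open>f\<close> kills \<open>M\<close>, so an invertible \<open>f\<close> would
    force \<open>M = {0}\<close>.\<close>
  have "f ` C \<subseteq> M"
  proof (rule ccontr)
    assume "\<not> f ` C \<subseteq> M"
    then obtain g where g: "\<And>x. x \<in> C \<Longrightarrow> g (f x) = x" "homogeneous_map R 0 g"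
      using unit(3)[OF f] centroid_mapD(1) by blast
    have "y = 0" if y: "y \<in> M" for y
    proof -
      have "f y = 0" by (rule fI[OF relI]) (use y Id(9) Md(13) H(6) in auto)
      then show ?thesis using g(1)[OF Md(4)[OF y]] homogeneous_mapD(6)[OF g(2)] by simp
    qed
    then show False using assms Md(9) by blast
  qed
  moreover obtain x where x: "x \<in> I" "h x \<notin> M" using hn by blast
  moreover have "f (h x) = x" by (rule fI[OF relI]) (use x Md(9) in auto)
  moreover have "x \<noteq> 0" using x(2) H(6) Md(9) by auto
  ultimately show thesis using that[OF f, of "h x"] H(1) Id(4) by metis
qed

text \<open>Otherwise the images of all centroid maps into \<open>M\<close> would span a stable
  ideal, because \<open>\<phi> l (f x)\<close> is a commutator applied to \<open>x\<close> plus a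
  multiple of \<open>f (\<phi> l x)\<close>. It lies in \<open>M\<close>, and it is nonzero by
  \<open>nilpotent_centroid_map\<close>.\<close>

lemma derivation_moving_centroid:
  assumes "M \<noteq> {0}"
  obtains s t \<phi> l m f where "derivation_family R s \<phi>" "centroid_map R t m f" "f ` C \<subseteq> M"
    "\<not> supercommutator R s t (\<phi> l) f ` C \<subseteq> M"
proof (rule ccontr)
  note found = that
  assume nt: "\<not> thesis"
  have no: "supercommutator R s t (\<phi> l) f ` C \<subseteq> M"
    if "derivation_family R s \<phi>" "centroid_map R t m f" "f ` C \<subseteq> M" for s t \<phi> l m f
    using found[OF that] nt by blast
  let ?G = "{f x |f x. x \<in> C \<and> f ` C \<subseteq> M \<and> (\<exists>t m. centroid_map R t m f)}"
  let ?J = "vs.span ?G"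
  note Md = conformal_idealD[OF M_ideal]
  have GC: "?G \<subseteq> C" using Md(4) by blast
  have JM: "?J \<subseteq> M" by (rule vs.span_minimal[OF _ Md(2)]) blast
  have base: "f x \<in> ?J" if "centroid_map R t m f" "f ` C \<subseteq> M" "x \<in> C" for f x t m
    by (rule vs.span_base) (use that in blast)
  have "conformal_ideal ?J"
  proof (rule conformal_idealI)
    show "vs.subspace ?J" by (rule vs.subspace_span)
    show "?J \<subseteq> C" using JM Md(3) by blast
    fix y assume y: "y \<in> ?J"
    show "sg 1 y \<in> ?J"
    proof (rule span_map[OF y GC linear_parity_map vs.subspace_span])
      fix z assume "z \<in> ?G"
      then obtain f x t m where f: "z = f x" "x \<in> C" "f ` C \<subseteq> M" "centroid_map R t m f" by blast
      note F = homogeneous_mapD[OF centroid_mapD(1)[OF f(4)]]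
      have "sg 1 z = f (smul R (koszul t 1) (sg 1 x))" using f(1,2) by (simp add: F ops)
      then show "sg 1 z \<in> ?J" using base[OF f(4,3)] f(2) by (simp add: ops)
    qed
    show "D y \<in> ?J"
    proof (rule span_map[OF y GC der_linear vs.subspace_span])
      fix z assume "z \<in> ?G"
      then obtain f x t m where f: "z = f x" "x \<in> C" "f ` C \<subseteq> M" "centroid_map R t m f" by blast
      note F = homogeneous_mapD[OF centroid_mapD(1)[OF f(4)]]
      have "D z = f (D x - smul R m x)" using f(1,2) by (simp add: F ops centroid_mapD(2)[OF f(4)])
      then show "D z \<in> ?J" using base[OF f(4,3)] f(2) by (simp add: ops)
    qed
    fix k a assume a: "a \<in> C"
    show "B k a y \<in> ?J"
    proof (rule span_map[OF y GC B_linear_right[OF a] vs.subspace_span])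
      fix z assume "z \<in> ?G"
      then obtain f x t m where f: "z = f x" "x \<in> C" "f ` C \<subseteq> M" "centroid_map R t m f" by blast
      have "B k a z = f (B k (sg t a) x)"
        using f(1,2) a by (simp add: ops centroid_mapD(3)[OF f(4)] parity_map_involution)
      then show "B k a z \<in> ?J" using base[OF f(4,3)] f(2) a by (simp add: ops)
    qed
  qed
  moreover have "stable ?J"
    unfolding stable_def
  proof (intro allI ballI impI)
    fix s \<phi> l y assume y: "y \<in> ?J" and \<phi>: "derivation_family R s \<phi>"
    note P = derivation_familyD[OF \<phi>]
    show "\<phi> l y \<in> ?J"
    proof (rule span_map[OF y GC homogeneous_map_linear[OF P(2)] vs.subspace_span])
      fix z assume "z \<in> ?G"
      then obtain f x t m where f: "z = f x" "x \<in> C" "f ` C \<subseteq> M" "centroid_map R t m f" by blast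
      have "supercommutator R s t (\<phi> l) f x \<in> ?J"
        by (rule base[OF centroid_map_supercommutator[OF P(1) f(4)] no[OF \<phi> f(4,3)] f(2)])
      moreover have "f (\<phi> l x) \<in> ?J" by (rule base[OF f(4,3) P(4)[OF f(2)]])
      ultimately have "supercommutator R s t (\<phi> l) f x + smul R (koszul s t) (f (\<phi> l x)) \<in> ?J"
        by (intro vs.span_add vs.span_scale)
      then show "\<phi> l z \<in> ?J" unfolding f(1) supercommutator_def by simp
    qed
  qed
  moreover have "?J \<noteq> C" using JM Md(3) M_proper by blast
  moreover have "?J \<noteq> {0}"
  proof -
    obtain s l f x where "centroid_map R s l f" "f ` C \<subseteq> M" "x \<in> C" "f x \<noteq> 0"
      using nilpotent_centroid_map[OF assms] by blast
    then show ?thesis using base by blast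
  qed
  ultimately show False using derivation_simple unfolding derivation_simple_def by blast
qed

text \<open>The commutator is a unit for all but finitely many values of the polynomial parameter of the
  derivation, so the quotients of these units have all possible degrees.\<close>

lemma degree_zero_pair:
  assumes "M \<noteq> {0}"
  obtains t \<delta> f where "derivation_at R t 0 \<delta>" "centroid_map R t 0 f" "f ` C \<subseteq> M"
    "\<And>x. x \<in> C \<Longrightarrow> \<delta> (f x) - smul R (koszul t t) (f (\<delta> x)) = x"
proof -
  obtain s t \<phi> l m f where \<phi>: "derivation_family R s \<phi>" and f: "centroid_map R t m f" "f ` C \<subseteq> M"
    and n: "\<not> supercommutator R s t (\<phi> l) f ` C \<subseteq> M"
    using derivation_moving_centroid[OF assms] by metis
  note Md = conformal_idealD[OF M_ideal] and P = derivation_familyD[OF \<phi>]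
  note lf = homogeneous_map_linear[OF centroid_mapD(1)[OF f(1)]]
  define g where "g k = supercommutator R s t (\<phi> k) f" for k
  have g: "centroid_map R (s + t) (k + m) (g k)" for k
    unfolding g_def by (rule centroid_map_supercommutator[OF P(1) f(1)])
  obtain x where x: "x \<in> C" "g l x \<notin> M" using n unfolding g_def by blast
  have fx: "f x \<in> C" using linear_mapD(1)[OF lf x(1)] .
  have "polynomial_family R (\<lambda>k. g k x)"
    unfolding g_def supercommutator_def
    by (intro polynomial_family_diff polynomial_family_scale P(3)[OF fx]
        polynomial_family_linear[OF P(3)[OF x(1)] lf])
  then have fin: "finite {k. g k x \<in> M}" using polynomial_family_cofinite[where f = "\<lambda>k. g k x" and l = l, OF _ Md(2) x(2)] by blast
  have unit_degree: "\<exists>u. centroid_map R 0 d u \<and> u ` C = C" for d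
  proof -
    \<comment> \<open>Choose \<open>k\<close> such that \<open>g k\<close> and
      \<open>g (k - d)\<close> are both invertible; their degrees differ by
      \<open>d\<close>.\<close>
    have "finite ({k. g k x \<in> M} \<union> (\<lambda>k. k + d) ` {k. g k x \<in> M})" using fin by simp
    then obtain k where k: "k \<notin> {k. g k x \<in> M} \<union> (\<lambda>k. k + d) ` {k. g k x \<in> M}"
      using ex_new_if_finite[OF infinite_UNIV_char_0] by blast
    have "g (k - d) x \<notin> M"
    proof
      assume "g (k - d) x \<in> M"
      then have "k - d + d \<in> (\<lambda>k. k + d) ` {k. g k x \<in> M}" by blast
      then show False using k by simp
    qed
    then have k1: "\<not> g k ` C \<subseteq> M" and k2: "\<not> g (k - d) ` C \<subseteq> M" using k x(1) by blast+
    obtain h where h: "centroid_map R 0 (- (k - d + m)) h"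
      "\<And>x. x \<in> C \<Longrightarrow> g (k - d) (h x) = x \<and> h (g (k - d) x) = x"
      using unit(3)[OF g k2] by blast
    have st: "s + t = 0" by (rule unit(1)[OF g k1])
    have "centroid_map R 0 d (\<lambda>x. g k (h x))"
      using centroid_map_comp[OF g h(1), of k] st by (simp add: algebra_simps)
    moreover have "(\<lambda>x. g k (h x)) ` C = C"
    proof -
      have "x \<in> h ` C" if "x \<in> C" for x
        by (rule image_eqI[of _ _ "g (k - d) x"])
          (use h(2)[OF that] homogeneous_mapD(1)[OF centroid_mapD(1)[OF g] that] in auto)
      then have "h ` C = C" using homogeneous_mapD(1)[OF centroid_mapD(1)[OF h(1)]] by blast
      then show ?thesis using unit(2)[OF g k1] by (metis image_image)
    qed
    ultimately show ?thesis by blast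
  qed
  \<comment> \<open>Correcting units: \<open>u\<close> brings \<open>\<phi> l\<close> to degree 0,
    and \<open>v\<close> does the same for \<open>f\<close>.\<close>
  obtain u where u: "centroid_map R 0 (- l) u" "u ` C = C" using unit_degree by blast
  obtain v where v: "centroid_map R 0 (- m) v" "v ` C = C" using unit_degree by blast
  note U = homogeneous_mapD[OF centroid_mapD(1)[OF u(1)]] and V = homogeneous_mapD[OF centroid_mapD(1)[OF v(1)]]
  note F = homogeneous_mapD[OF centroid_mapD(1)[OF f(1)]] and PH = homogeneous_mapD[OF P(2)]
  define \<delta> where "\<delta> = (\<lambda>x. u (\<phi> l x))"
  define e where "e = (\<lambda>x. f (v x))"
  have \<delta>: "derivation_at R s 0 \<delta>"
    unfolding \<delta>_def using derivation_at_centroid_comp[OF u(1) P(1)[of l]] by simp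
  have e: "centroid_map R t 0 e"
    unfolding e_def using centroid_map_comp[OF f(1) v(1)] by simp
  have eM: "e ` C \<subseteq> M" unfolding e_def using f(2) V(1) by blast
  define w where "w = supercommutator R s t \<delta> e"
  have w: "centroid_map R (s + t) 0 w"
    unfolding w_def using centroid_map_supercommutator[OF \<delta> e] by simp
  \<comment> \<open>Up to terms in the image of \<open>f\<close>, hence in \<open>M\<close>, the new
    commutator is the old unit composed with \<open>u\<close> and \<open>v\<close>.\<close>
  have "\<not> w ` C \<subseteq> M"
  proof
    assume wM: "w ` C \<subseteq> M"
    have "u (g l (v y)) \<in> M" if y: "y \<in> C" for y
    proof -
      have vy: "v y \<in> C" "\<phi> l (v y) \<in> C" using V(1) P(4) y by auto
      have 1: "u (f (\<phi> l (v y))) = f (u (\<phi> l (v y)))"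
        using centroid_maps_supercommute[OF u(1) f(1) vy(2)] by simp
      have "u (g l (v y)) = w y - smul R (koszul s t) (f (u (\<phi> l (v y)))) +
          smul R (koszul s t) (f (v (u (\<phi> l y))))"
        unfolding g_def w_def supercommutator_def \<delta>_def e_def
        using vy y by (simp add: U F P(4) V ops 1)
      moreover have "w y \<in> M" using wM y by blast
      moreover have "f (u (\<phi> l (v y))) \<in> M" "f (v (u (\<phi> l y))) \<in> M"
        using f(2) U(1)[OF vy(2)] V(1)[OF U(1)[OF P(4)[OF y]]] by blast+
      ultimately show ?thesis by (simp only:) (intro Md(10) Md(11) Md(12))
    qed
    moreover have "C \<subseteq> (\<lambda>y. u (g l (v y))) ` C"
    proof -
      have "g l ` C = C" by (rule unit(2)[OF g]) (use n in \<open>simp add: g_def\<close>)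
      then have "u ` (g l ` (v ` C)) = C" using u(2) v(2) by simp
      then show ?thesis by (simp add: image_image)
    qed
    ultimately have "C \<subseteq> M" by blast
    then show False using M_proper Md(3) by blast
  qed
  note wu = unit[OF w this]
  \<comment> \<open>Composing the derivation with the inverse of \<open>w\<close> normalises the
    commutator to the identity; as \<open>w\<close> is even, both maps have the same parity.\<close>
  obtain h where h: "centroid_map R 0 0 h" "\<And>x. x \<in> C \<Longrightarrow> h (w x) = x" using wu(3) by auto
  have st: "s = t" using wu(1) bit_cases[of s] bit_cases[of t] by auto
  note H = homogeneous_mapD[OF centroid_mapD(1)[OF h(1)]] and E = homogeneous_mapD[OF centroid_mapD(1)[OF e]]
  have "derivation_at R t 0 (\<lambda>x. h (\<delta> x))"
    using derivation_at_centroid_comp[OF h(1) \<delta>] st by simp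
  moreover have "h (\<delta> (e x)) - smul R (koszul t t) (e (h (\<delta> x))) = x" if y: "x \<in> C" for x
  proof -
    have d: "\<delta> z \<in> C" if "z \<in> C" for z using homogeneous_mapD(1)[OF derivation_atD(1)[OF \<delta>] that] .
    have "e (h (\<delta> x)) = h (e (\<delta> x))" using centroid_maps_supercommute[OF h(1) e d[OF y]] by simp
    then have "h (\<delta> (e x)) - smul R (koszul t t) (e (h (\<delta> x))) = h (w x)"
      unfolding w_def supercommutator_def st using y by (simp add: H d E ops)
    then show ?thesis using h(2)[OF y] by simp
  qed
  ultimately show thesis using that e eM by blast
qed

section \<open>Nilpotence of even non-units, and the odd pair\<close>

lemma centroid_map_funpow:
  assumes f: "centroid_map R 0 0 f"
  shows "centroid_map R 0 0 (f ^^ n)"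
proof (induction n)
  case 0
  then show ?case using centroid_map_id by (simp add: id_def)
next
  case (Suc n)
  then show ?case using centroid_map_comp[OF f Suc] by (simp add: comp_def)
qed

text \<open>A Fitting argument: once the images of the powers stabilise, \<open>C\<close> is the sum
  of the kernel and the image of some power. The image lies in \<open>M\<close>, so the kernel,
  being an ideal, cannot be proper.\<close>

lemma even_nonunit_nilpotent:
  assumes f: "centroid_map R 0 0 f" and fM: "f ` C \<subseteq> M"
  obtains n where "\<And>x. x \<in> C \<Longrightarrow> (f ^^ n) x = 0"
proof -
  note Md = conformal_idealD[OF M_ideal]
  note fn = centroid_map_funpow[OF f]
  note Fn = homogeneous_mapD[OF centroid_mapD(1)[OF fn]]
  obtain b where b: "rank_le R b C" using rank_bounded by blast
  let ?P = "range (\<lambda>n. (f ^^ n) ` C)"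
  have Pid: "conformal_ideal J" if "J \<in> ?P" for J
    using that centroid_map_image_ideal[OF fn conformal_ideal_carrier] by blast
  obtain I where IP: "I \<in> ?P" and min: "\<And>J. J \<in> ?P \<Longrightarrow> J \<subseteq> I \<Longrightarrow> bracket_span R I \<subseteq> J"
    using minimal_rank_ideal[OF b, of "(f ^^ 0) ` C" ?P] Pid by blast
  obtain n where n: "I = (f ^^ n) ` C" using IP by blast
  have sub: "(f ^^ (n + k)) ` C \<subseteq> (f ^^ n) ` C" for k
    using Fn(1) by (force simp: funpow_add)
  \<comment> \<open>Powers of \<open>f\<close> commute with brackets and \<open>C\<close> is
    perfect, so no replacement by a bracket span is needed: \<open>minimal_rank_ideal\<close> gives
    genuine stabilisation.\<close>
  have perf: "(f ^^ n) ` C \<subseteq> bracket_span R I"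
  proof
    fix y assume "y \<in> (f ^^ n) ` C"
    then obtain x where x: "x \<in> C" "y = (f ^^ n) x" by blast
    have "(f ^^ n) x \<in> bracket_span R I"
    proof (rule bracket_span_map[where X = C and f = "f ^^ n"])
      show "x \<in> bracket_span R C" using x perfect by simp
      show "linear_map R R (f ^^ n)" by (rule homogeneous_map_linear[OF centroid_mapD(1)[OF fn]])
      show "vs.subspace (bracket_span R I)" by (rule subspace_bracket_span)
      fix m a z assume "a \<in> C" "z \<in> C"
      then show "(f ^^ n) (B m a z) \<in> bracket_span R I"
        unfolding n by (simp add: centroid_mapD(3)[OF fn] parity_map_0 bracket_span_superset)
    qed simp
    then show "y \<in> bracket_span R I" using x by simp
  qed
  have step: "(f ^^ n) ` C \<subseteq> (f ^^ (n + k)) ` C" for k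
    using perf min[of "(f ^^ (n + k)) ` C"] sub[of k] n by blast
  \<comment> \<open>One power more than \<open>n\<close>, so that the image lies in \<open>M\<close>
    even for \<open>n = 0\<close>.\<close>
  define N where "N = Suc n"
  have NN: "\<exists>y\<in>C. (f ^^ N) x = (f ^^ N) ((f ^^ N) y)" if x: "x \<in> C" for x
  proof -
    have "(f ^^ N) x = (f ^^ n) (f x)" by (simp add: N_def funpow_swap1)
    moreover have "f x \<in> C" using Fn(1)[of _ 1] x by simp
    ultimately have "(f ^^ N) x \<in> (f ^^ n) ` C" by simp
    then have "(f ^^ N) x \<in> (f ^^ (n + (N + 1))) ` C" using step by blast
    moreover have "n + (N + 1) = N + N" by (simp add: N_def)
    ultimately show ?thesis by (auto simp: funpow_add)
  qed
  let ?K = "{x \<in> C. (f ^^ N) x = 0}"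
  have K: "conformal_ideal ?K" by (rule centroid_map_kernel_ideal[OF fn])
  have "?K = C"
  proof (rule ccontr)
    assume "?K \<noteq> C"
    then have KM: "?K \<subseteq> M" by (rule M_largest[OF K])
    have "x \<in> M" if x: "x \<in> C" for x
    proof -
      obtain y where y: "y \<in> C" "(f ^^ N) x = (f ^^ N) ((f ^^ N) y)" using NN[OF x] by blast
      have "x - (f ^^ N) y \<in> ?K" using x y Fn by (simp add: ops)
      then have "x - (f ^^ N) y \<in> M" using KM by blast
      moreover have "(f ^^ N) y \<in> M" using fM Fn(1)[OF y(1), of n] by (auto simp: N_def)
      ultimately have "x - (f ^^ N) y + (f ^^ N) y \<in> M" by (rule Md(10))
      then show ?thesis by simp
    qed
    then show False using M_proper Md(3) by blast
  qed
  then show thesis using that[of N] by blast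
qed

theorem odd_pair:
  assumes "M \<noteq> {0}"
  obtains \<delta> f where "derivation_at R 1 0 \<delta>" "centroid_map R 1 0 f"
    "\<And>x. x \<in> C \<Longrightarrow> \<delta> (f x) + f (\<delta> x) = x" "\<And>x. x \<in> C \<Longrightarrow> \<delta> (\<delta> x) = 0" "\<And>x. x \<in> C \<Longrightarrow> f (f x) = 0"
proof -
  obtain t \<delta> f where \<delta>: "derivation_at R t 0 \<delta>" and f: "centroid_map R t 0 f" "f ` C \<subseteq> M"
    and inv: "\<And>x. x \<in> C \<Longrightarrow> \<delta> (f x) - smul R (koszul t t) (f (\<delta> x)) = x"
    using degree_zero_pair[OF assms] by blast
  note \<Delta> = homogeneous_mapD[OF derivation_atD(1)[OF \<delta>]] and F = homogeneous_mapD[OF centroid_mapD(1)[OF f(1)]]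
  have "t = 1"
  proof (rule ccontr)
    assume "t \<noteq> 1"
    then have t: "t = 0" using bit_cases[of t] by auto
    have c: "\<delta> (f x) = f (\<delta> x) + x" if "x \<in> C" for x using inv[OF that] t by (simp add: algebra_simps)
    have fC: "(f ^^ n) x \<in> C" if "x \<in> C" for n x by (induction n) (use that F(1) in auto)
    have lfn: "(f ^^ n) (x + y) = (f ^^ n) x + (f ^^ n) y" if "x \<in> C" "y \<in> C" for n x y
      by (induction n) (use that fC F(2) in auto)
    \<comment> \<open>The Weyl relation for powers. At the nilpotency index \<open>Suc k\<close> it
      leaves \<open>of_nat (Suc k)\<close> times \<open>(f ^^ k) x\<close>, which must then vanish
      although \<open>k\<close> is below the index.\<close>
    have pw: "\<delta> ((f ^^ Suc n) x) = (f ^^ Suc n) (\<delta> x) + smul R (of_nat (Suc n)) ((f ^^ n) x)" if x: "x \<in> C" for n x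
    proof (induction n)
      case 0
      then show ?case using c[OF x] by simp
    next
      case (Suc n)
      have "\<delta> ((f ^^ Suc (Suc n)) x) = f (\<delta> ((f ^^ Suc n) x)) + (f ^^ Suc n) x"
        using c[OF fC[OF x, of "Suc n"]] by simp
      also have "\<dots> = f ((f ^^ Suc n) (\<delta> x) + smul R (of_nat (Suc n)) ((f ^^ n) x)) + (f ^^ Suc n) x"
        by (simp only: Suc)
      also have "\<dots> = f ((f ^^ Suc n) (\<delta> x)) + smul R (of_nat (Suc n)) (f ((f ^^ n) x)) + (f ^^ Suc n) x"
        using fC[OF x, of n] fC[OF \<Delta>(1)[OF x], of "Suc n"] by (simp only: F(2,3) carrier_smul)
      also have "\<dots> = (f ^^ Suc (Suc n)) (\<delta> x) + smul R (of_nat (Suc (Suc n))) ((f ^^ Suc n) x)"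
        unfolding of_nat_Suc[of "Suc n"] vs.scale_left_distrib by (simp add: add_ac del: of_nat_Suc)
      finally show ?case .
    qed
    obtain n where "\<forall>x\<in>C. (f ^^ n) x = 0"
      using even_nonunit_nilpotent[of f] f t by metis
    then obtain n where n: "\<forall>x\<in>C. (f ^^ n) x = 0" "\<forall>k<n. \<not> (\<forall>x\<in>C. (f ^^ k) x = 0)"
      using exists_least_iff[of "\<lambda>n. \<forall>x\<in>C. (f ^^ n) x = 0"] by blast
    show False
    proof (cases n)
      case 0
      then show False using n(1) carrier_nontrivial by auto
    next
      case (Suc k)
      have "(f ^^ k) x = 0" if x: "x \<in> C" for x
      proof -
        have "smul R (of_nat (Suc k)) ((f ^^ k) x) = 0"
          using pw[OF x, of k] n(1) x \<Delta>(1)[OF x] \<Delta>(6) unfolding Suc by simp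
        then show ?thesis by (simp del: of_nat_Suc)
      qed
      then show False using n(2) Suc by blast
    qed
  qed
  note t = this
  have ff: "f (f x) = 0" if x: "x \<in> C" for x
  proof -
    have "f (f x) = - f (f x)" using centroid_maps_supercommute[OF f(1) f(1) x] t by simp
    then have "f (f x) + f (f x) = 0" by (metis add.right_inverse)
    then have "smul R 2 (f (f x)) = 0" using vs.scale_left_distrib[of 1 1 "f (f x)"] by simp
    then show ?thesis by simp
  qed
  have inv': "\<delta> (f x) = x - f (\<delta> x)" if "x \<in> C" for x using inv[OF that] t by (simp add: algebra_simps)
  text \<open>The square of \<open>\<delta>\<close> is a derivation commuting with \<open>f\<close>; subtracting \<open>f \<delta>\<^sup>2\<close> makes the square vanish.\<close>
  define \<epsilon> where "\<epsilon> = (\<lambda>x. \<delta> x - f (\<delta> (\<delta> x)))"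
  \<comment> \<open>The supercommutator of an odd map with itself is twice its square.\<close>
  have "derivation_at R 0 0 (supercommutator R 1 1 \<delta> \<delta>)"
    using derivation_at_supercommutator[OF \<delta> \<delta>] t by simp
  then have dd: "derivation_at R 0 0 (\<lambda>x. smul R 2 (\<delta> (\<delta> x)))"
    using vs.scale_left_distrib[of 1 1] by (simp add: supercommutator_def)
  have "centroid_map R 1 0 (\<lambda>x. smul R (1/2) (f x))"
    using f(1) t homogeneous_map_scale[of 1 f "1/2"] F(1)
    by (simp add: centroid_map_def smul_add ops)
  from derivation_at_centroid_comp[OF this dd]
  have h: "derivation_at R 1 0 (\<lambda>x. smul R (1/2) (f (smul R 2 (\<delta> (\<delta> x)))))" by simp
  have "derivation_at R 1 0 (\<lambda>x. \<delta> x - smul R (1/2) (f (smul R 2 (\<delta> (\<delta> x)))))"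
    by (rule derivation_at_diff[OF \<delta>[unfolded t] h])
  then have "derivation_at R 1 0 \<epsilon>"
    by (rule derivation_at_cong) (simp add: \<epsilon>_def F(3) \<Delta>(1))
  moreover have "\<epsilon> (f x) + f (\<epsilon> x) = x" if x: "x \<in> C" for x
    unfolding \<epsilon>_def using x by (simp add: inv' \<Delta> F ff ops)
  \<comment> \<open>The square of \<open>\<delta>\<close> commutes with \<open>f\<close>. On
    expanding, the terms \<open>f (\<delta> (\<delta> (\<delta> x)))\<close> cancel and the last one
    contains \<open>f (f z) = 0\<close>.\<close>
  moreover have "\<epsilon> (\<epsilon> x) = 0" if x: "x \<in> C" for x
    unfolding \<epsilon>_def using x by (simp add: inv' \<Delta> F ff ops)
  ultimately show thesis using that f(1) ff t by blast
qed

end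

section \<open>Splitting off one Grassmann generator\<close>

text \<open>Only carrier and grading shrink. The operations stay those of the ambient algebra, so
  brackets are literally the same and the type does not change.\<close>

definition sub_lcs :: "('a::ab_group_add, 'm) lcs_scheme \<Rightarrow> 'a set \<Rightarrow> 'a lcs" where
  "sub_lcs R A = \<lparr>smul = smul R, carrier = A, gr = (\<lambda>p. gr R p \<inter> A), der = der R, nprod = nprod R\<rparr>"

lemma sub_lcs_simps [simp]:
  "smul (sub_lcs R A) = smul R" "carrier (sub_lcs R A) = A" "gr (sub_lcs R A) p = gr R p \<inter> A"
  "der (sub_lcs R A) = der R" "nprod (sub_lcs R A) = nprod R" "bracket (sub_lcs R A) = bracket R"
  "gen_poly (sub_lcs R A) = gen_poly R" "gen_poly_op (sub_lcs R A) = gen_poly_op R"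
  by (simp_all add: sub_lcs_def bracket_def gen_poly_def gen_poly_op_def fun_eq_iff)

lemma sub_lcs_sub_lcs: "S \<subseteq> A \<Longrightarrow> sub_lcs (sub_lcs R A) S = sub_lcs R S"
  by (auto simp: sub_lcs_def)

lemma rank_le_sub_lcs: "rank_le (sub_lcs R A) b X \<longleftrightarrow> rank_le R b X"
  by (simp add: rank_le_def free_family_def)

context lie_conformal_superalgebra begin

definition subalgebra :: "'a set \<Rightarrow> bool" where
  "subalgebra A \<longleftrightarrow> graded_subspace A \<and> (\<forall>x\<in>A. D x \<in> A) \<and> (\<forall>m. \<forall>x\<in>A. \<forall>y\<in>A. B m x y \<in> A)"

lemma sub_lcs_lcs:
  assumes A: "subalgebra A"
  shows "lie_conformal_superalgebra (sub_lcs R A)"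
proof -
  have sub: "vs.subspace A" and g: "graded_subspace A" and AC: "\<And>x. x \<in> A \<Longrightarrow> x \<in> C"
    and D: "\<And>x. x \<in> A \<Longrightarrow> D x \<in> A" and b: "\<And>m x y. x \<in> A \<Longrightarrow> y \<in> A \<Longrightarrow> B m x y \<in> A"
    using A by (auto simp: subalgebra_def graded_subspace_def)
  have n: "nprod R k x y \<in> A" if "x \<in> A" "y \<in> A" for k x y
    using gen_poly_coefficients[OF nprod_finite[OF AC[OF that(1)] AC[OF that(2)]] sub] b[OF that]
    unfolding bracket_def by blast
  let ?R = "sub_lcs R A"
  show ?thesis
  proof (unfold_locales, goal_cases)
    case (5 p)
    then show ?case using vs.subspace_inter[OF subspace_gr sub] by simp
  next
    case 6
    have "x \<in> {y + z |y z. y \<in> gr R 0 \<inter> A \<and> z \<in> gr R 1 \<inter> A}" if "x \<in> A" for x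
      using proj_decomp[OF AC[OF that]] proj_mem_gr[OF AC[OF that]] graded_subspace_proj[OF g that] by blast
    then show ?case using vs.subspace_add[OF sub] by auto
  next
    case 7
    then show ?case using gr_disjoint vs.subspace_0[OF sub] by auto
  next
    case 8
    then show ?case using der_linear D AC by (simp add: linear_map_def)
  next
    case (9 x p)
    then show ?case using der_even D by simp
  next
    case (10 b n)
    then show ?case using nprod_linear_left[OF AC, of b n] n AC by (simp add: linear_map_def)
  next
    case (11 a n)
    then show ?case using nprod_linear_right[OF AC, of a n] n AC by (simp add: linear_map_def)
  next
    case (12 a b)
    then show ?case using nprod_finite AC by simp
  next
    case (13 a p b q n)
    then show ?case using nprod_parity n by simp
  next
    case (14 a b l)
    then show ?case using sesquilinear_left AC by simp
  next
    case (15 a b l)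
    then show ?case using sesquilinear_right AC by simp
  next
    case (16 a p b q l)
    then show ?case using skew[of a p b q l] by simp
  next
    case (17 a p b q c l m)
    then show ?case using jacobi[of a p b q c l m] AC by simp
  qed (simp_all add: vs.scale_right_distrib vs.scale_left_distrib)
qed

text \<open>\<open>proj\<close> is a description relative to the grading, so its agreement with the
  ambient projection needs an argument.\<close>

lemma parity_map_sub_lcs:
  assumes A: "subalgebra A" and x: "x \<in> A"
  shows "parity_map (sub_lcs R A) s x = sg s x"
proof -
  interpret A: lie_conformal_superalgebra "sub_lcs R A" by (rule sub_lcs_lcs[OF A])
  have "proj (sub_lcs R A) p x = proj R p x" for p
  proof -
    obtain y z where yz: "x = y + z" "y \<in> gr (sub_lcs R A) p" "z \<in> gr (sub_lcs R A) (p + 1)"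
      using A.carrier_split[of x p] x by auto
    have "y \<in> gr R p" "z \<in> gr R (p + 1)" using yz(2,3) by simp_all
    then show ?thesis using A.proj_eq[OF yz(2,3)] proj_eq yz(1) by simp
  qed
  then show ?thesis by (simp add: parity_map_def)
qed

lemma homogeneous_map_sub_lcs:
  assumes A: "subalgebra A" and f: "homogeneous_map R s f" and "\<And>x. x \<in> A \<Longrightarrow> f x \<in> A"
  shows "homogeneous_map (sub_lcs R A) s f"
proof -
  have "x \<in> C" if "x \<in> A" for x using A that by (auto simp: subalgebra_def graded_subspace_def)
  then show ?thesis using assms(2,3) by (simp add: homogeneous_map_def linear_map_def)
qed

lemma derivation_family_sub_lcs:
  assumes A: "subalgebra A" and \<phi>: "derivation_family R s \<phi>" and st: "\<And>x l. x \<in> A \<Longrightarrow> \<phi> l x \<in> A"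
  shows "derivation_family (sub_lcs R A) s \<phi>"
proof -
  have AC: "x \<in> C" if "x \<in> A" for x using A that by (auto simp: subalgebra_def graded_subspace_def)
  have sub: "vs.subspace A" using A by (simp add: subalgebra_def graded_subspace_def)
  note P = derivation_familyD[OF \<phi>]
  have "derivation_at (sub_lcs R A) s l (\<phi> l)" for l
    using derivation_atD(2,3)[OF P(1)] AC
    by (simp add: derivation_at_def homogeneous_map_sub_lcs[OF A P(2) st] parity_map_sub_lcs[OF A])
  moreover have "polynomial_family (sub_lcs R A) (\<lambda>l. \<phi> l x)" if x: "x \<in> A" for x
  proof -
    obtain N w where w: "\<And>n. n > N \<Longrightarrow> w n = 0" "\<And>l. \<phi> l x = (\<Sum>n\<le>N. smul R (l ^ n) (w n))"
      using P(3)[OF AC[OF x]] unfolding polynomial_family_def by blast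
    have wA: "w n \<in> A" for n
    proof (cases "n \<le> N")
      case True
      show ?thesis
        by (rule polynomial_coefficients_in_subspace[OF sub infinite_UNIV_char_0 _ True])
          (use w(2) st[OF x] in metis)
    next
      case False
      then show ?thesis using w(1) vs.subspace_0[OF sub] by simp
    qed
    show ?thesis unfolding polynomial_family_def sub_lcs_simps using w wA by blast
  qed
  ultimately show ?thesis by (simp add: derivation_family_def)
qed

lemma derivation_kernel_subalgebra:
  assumes \<delta>: "derivation_at R s 0 \<delta>"
  shows "subalgebra {x \<in> C. \<delta> x = 0}"
proof -
  note \<Delta> = homogeneous_mapD[OF derivation_atD(1)[OF \<delta>]]
  have s0: "sg s 0 = 0" and D0: "D 0 = 0" for s
    by (rule linear_zero[OF linear_parity_map], rule linear_zero[OF der_linear])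
  have "vs.subspace {x \<in> C. \<delta> x = 0}"
    by (rule vs.subspaceI) (auto simp: \<Delta> ops)
  then show ?thesis
    by (auto simp: subalgebra_def graded_subspace_def \<Delta> ops derivation_atD(2,3)[OF \<delta>] s0 D0)
qed

end

text \<open>\<open>\<xi>\<close> behaves like multiplication by an odd variable and
  \<open>\<delta>\<close> like the derivative in it, a Clifford pair; \<open>A\<close> is the
  algebra of constants.\<close>

locale grassmann_pair = derivation_simple_lcs +
  fixes \<delta> \<xi> A
  assumes \<delta>: "derivation_at R 1 0 \<delta>"
    and \<xi>: "centroid_map R 1 0 \<xi>"
    and \<delta>_\<xi>: "x \<in> carrier R \<Longrightarrow> \<delta> (\<xi> x) + \<xi> (\<delta> x) = x"
    and \<delta>_\<delta>: "x \<in> carrier R \<Longrightarrow> \<delta> (\<delta> x) = 0"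
    and \<xi>_\<xi>: "x \<in> carrier R \<Longrightarrow> \<xi> (\<xi> x) = 0"
    and A_def: "A = {x \<in> carrier R. \<delta> x = 0}"
begin

lemmas \<Delta> = homogeneous_mapD[OF derivation_atD(1)[OF \<delta>]]
lemmas \<Xi> = homogeneous_mapD[OF centroid_mapD(1)[OF \<xi>]]
lemmas linear_\<delta> = homogeneous_map_linear[OF derivation_atD(1)[OF \<delta>]]
lemmas linear_\<xi> = homogeneous_map_linear[OF centroid_mapD(1)[OF \<xi>]]

lemma A_subalgebra: "subalgebra A"
  unfolding A_def by (rule derivation_kernel_subalgebra[OF \<delta>])

lemma A_carrier: "x \<in> A \<Longrightarrow> x \<in> C"
  and \<delta>_A: "x \<in> A \<Longrightarrow> \<delta> x = 0"
  and \<delta>_mem: "x \<in> C \<Longrightarrow> \<delta> x \<in> A"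
  by (auto simp: A_def \<Delta>(1) \<delta>_\<delta>)

lemma A_closed:
  shows "vs.subspace A" "graded_subspace A" "x \<in> A \<Longrightarrow> D x \<in> A" "x \<in> A \<Longrightarrow> y \<in> A \<Longrightarrow> B m x y \<in> A"
    "x \<in> A \<Longrightarrow> sg s x \<in> A" "x \<in> A \<Longrightarrow> y \<in> A \<Longrightarrow> x + y \<in> A" "x \<in> A \<Longrightarrow> smul R c x \<in> A"
proof -
  show g: "graded_subspace A" and "x \<in> A \<Longrightarrow> D x \<in> A" "x \<in> A \<Longrightarrow> y \<in> A \<Longrightarrow> B m x y \<in> A"
    using A_subalgebra by (simp_all add: subalgebra_def)
  then show s: "vs.subspace A" by (simp add: graded_subspace_def)
  show "x \<in> A \<Longrightarrow> sg s x \<in> A" by (rule graded_subspace_parity_map[OF g])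
  show "x \<in> A \<Longrightarrow> y \<in> A \<Longrightarrow> x + y \<in> A" "x \<in> A \<Longrightarrow> smul R c x \<in> A"
    by (rule vs.subspace_add[OF s] vs.subspace_scale[OF s], assumption+)+
qed

lemma \<delta>_\<xi>_A: "x \<in> A \<Longrightarrow> \<delta> (\<xi> x) = x"
  using \<delta>_\<xi>[OF A_carrier] \<delta>_A \<Xi>(6) by fastforce

text \<open>\<open>\<delta> \<xi>\<close> and \<open>\<xi> \<delta>\<close> are complementary
  projections, onto \<open>A\<close> and onto \<open>\<xi> A\<close>; in the second part
  \<open>\<delta>\<close> removes the factor \<open>\<xi>\<close>.\<close>

lemma components:
  assumes "u \<in> A" "v \<in> A"
  shows "\<delta> (\<xi> (u + \<xi> v)) = u" "\<delta> (u + \<xi> v) = v"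
  using assms A_carrier by (simp_all add: \<Delta> \<Xi> \<xi>_\<xi> \<delta>_\<xi>_A \<delta>_A)

lemma components_decomp: "x \<in> C \<Longrightarrow> x = \<delta> (\<xi> x) + \<xi> (\<delta> x)"
  by (simp add: \<delta>_\<xi>)

lemma component_mem: "x \<in> C \<Longrightarrow> \<delta> (\<xi> x) \<in> A" "x \<in> C \<Longrightarrow> \<delta> x \<in> A"
  using \<delta>_mem \<Xi>(1) by blast+

lemma decomp_cases:
  assumes "x \<in> C"
  obtains u v where "u \<in> A" "v \<in> A" "x = u + \<xi> v"
  using components_decomp component_mem assms by blast

text \<open>Pulling \<open>\<xi>\<close> out of the right factor costs a parity twist of the left
  one, pulling it out of the left factor costs nothing, and two factors \<open>\<xi>\<close> give
  zero.\<close>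

lemma bracket_components:
  assumes "a0 \<in> C" "a1 \<in> C" "x0 \<in> C" "x1 \<in> C"
  shows "B m (a0 + \<xi> a1) (x0 + \<xi> x1) = B m a0 x0 + \<xi> (B m a1 x0 + B m (sg 1 a0) x1)"
proof -
  have "B m a0 (\<xi> x1) = \<xi> (B m (sg 1 a0) x1)"
    using assms by (simp add: centroid_mapD(3)[OF \<xi>] ops parity_map_involution)
  moreover have l: "B m (\<xi> a1) y = \<xi> (B m a1 y)" if "y \<in> C" for y
    using centroid_map_left[OF \<xi> assms(2) that, of m] by simp
  moreover have "B m (\<xi> a1) (\<xi> x1) = 0"
  proof -
    have "B m (\<xi> a1) (\<xi> x1) = \<xi> (\<xi> (B m (sg 1 a1) x1))"
      using assms by (simp add: l \<Xi> centroid_mapD(3)[OF \<xi>] ops parity_map_involution)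
    then show ?thesis using assms by (simp add: \<xi>_\<xi> ops)
  qed
  ultimately show ?thesis using assms by (simp add: ops \<Xi>)
qed

sublocale A: lie_conformal_superalgebra "sub_lcs R A"
  by (rule sub_lcs_lcs[OF A_subalgebra])

section \<open>Ideals, rank and derivation-simplicity of the constants\<close>

lemma A_conformal_ideal:
  "A.conformal_ideal J \<longleftrightarrow> vs.subspace J \<and> J \<subseteq> A \<and> (\<forall>x\<in>J. sg 1 x \<in> J) \<and> (\<forall>x\<in>J. D x \<in> J) \<and>
     (\<forall>l. \<forall>a\<in>A. \<forall>x\<in>J. B l a x \<in> J)"
proof (cases "J \<subseteq> A")
  case True
  then have "A.sg 1 x = sg 1 x" if "x \<in> J" for x using parity_map_sub_lcs[OF A_subalgebra] that by blast
  then show ?thesis unfolding A.conformal_ideal_def A.graded_subspace_def by auto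
qed (simp add: A.conformal_ideal_def A.graded_subspace_def)

lemma not_abelian_A: "\<not> abelian (sub_lcs R A)"
proof
  assume "abelian (sub_lcs R A)"
  then have z: "B m a b = 0" if "a \<in> A" "b \<in> A" for m a b using that unfolding A.abelian_iff by simp
  have "B m a x = 0" if ax: "a \<in> C" "x \<in> C" for m a x
  proof -
    obtain a0 a1 where a: "a0 \<in> A" "a1 \<in> A" "a = a0 + \<xi> a1" using decomp_cases[OF ax(1)] by blast
    obtain x0 x1 where x: "x0 \<in> A" "x1 \<in> A" "x = x0 + \<xi> x1" using decomp_cases[OF ax(2)] by blast
    show ?thesis unfolding a(3) x(3)
      using a x A_carrier by (simp add: bracket_components z A_closed(5) \<Xi>(6))
  qed
  then show False using not_abelian unfolding abelian_iff by blast
qed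

lemma Dpow_A: "x \<in> A \<Longrightarrow> (D ^^ k) x \<in> A"
  by (induction k) (simp_all add: A_closed)

lemma Dpow_\<xi>: "x \<in> C \<Longrightarrow> (D ^^ k) (\<xi> x) = \<xi> ((D ^^ k) x)"
  by (induction k) (simp_all add: centroid_mapD(2)[OF \<xi>] Dpow_closed)

text \<open>Without a free element everything would be torsion, and \<open>torsion_action\<close>
  for the zero ideal would make the algebra abelian. For the drop, a nonempty free family in
  \<open>A\<close> stays free when \<open>\<xi> (x 0)\<close> is adjoined, because every relation
  splits along \<open>A + \<xi> A\<close>.\<close>

lemma rank_drop:
  assumes b: "rank_le R b C"
  shows "b > 0" "rank_le R (b - 1) A"
proof -
  have "\<exists>y\<in>C. free_family R 1 (\<lambda>i. y)"
  proof (rule ccontr)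
    assume no: "\<not> ?thesis"
    have "B l a y = 0" if a: "a \<in> C" and y: "y \<in> C" for l a y
    proof -
      obtain d c k where c: "(\<Sum>k\<le>d. smul R (c 0 k) ((D ^^ k) y)) = 0" "k \<le> d" "c 0 k \<noteq> 0"
        using no y unfolding free_family_def by fastforce
      have "conformal_ideal {0}"
        by (rule conformal_idealI)
          (auto simp: B_zero_right linear_zero[OF der_linear] linear_zero[OF linear_parity_map])
      then have "B l a y \<in> {0}"
        by (rule torsion_action[of _ _ _ "c 0" d k]) (use a y c in auto)
      then show ?thesis by simp
    qed
    then show False using not_abelian unfolding abelian_iff by blast
  qed
  then obtain y where "y \<in> C" "free_family R 1 (\<lambda>i. y)" by blast
  then have one: "1 \<le> b" using b[unfolded rank_le_def, THEN spec[of _ 1], THEN spec[of _ "\<lambda>i. y"]] by simp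
  then show "b > 0" by simp
  have "m \<le> b - 1" if x: "\<forall>i<m. x i \<in> A" and free: "free_family R m x" for m x
  proof (cases "m = 0")
    case False
    let ?x = "x(m := \<xi> (x 0))"
    have "free_family R (Suc m) ?x"
      unfolding free_family_def
    proof (intro allI impI)
      fix d c i k
      assume r: "(\<Sum>i<Suc m. \<Sum>k\<le>d. smul R (c i k) ((D ^^ k) (?x i))) = 0" and ik: "i < Suc m" "k \<le> d"
      let ?s = "\<Sum>i<m. \<Sum>k\<le>d. smul R (c i k) ((D ^^ k) (x i))"
      let ?t = "\<Sum>k\<le>d. smul R (c m k) ((D ^^ k) (x 0))"
      have x0: "x 0 \<in> A" using x False by simp
      have s: "?s \<in> A" using x by (intro vs.subspace_sum[OF A_closed(1)] A_closed(7) Dpow_A) simp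
      have t: "?t \<in> A" using x0 by (intro vs.subspace_sum[OF A_closed(1)] A_closed(7) Dpow_A)
      have "\<xi> ?t = (\<Sum>k\<le>d. smul R (c m k) ((D ^^ k) (\<xi> (x 0))))"
        using A_carrier[OF x0] by (simp add: linear_sum[OF linear_\<xi>] carrier_smul Dpow_closed \<Xi>(3) Dpow_\<xi>)
      then have "?s + \<xi> ?t = 0" using r by simp
      then have s0: "?s = 0" and t0: "?t = 0" using components[OF s t] \<Delta>(6) \<Xi>(6) by auto
      have cs: "\<forall>i<m. \<forall>k\<le>d. c i k = 0" using s0 free unfolding free_family_def by blast
      \<comment> \<open>The \<open>\<xi>\<close> part of the relation involves \<open>x 0\<close>
        alone; it is read as a relation of the whole family with zero coefficients
        elsewhere.\<close>
      let ?c = "\<lambda>i k. if i = 0 then c m k else 0"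
      have "(\<Sum>i<m. \<Sum>k\<le>d. smul R (?c i k) ((D ^^ k) (x i))) = (\<Sum>i\<in>{0}. \<Sum>k\<le>d. smul R (?c i k) ((D ^^ k) (x i)))"
        by (rule sum.mono_neutral_right) (use False in auto)
      then have "(\<Sum>i<m. \<Sum>k\<le>d. smul R (?c i k) ((D ^^ k) (x i))) = 0" using t0 by simp
      then have c0: "\<forall>i<m. \<forall>k\<le>d. ?c i k = 0"
        by (rule free[unfolded free_family_def, THEN spec[of _ d], THEN spec[of _ ?c], THEN mp])
      have "0 < m" using False by simp
      from c0[THEN spec[of _ 0], THEN mp, OF this] have "\<forall>k\<le>d. c m k = 0" by simp
      then show "c i k = 0" using cs ik by (cases "i = m") simp_all
    qed
    moreover have "\<forall>i<Suc m. ?x i \<in> C" using x A_carrier \<Xi>(1) False by (auto simp: less_Suc_eq)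
    ultimately have "Suc m \<le> b" using b unfolding rank_le_def by blast
    then show ?thesis by simp
  qed simp
  then show "rank_le R (b - 1) A" unfolding rank_le_def by blast
qed

text \<open>The obvious candidate \<open>J' + \<xi> J'\<close> may fail to be stable: a derivation
  applied to \<open>\<xi> y\<close> produces its commutator with \<open>\<xi>\<close>, a centroid
  map that need not respect \<open>J'\<close>. On a bracket of \<open>a\<close> with
  \<open>c \<in> J'\<close>, however, that map can act on \<open>a\<close> and leave
  \<open>c\<close> alone. Hence \<open>J'\<close> is first replaced by the span \<open>K\<close> of
  such brackets.\<close>

lemma derivation_simple_A: "A.derivation_simple"
  unfolding A.derivation_simple_def sub_lcs_simps
proof (intro allI impI)
  fix J' assume J': "A.conformal_ideal J' \<and> A.stable J'"
  define K where "K = bracket_span (sub_lcs R A) J'"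
  have KA: "A.conformal_ideal K" and KJ: "K \<subseteq> J'" and Kst: "A.stable K"
    using J' A.bracket_span_ideal A.bracket_span_stable unfolding K_def by blast+
  have J'A: "J' \<subseteq> A" using J' A.conformal_idealD(3) by auto
  have K: "vs.subspace K" "\<And>x. x \<in> K \<Longrightarrow> x \<in> A" "\<And>x. x \<in> K \<Longrightarrow> sg 1 x \<in> K" "\<And>x. x \<in> K \<Longrightarrow> D x \<in> K"
    "\<And>l a x. a \<in> A \<Longrightarrow> x \<in> K \<Longrightarrow> B l a x \<in> K"
    using KA unfolding A_conformal_ideal by blast+
  have K0: "0 \<in> K" and Kadd: "\<And>x y. x \<in> K \<Longrightarrow> y \<in> K \<Longrightarrow> x + y \<in> K"
    and Kscale: "\<And>c x. x \<in> K \<Longrightarrow> smul R c x \<in> K" and Kneg: "\<And>x. x \<in> K \<Longrightarrow> - x \<in> K"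
    using vs.subspace_0[OF K(1)] vs.subspace_add[OF K(1)] vs.subspace_scale[OF K(1)] vs.subspace_neg[OF K(1)]
    by blast+
  define J where "J = {x \<in> C. \<delta> (\<xi> x) \<in> K \<and> \<delta> x \<in> K}"
  have JI: "u + \<xi> v \<in> J" if "u \<in> K" "v \<in> K" for u v
    unfolding J_def using components[OF K(2) K(2), OF that] that A_carrier K(2) \<Xi>(1) carrier_add by simp
  have JE: "\<exists>u\<in>K. \<exists>v\<in>K. x = u + \<xi> v" if "x \<in> J" for x
    using that components_decomp unfolding J_def by blast
  have Jsub: "vs.subspace J"
  proof -
    have "J = {x \<in> C. \<delta> (\<xi> x) \<in> K} \<inter> {x \<in> C. \<delta> x \<in> K}" unfolding J_def by blast
    then show ?thesis
      using vs.subspace_inter[OF subspace_preimage[OF linear_comp[OF linear_\<delta> linear_\<xi>] K(1)]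
          subspace_preimage[OF linear_\<delta> K(1)]] by simp
  qed
  have "conformal_ideal J"
  proof (rule conformal_idealI[OF Jsub])
    show "J \<subseteq> C" unfolding J_def by blast
    show "sg 1 x \<in> J" if "x \<in> J" for x
      using that unfolding J_def by (simp add: \<Delta> \<Xi> ops Kscale Kneg K(3))
    show "D x \<in> J" if "x \<in> J" for x
      using that unfolding J_def by (simp add: \<Delta> \<Xi> ops K(4) centroid_mapD(2)[OF \<xi>] derivation_atD(2)[OF \<delta>])
    fix m a x assume a: "a \<in> C" and x: "x \<in> J"
    obtain u v where uv: "u \<in> K" "v \<in> K" "x = u + \<xi> v" using JE[OF x] by blast
    obtain a0 a1 where a01: "a0 \<in> A" "a1 \<in> A" "a = a0 + \<xi> a1" using decomp_cases[OF a] by blast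
    have c: "u \<in> C" "v \<in> C" "a0 \<in> C" "a1 \<in> C" using uv a01 K(2) A_carrier by auto
    show "B m a x \<in> J"
      unfolding a01(3) uv(3) bracket_components[OF c(3,4,1,2)]
      by (intro JI Kadd K(5) A_closed(5) uv a01)
  qed
  moreover have "stable J"
    unfolding stable_def
  proof (intro allI ballI impI)
    fix s \<phi> l x assume x: "x \<in> J" and \<phi>: "derivation_family R s \<phi>"
    note P = derivation_familyD[OF \<phi>]
    note PH = homogeneous_mapD[OF P(2)]
    \<comment> \<open>Taylor expansion in the odd variable: \<open>\<phi>\<close> is
      \<open>\<phi>0\<close> plus \<open>\<xi>\<close> times \<open>\<phi>1\<close>, and both
      coefficients are derivations that preserve \<open>A\<close>.\<close>
    define \<phi>1 where "\<phi>1 k = supercommutator R 1 s \<delta> (\<phi> k)" for k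
    define \<phi>0 where "\<phi>0 k = (\<lambda>x. \<phi> k x - \<xi> (\<phi>1 k x))" for k
    have d1: "derivation_at R (1 + s) k (\<phi>1 k)" for k
      unfolding \<phi>1_def using derivation_at_supercommutator[OF \<delta> P(1)] by simp
    have d0: "derivation_at R s k (\<phi>0 k)" for k
      unfolding \<phi>0_def using derivation_at_diff[OF P(1)] derivation_at_centroid_comp[OF \<xi> d1, of k] by simp
    have f1: "derivation_family R (1 + s) \<phi>1"
      unfolding derivation_family_def
    proof (intro conjI allI ballI d1)
      fix x assume x: "x \<in> C"
      show "polynomial_family R (\<lambda>k. \<phi>1 k x)"
        unfolding \<phi>1_def supercommutator_def
        by (intro polynomial_family_diff polynomial_family_scale P(3) \<Delta>(1) x
            polynomial_family_linear[OF P(3) linear_\<delta>])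
    qed
    have f0: "derivation_family R s \<phi>0"
      unfolding derivation_family_def
    proof (intro conjI allI ballI d0)
      fix x assume x: "x \<in> C"
      show "polynomial_family R (\<lambda>k. \<phi>0 k x)"
        unfolding \<phi>0_def
        by (intro polynomial_family_diff P(3) x
            polynomial_family_linear[OF derivation_familyD(3)[OF f1 x] linear_\<xi>])
    qed
    have \<phi>1A: "\<phi>1 k y = \<delta> (\<phi> k y)" if "y \<in> A" for k y
      unfolding \<phi>1_def supercommutator_def using \<delta>_A[OF that] PH(6) by simp
    have A1: "\<phi>1 k y \<in> A" if "y \<in> A" for k y
      unfolding \<phi>1A[OF that] by (rule \<delta>_mem[OF P(4)[OF A_carrier[OF that]]])
    have A0: "\<phi>0 k y \<in> A" if y: "y \<in> A" for k y
    proof -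
      have c: "\<phi> k y \<in> C" "\<phi>1 k y \<in> C" using P(4) A_carrier y A1[OF y] by auto
      have "\<delta> (\<phi>0 k y) = 0"
        unfolding \<phi>0_def using c \<delta>_\<xi>_A[OF A1[OF y]] by (simp add: \<Delta> \<Xi>(1) \<phi>1A[OF y])
      moreover have "\<phi>0 k y \<in> C" unfolding \<phi>0_def using c by (simp add: ops \<Xi>(1))
      ultimately show ?thesis unfolding A_def by simp
    qed
    have K1: "\<phi>1 k y \<in> K" "\<phi>0 k y \<in> K" if "y \<in> K" for k y
      using Kst that derivation_family_sub_lcs[OF A_subalgebra f1 A1]
        derivation_family_sub_lcs[OF A_subalgebra f0 A0] unfolding A.stable_def by blast+
    have KJ: "\<phi> k y \<in> J" if "y \<in> K" for k y
    proof -
      have "\<phi> k y = \<phi>0 k y + \<xi> (\<phi>1 k y)" by (simp add: \<phi>0_def)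
      then show ?thesis using JI[OF K1(2,1), OF that that] by simp
    qed
    have "\<phi> l (\<xi> y) \<in> J" if y: "y \<in> K" for y
    proof -
      define \<psi> where "\<psi> = supercommutator R s 1 (\<phi> l) \<xi>"
      have \<psi>: "centroid_map R (s + 1) l \<psi>"
        unfolding \<psi>_def using centroid_map_supercommutator[OF P(1) \<xi>, of l] by simp
      let ?X = "{B m a c |m a c. a \<in> A \<and> c \<in> J'}"
      have yX: "y \<in> vs.span ?X" using y by (simp add: K_def bracket_span_def)
      have "\<psi> y \<in> J"
      proof (rule span_map[OF yX _ homogeneous_map_linear[OF centroid_mapD(1)[OF \<psi>]] Jsub])
        show "?X \<subseteq> C" using A_carrier J'A B_closed by blast
        fix z assume "z \<in> ?X"
        then obtain m a c where z: "z = B m a c" "a \<in> A" "c \<in> J'" by blast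
        have c: "c \<in> A" "c \<in> C" using z(3) J'A A_carrier by auto
        have pa: "\<psi> a \<in> C" using homogeneous_mapD(1)[OF centroid_mapD(1)[OF \<psi>] A_carrier[OF z(2)]] .
        obtain a0 a1 where a: "a0 \<in> A" "a1 \<in> A" "\<psi> a = a0 + \<xi> a1" using decomp_cases[OF pa] by blast
        have "\<psi> z = B (l + m) (a0 + \<xi> a1) (c + \<xi> 0)"
          unfolding z(1) using centroid_map_left[OF \<psi> A_carrier[OF z(2)] c(2), of m] a(3) by (simp add: \<Xi>(6))
        also have "\<dots> = B (l + m) a0 c + \<xi> (B (l + m) a1 c)"
          using a(1,2) A_carrier c by (simp add: bracket_components[of a0 a1 c 0] ops)
        also have "\<dots> \<in> J"
          by (rule JI) (use A.bracket_span_superset[of _ c J'] a(1,2) z(3) in \<open>simp_all add: K_def\<close>)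
        finally show "\<psi> z \<in> J" .
      qed
      moreover have "\<xi> (\<phi> l y) = 0 + \<xi> (\<phi>0 l y)"
      proof -
        have yA: "y \<in> A" by (rule K(2)[OF y])
        have "\<phi> l y = \<phi>0 l y + \<xi> (\<phi>1 l y)" by (simp add: \<phi>0_def)
        then show ?thesis using A_carrier[OF A0[OF yA]] A_carrier[OF A1[OF yA]] by (simp add: \<Xi> \<xi>_\<xi>)
      qed
      then have "\<xi> (\<phi> l y) \<in> J" using JI[OF K0 K1(2)[OF y]] by simp
      ultimately have "\<psi> y + smul R (koszul s 1) (\<xi> (\<phi> l y)) \<in> J"
        by (intro vs.subspace_add[OF Jsub] vs.subspace_scale[OF Jsub])
      then show ?thesis unfolding \<psi>_def supercommutator_def by simp
    qed
    moreover obtain u v where uv: "u \<in> K" "v \<in> K" "x = u + \<xi> v" using JE[OF x] by blast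
    moreover have "\<phi> l x = \<phi> l u + \<phi> l (\<xi> v)"
      unfolding uv(3) using A_carrier K(2) uv \<Xi>(1) by (intro PH(2)) auto
    ultimately show "\<phi> l x \<in> J" using KJ vs.subspace_add[OF Jsub] by simp
  qed
  ultimately have "J = {0} \<or> J = C" using derivation_simple unfolding derivation_simple_def by blast
  then show "J' = {0} \<or> J' = A"
  proof
    assume J: "J = C"
    have "x \<in> J'" if "x \<in> A" for x
    proof -
      have "\<delta> (\<xi> x) \<in> K" using J A_carrier[OF that] unfolding J_def by blast
      then show ?thesis using \<delta>_\<xi>_A[OF that] KJ by auto
    qed
    then show ?thesis using J'A by blast
  next
    assume J: "J = {0}"
    \<comment> \<open>Then all brackets of \<open>A\<close> with \<open>J'\<close> vanish, and so do
      those of \<open>C\<close>; thus \<open>J'\<close> is central.\<close>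
    have Kz: "y = 0" if "y \<in> K" for y
      using JI[OF that K0] J \<Xi>(6) by simp
    have "c = 0" if c: "c \<in> J'" for c
    proof (rule centralI)
      have cA: "c \<in> A" using c J'A by blast
      then show "c \<in> C" by (rule A_carrier)
      fix m a assume "a \<in> C"
      then obtain a0 a1 where a: "a0 \<in> A" "a1 \<in> A" "a = a0 + \<xi> a1" using decomp_cases by blast
      have z: "B m a0 c = 0" "B m a1 c = 0"
        using A.bracket_span_superset[of _ c J' m] a(1,2) c Kz by (simp_all add: K_def)
      have "B m a c = B m (a0 + \<xi> a1) (c + \<xi> 0)" using a(3) by (simp add: \<Xi>(6))
      also have "\<dots> = B m a0 c + \<xi> (B m a1 c + B m (sg 1 a0) 0)"
        by (rule bracket_components) (use a(1,2) A_carrier cA in auto)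
      also have "\<dots> = 0" using A_carrier[OF A_closed(5)[OF a(1)]] by (simp add: z \<Xi>(6) B_zero_right)
      finally show "B m a c = 0" .
    qed
    then have "J' \<subseteq> {0}" by blast
    moreover have "0 \<in> J'" using J' A.conformal_idealD(9) by blast
    ultimately show ?thesis by blast
  qed
qed

section \<open>Extension of centroid maps from the constants\<close>

text \<open>The only possible extension: by \<open>centroid_maps_supercommute\<close> it has to
  supercommute with \<open>\<xi>\<close>, which forces the sign \<open>koszul t 1\<close> on the
  second component.\<close>

definition extend :: "bit \<Rightarrow> ('a \<Rightarrow> 'a) \<Rightarrow> 'a \<Rightarrow> 'a" where
  "extend t g = (\<lambda>x. g (\<delta> (\<xi> x)) + smul R (koszul t 1) (\<xi> (g (\<delta> x))))"

lemma extend_components: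
  assumes "u \<in> A" "v \<in> A"
  shows "extend t g (u + \<xi> v) = g u + smul R (koszul t 1) (\<xi> (g v))"
  unfolding extend_def components[OF assms] ..

lemma extend_centroid_map:
  assumes g: "centroid_map (sub_lcs R A) t 0 g"
  shows "centroid_map R t 0 (extend t g)"
proof -
  note G = A.homogeneous_mapD[OF A.centroid_mapD(1)[OF g], unfolded sub_lcs_simps]
  have gA: "g x \<in> A" "g x \<in> C" if "x \<in> A" for x using G(1)[OF that] A_carrier by auto
  have gD: "g (D x) = D (g x)" if "x \<in> A" for x
    using A.centroid_mapD(2)[OF g] that by simp
  have gB: "g (B m x y) = B m (sg t x) (g y)" if "x \<in> A" "y \<in> A" for m x y
    using A.centroid_mapD(3)[OF g] that parity_map_sub_lcs[OF A_subalgebra] by simp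
  have gBl: "g (B m x y) = B m (g x) y" if "x \<in> A" "y \<in> A" for m x y
    using A.centroid_map_left[OF g] that by simp
  have gs: "g (sg s x) = smul R (koszul t s) (sg s (g x))" if "x \<in> A" for s x
    using G(7)[of x s] that gA(1)[OF that] parity_map_sub_lcs[OF A_subalgebra] by simp
  have lin: "linear_map R R (extend t g)"
    unfolding linear_map_def
  proof (intro conjI ballI allI)
    fix x assume x: "x \<in> C"
    show "extend t g x \<in> C"
      unfolding extend_def using component_mem[OF x] gA \<Xi>(1) by (simp add: ops)
    show "extend t g (smul R c x) = smul R c (extend t g x)" for c
      unfolding extend_def using component_mem[OF x] gA x
      by (simp add: ops \<Xi> \<Delta> G(3) smul_add mult.commute)
    fix y assume y: "y \<in> C"
    show "extend t g (x + y) = extend t g x + extend t g y"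
      unfolding extend_def using component_mem[OF x] component_mem[OF y] gA x y
      by (simp add: ops \<Xi> \<Delta> G(2) smul_add)
  qed
  have "homogeneous_map R t (extend t g)"
  proof (rule homogeneous_mapI[OF lin])
    fix x s assume x: "x \<in> C"
    obtain u v where uv: "u \<in> A" "v \<in> A" "x = u + \<xi> v" using decomp_cases[OF x] by blast
    have c: "u \<in> C" "v \<in> C" "\<xi> v \<in> C" using uv A_carrier \<Xi>(1) by auto
    have "sg s x = sg s u + \<xi> (smul R (koszul 1 s) (sg s v))"
      unfolding uv(3) using c by (simp add: ops \<Xi>)
    moreover have "smul R (koszul 1 s) (sg s v) \<in> A" by (intro A_closed uv)
    ultimately have "extend t g (sg s x) = g (sg s u) + smul R (koszul t 1) (\<xi> (g (smul R (koszul 1 s) (sg s v))))"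
      using extend_components[OF A_closed(5)[OF uv(1)]] by simp
    also have "\<dots> = smul R (koszul t s) (sg s (g u + smul R (koszul t 1) (\<xi> (g v))))"
      using uv gA A_closed(5)[OF uv(2)] by (simp add: gs G(3) \<Xi> ops smul_add mult.commute mult.left_commute)
    also have "\<dots> = smul R (koszul t s) (sg s (extend t g x))"
      unfolding uv(3) extend_components[OF uv(1,2)] ..
    finally show "extend t g (sg s x) = smul R (koszul t s) (sg s (extend t g x))" .
  qed
  moreover have "extend t g (D x) = D (extend t g x) + smul R 0 (extend t g x)" if x: "x \<in> C" for x
  proof -
    obtain u v where uv: "u \<in> A" "v \<in> A" "x = u + \<xi> v" using decomp_cases[OF x] by blast
    have c: "u \<in> C" "v \<in> C" "\<xi> v \<in> C" using uv A_carrier \<Xi>(1) by auto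
    have "D x = D u + \<xi> (D v)" unfolding uv(3) using c by (simp add: ops centroid_mapD(2)[OF \<xi>])
    then have "extend t g (D x) = g (D u) + smul R (koszul t 1) (\<xi> (g (D v)))"
      using extend_components A_closed(3) uv by simp
    also have "\<dots> = D (extend t g x)"
      unfolding uv(3) extend_components[OF uv(1,2)] using uv gA
      by (simp add: gD ops \<Xi>(1) centroid_mapD(2)[OF \<xi>])
    finally show ?thesis by simp
  qed
  moreover have "extend t g (B m a x) = B m (sg t a) (extend t g x)" if a: "a \<in> C" and x: "x \<in> C" for m a x
  proof -
    obtain u v where uv: "u \<in> A" "v \<in> A" "x = u + \<xi> v" using decomp_cases[OF x] by blast
    obtain a0 a1 where b: "a0 \<in> A" "a1 \<in> A" "a = a0 + \<xi> a1" using decomp_cases[OF a] by blast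
    have c: "u \<in> C" "v \<in> C" "a0 \<in> C" "a1 \<in> C" using uv b A_carrier by auto
    have s: "sg t a0 \<in> A" "sg t a1 \<in> A" "sg 1 a0 \<in> A" using b A_closed(5) by auto
    let ?k = "koszul t 1"
    have "extend t g (B m a x) = g (B m a0 u) + smul R ?k (\<xi> (g (B m a1 u + B m (sg 1 a0) v)))"
      unfolding b(3) uv(3) bracket_components[OF c(3,4,1,2)]
      by (rule extend_components) (intro A_closed uv b)+
    also have "\<dots> = B m (sg t a0) (g u) + smul R ?k (\<xi> (B m (sg t a1) (g u) + B m (sg t (sg 1 a0)) (g v)))"
      using uv b s A_closed(4) by (simp add: gB G(2))
    also have "\<dots> = B m (sg t a0 + \<xi> (smul R ?k (sg t a1))) (g u + \<xi> (smul R ?k (g v)))"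
    proof -
      have e: "g u \<in> C" "g v \<in> C" "sg t a0 \<in> C" "sg t a1 \<in> C" "sg t (sg 1 a0) \<in> C"
        using gA[OF uv(1)] gA[OF uv(2)] s A_carrier A_closed(5)[OF s(3)] by auto
      have "B m (sg t a0 + \<xi> (smul R ?k (sg t a1))) (g u + \<xi> (smul R ?k (g v))) =
          B m (sg t a0) (g u) + \<xi> (B m (smul R ?k (sg t a1)) (g u) + B m (sg 1 (sg t a0)) (smul R ?k (g v)))"
        by (rule bracket_components) (use e carrier_smul in auto)
      then show ?thesis using e c
        by (simp add: ops \<Xi> smul_add parity_map_parity_map add.commute[of 1 t])
    qed
    also have "sg t a0 + \<xi> (smul R ?k (sg t a1)) = sg t a"
      unfolding b(3) using c by (simp add: ops \<Xi> koszul_commute)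
    also have "g u + \<xi> (smul R ?k (g v)) = extend t g x"
      unfolding uv(3) extend_components[OF uv(1,2)] using gA[OF uv(2)] by (simp add: \<Xi>)
    finally show ?thesis .
  qed
  ultimately show ?thesis unfolding centroid_map_def by blast
qed

lemma extend_A:
  assumes x: "x \<in> A" and g: "homogeneous_map (sub_lcs R A) t g"
  shows "extend t g x = g x"
  unfolding extend_def \<delta>_\<xi>_A[OF x] \<delta>_A[OF x] A.homogeneous_mapD(6)[OF g] by (simp add: \<Xi>(6))

lemma extend_extend:
  assumes h: "homogeneous_map (sub_lcs R A) t h" and g: "homogeneous_map (sub_lcs R A) s g" and x: "x \<in> C"
  shows "extend s g (extend t h x) = extend (s + t) (\<lambda>x. g (h x)) x"
proof -
  note H = A.homogeneous_mapD[OF h, unfolded sub_lcs_simps] and G = A.homogeneous_mapD[OF g, unfolded sub_lcs_simps]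
  obtain u v where uv: "u \<in> A" "v \<in> A" "x = u + \<xi> v" using decomp_cases[OF x] by blast
  have hA: "h u \<in> A" "h v \<in> A" "g (h v) \<in> A" using H(1) G(1) uv by auto
  have "extend t h x = h u + \<xi> (smul R (koszul t 1) (h v))"
    unfolding uv(3) extend_components[OF uv(1,2)] using A_carrier[OF hA(2)] by (simp add: \<Xi>)
  then have "extend s g (extend t h x) = g (h u) + smul R (koszul s 1) (\<xi> (g (smul R (koszul t 1) (h v))))"
    using extend_components[OF hA(1) A_closed(7)[OF hA(2)]] by simp
  also have "\<dots> = extend (s + t) (\<lambda>x. g (h x)) x"
    unfolding uv(3) extend_components[OF uv(1,2)] using hA A_carrier[OF hA(3)]
    by (simp add: G(3) \<Xi> koszul_add)
  finally show ?thesis .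
qed

end

section \<open>Decomposition over a Grassmann algebra\<close>

text \<open>An internal form of the tensor product: \<open>\<theta> I\<close> is left multiplication
  by the monomial of \<open>I\<close>, with coefficients from \<open>S\<close>. Operators on one
  carrier spare the induction iterated tensor products and changes of type.\<close>

definition grassmann_decomposition ::
  "('a::ab_group_add) lcs \<Rightarrow> nat \<Rightarrow> 'a set \<Rightarrow> (nat set \<Rightarrow> 'a \<Rightarrow> 'a) \<Rightarrow> bool" where
  "grassmann_decomposition R n S \<theta> \<longleftrightarrow>
     S \<subseteq> carrier R \<and> lie_conformal_superalgebra (sub_lcs R S) \<and> simple_lcs (sub_lcs R S) \<and>
     (\<forall>I\<subseteq>{..<n}. centroid_map R (of_nat (card I)) 0 (\<theta> I)) \<and>
     (\<forall>x\<in>carrier R. \<theta> {} x = x) \<and>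
     (\<forall>I\<subseteq>{..<n}. \<forall>J\<subseteq>{..<n}. \<forall>x\<in>carrier R.
        \<theta> I (\<theta> J x) = (if I \<inter> J = {} then smul R (grass_sign I J) (\<theta> (I \<union> J) x) else 0)) \<and>
     (\<forall>x\<in>carrier R. \<exists>s. (\<forall>I\<subseteq>{..<n}. s I \<in> S) \<and> x = (\<Sum>I\<in>Pow {..<n}. \<theta> I (s I))) \<and>
     (\<forall>s. (\<forall>I\<subseteq>{..<n}. s I \<in> S) \<and> (\<Sum>I\<in>Pow {..<n}. \<theta> I (s I)) = 0 \<longrightarrow> (\<forall>I\<subseteq>{..<n}. s I = 0))"

lemma sum_Pow_lessThan_Suc:
  fixes f :: "nat set \<Rightarrow> 'a::comm_monoid_add"
  shows "(\<Sum>K\<in>Pow {..<Suc n}. f K) = (\<Sum>I\<in>Pow {..<n}. f I) + (\<Sum>I\<in>Pow {..<n}. f (insert n I))"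
proof -
  have "inj_on (insert n) (Pow {..<n})"
    by (rule inj_onI) (metis Pow_iff insert_ident lessThan_iff less_irrefl subset_iff)
  moreover have "Pow {..<n} \<inter> insert n ` Pow {..<n} = {}" by auto
  ultimately show ?thesis
    unfolding lessThan_Suc Pow_insert
    by (subst sum.union_disjoint) (auto simp: sum.reindex)
qed

lemma grass_sign_ordered: "(\<And>i j. i \<in> I \<Longrightarrow> j \<in> J \<Longrightarrow> i \<le> j) \<Longrightarrow> grass_sign I J = 1"
proof -
  assume "\<And>i j. i \<in> I \<Longrightarrow> j \<in> J \<Longrightarrow> i \<le> j"
  then have "{(i, j). i \<in> I \<and> j \<in> J \<and> j < i} = {}" by fastforce
  then show ?thesis unfolding grass_sign_def by (simp only: card.empty power_0)
qed

text \<open>All of \<open>J\<close> lies below \<open>n\<close>, so each of its elements contributes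
  one inversion.\<close>

lemma grass_sign_singleton_left:
  assumes "\<And>j. j \<in> J \<Longrightarrow> j < n"
  shows "grass_sign {n} J = (- 1) ^ card J"
proof -
  have "{(i, j). i \<in> {n} \<and> j \<in> J \<and> j < i} = Pair n ` J" using assms by auto
  moreover have "card (Pair n ` J) = card J" by (rule card_image) (simp add: inj_on_def)
  ultimately show ?thesis unfolding grass_sign_def by (simp only:)
qed

context grassmann_pair begin

lemma derivation_simple_lcs_A: "derivation_simple_lcs (sub_lcs R A)"
proof unfold_locales
  show "A.derivation_simple" by (rule derivation_simple_A)
  show "\<not> abelian (sub_lcs R A)" by (rule not_abelian_A)
  show "\<exists>b. rank_le (sub_lcs R A) b (carrier (sub_lcs R A))"
    using rank_bounded rank_drop(2) unfolding rank_le_sub_lcs sub_lcs_simps by blast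
qed

end

text \<open>The new generator gets the largest index \<open>n\<close>. Accordingly
  \<open>\<xi>\<close> is applied before the extended old operators, so that it stands last in its
  monomials, in increasing order.\<close>

lemma grassmann_decomposition_lift:
  fixes R :: "('a::ab_group_add) lcs"
  assumes "grassmann_pair R \<delta> \<xi> A" and dec: "grassmann_decomposition (sub_lcs R A) n S \<theta>"
  shows "\<exists>\<theta>. grassmann_decomposition R (Suc n) S \<theta>"
proof -
  interpret grassmann_pair R \<delta> \<xi> A by fact
  have SA: "S \<subseteq> A"
    and Slcs: "lie_conformal_superalgebra (sub_lcs R S)" "simple_lcs (sub_lcs R S)"
    and cm: "\<And>I. I \<subseteq> {..<n} \<Longrightarrow> centroid_map (sub_lcs R A) (of_nat (card I)) 0 (\<theta> I)"
    and emp: "\<And>x. x \<in> A \<Longrightarrow> \<theta> {} x = x"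
    and prod: "\<And>I J x. I \<subseteq> {..<n} \<Longrightarrow> J \<subseteq> {..<n} \<Longrightarrow> x \<in> A \<Longrightarrow>
      \<theta> I (\<theta> J x) = (if I \<inter> J = {} then smul R (grass_sign I J) (\<theta> (I \<union> J) x) else 0)"
    and ex: "\<And>x. x \<in> A \<Longrightarrow> \<exists>s. (\<forall>I\<subseteq>{..<n}. s I \<in> S) \<and> x = (\<Sum>I\<in>Pow {..<n}. \<theta> I (s I))"
    and uniq: "\<And>s I. \<forall>I\<subseteq>{..<n}. s I \<in> S \<Longrightarrow> (\<Sum>I\<in>Pow {..<n}. \<theta> I (s I)) = 0 \<Longrightarrow> I \<subseteq> {..<n} \<Longrightarrow> s I = 0"
    using dec sub_lcs_sub_lcs[of S A R] unfolding grassmann_decomposition_def by simp_all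
  have hm: "homogeneous_map (sub_lcs R A) (of_nat (card I)) (\<theta> I)" if "I \<subseteq> {..<n}" for I
    using A.centroid_mapD(1)[OF cm[OF that]] .
  have \<theta>A: "\<theta> I x \<in> A" if "I \<subseteq> {..<n}" "x \<in> A" for I x
    using A.homogeneous_mapD(1)[OF hm[OF that(1)]] that(2) by simp
  have \<theta>smul: "\<theta> I (smul R c x) = smul R c (\<theta> I x)" if "I \<subseteq> {..<n}" "x \<in> A" for I x c
    using A.homogeneous_mapD(3)[OF hm[OF that(1)]] that(2) by simp
  define E where "E I = extend (of_nat (card I)) (\<theta> I)" for I
  have Ec: "centroid_map R (of_nat (card I)) 0 (E I)" if "I \<subseteq> {..<n}" for I
    unfolding E_def by (rule extend_centroid_map[OF cm[OF that]])
  note Eh = homogeneous_mapD[OF centroid_mapD(1)[OF Ec]]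
  have EA: "E I x = \<theta> I x" if "I \<subseteq> {..<n}" "x \<in> A" for I x
    unfolding E_def by (rule extend_A[OF that(2) hm[OF that(1)]])
  have EE: "E I (E J x) = (if I \<inter> J = {} then smul R (grass_sign I J) (E (I \<union> J) x) else 0)"
    if I: "I \<subseteq> {..<n}" and J: "J \<subseteq> {..<n}" and x: "x \<in> C" for I J x
  proof -
    have fin: "finite I" "finite J" using I J finite_subset by auto
    have IJ: "I \<union> J \<subseteq> {..<n}" using I J by blast
    let ?u = "\<delta> (\<xi> x)" and ?v = "\<delta> x"
    have c: "?u \<in> A" "?v \<in> A" using component_mem[OF x] by auto
    have 1: "E I (E J x) = extend (of_nat (card I) + of_nat (card J)) (\<lambda>x. \<theta> I (\<theta> J x)) x"
      unfolding E_def by (rule extend_extend[OF hm[OF J] hm[OF I] x])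
    show ?thesis
    proof (cases "I \<inter> J = {}")
      case True
      then have "(of_nat (card I) + of_nat (card J) :: bit) = of_nat (card (I \<union> J))"
        using fin by (simp add: card_Un_disjoint)
      moreover have "\<theta> (I \<union> J) ?v \<in> C" by (rule A_carrier[OF \<theta>A[OF IJ c(2)]])
      ultimately show ?thesis
        unfolding 1 using True by (simp add: E_def extend_def prod[OF I J] c \<Xi>(3) smul_add mult.commute)
    next
      case False
      then show ?thesis unfolding 1 by (simp add: extend_def prod[OF I J] c \<Xi>(6))
    qed
  qed
  \<comment> \<open>The sign of moving \<open>\<xi>\<close> past the monomial of
    \<open>I\<close>.\<close>
  define k :: "nat set \<Rightarrow> complex" where "k I = (- 1) ^ card I" for I
  have kk: "k I * k I = 1" for I unfolding k_def by (simp add: power_mult_distrib[symmetric])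
  have ko: "koszul 1 (of_nat (card I)) = k I" for I
    using koszul_card[of 1 "card I"] by (simp add: k_def)
  have \<xi>E: "\<xi> (E I x) = smul R (k I) (E I (\<xi> x))" if "I \<subseteq> {..<n}" "x \<in> C" for I x
    using centroid_maps_supercommute[OF \<xi> Ec[OF that(1)] that(2)] by (simp add: ko)
  have E\<xi>: "E I (\<xi> x) = \<xi> (\<theta> I (smul R (k I) x))" if "I \<subseteq> {..<n}" "x \<in> A" for I x
  proof -
    have "\<theta> I x \<in> C" by (rule A_carrier[OF \<theta>A[OF that]])
    then have "\<xi> (\<theta> I (smul R (k I) x)) = smul R (k I) (\<xi> (E I x))"
      by (simp add: \<theta>smul[OF that] \<Xi>(3) EA[OF that])
    also have "\<dots> = E I (\<xi> x)" using \<xi>E[OF that(1) A_carrier[OF that(2)]] by (simp add: kk)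
    finally show ?thesis ..
  qed
  define \<theta>' where "\<theta>' K = (if n \<in> K then \<lambda>x. E (K - {n}) (\<xi> x) else E K)" for K
  have sub: "K - {n} \<subseteq> {..<n}" "n \<notin> K \<Longrightarrow> K \<subseteq> {..<n}" if "K \<subseteq> {..<Suc n}" for K
    using that by (auto simp: less_Suc_eq)
  have \<theta>'n: "\<theta>' I = E I" "\<theta>' (insert n I) = (\<lambda>x. E I (\<xi> x))" if "I \<subseteq> {..<n}" for I
  proof -
    have "n \<notin> I" using that by auto
    then show "\<theta>' I = E I" "\<theta>' (insert n I) = (\<lambda>x. E I (\<xi> x))" by (simp_all add: \<theta>'_def)
  qed
  have "grassmann_decomposition R (Suc n) S \<theta>'"
    unfolding grassmann_decomposition_def
  proof (intro conjI allI ballI impI)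
    show "S \<subseteq> C" using SA A_carrier by blast
    show "lie_conformal_superalgebra (sub_lcs R S)" "simple_lcs (sub_lcs R S)" by (rule Slcs)+
  next
    fix K assume K: "K \<subseteq> {..<Suc n}"
    show "centroid_map R (of_nat (card K)) 0 (\<theta>' K)"
    proof (cases "n \<in> K")
      case True
      have "finite K" using K finite_subset by blast
      then have "card K = card (K - {n}) + 1" using True by (metis card_Suc_Diff1 Suc_eq_plus1)
      then show ?thesis
        using centroid_map_comp[OF Ec[OF sub(1)[OF K]] \<xi>] True by (simp add: \<theta>'_def)
    next
      case False
      then show ?thesis using Ec[OF sub(2)[OF K False]] by (simp add: \<theta>'_def)
    qed
  next
    fix x assume x: "x \<in> C"
    show "\<theta>' {} x = x"
      using components_decomp[OF x] by (simp add: \<theta>'_def E_def extend_def emp component_mem[OF x])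
  next
    fix K L x assume K: "K \<subseteq> {..<Suc n}" and L: "L \<subseteq> {..<Suc n}" and x: "x \<in> C"
    define I J where "I = K - {n}" and "J = L - {n}"
    have I: "I \<subseteq> {..<n}" and J: "J \<subseteq> {..<n}" using sub(1)[OF K] sub(1)[OF L] by (simp_all add: I_def J_def)
    have fin: "finite I" "finite J" using I J finite_subset by auto
    have IJ: "I \<union> J \<subseteq> {..<n}" using I J by blast
    have nI: "n \<notin> I" "n \<notin> J" by (simp_all add: I_def J_def)
    have \<xi>x: "\<xi> x \<in> C" by (rule \<Xi>(1)[OF x])
    have EJ: "E J x \<in> C" "E J (\<xi> x) \<in> C" using Eh(1)[OF J] x \<xi>x by auto
    have g1: "grass_sign I {n} = 1" by (rule grass_sign_ordered) (use I in auto)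
    have g2: "grass_sign {n} J = k J" unfolding k_def by (rule grass_sign_singleton_left) (use J in auto)
    have KI: "K = (if n \<in> K then insert n I else I)" and LJ: "L = (if n \<in> L then insert n J else J)"
      by (auto simp: I_def J_def)
    show "\<theta>' K (\<theta>' L x) = (if K \<inter> L = {} then smul R (grass_sign K L) (\<theta>' (K \<union> L) x) else 0)"
    proof (cases "n \<in> K"; cases "n \<in> L")
      \<comment> \<open>Moved next to each other, the two factors \<open>\<xi>\<close> give
        zero.\<close>
      assume n: "n \<in> K" "n \<in> L"
      then have "\<theta>' K (\<theta>' L x) = E I (\<xi> (E J (\<xi> x)))" by (simp add: \<theta>'_def I_def J_def)
      also have "\<dots> = 0" using \<xi>E[OF J \<xi>x] x by (simp add: \<xi>_\<xi> Eh(6)[OF J] Eh(6)[OF I])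
      finally show ?thesis using n by auto
    next
      \<comment> \<open>Moving \<open>\<xi>\<close> past the monomial of \<open>J\<close> produces
        \<open>k J\<close>, which counts the inversions of \<open>n\<close> with
        \<open>J\<close>.\<close>
      assume n: "n \<in> K" "n \<notin> L"
      then have L: "L = J" and K: "K = insert n I" using KI LJ by auto
      have "grass_sign K J = grass_sign I J * k J"
        using grass_sign_Un_left[of "{n}" I J] fin nI unfolding K by (simp add: g2 mult.commute)
      moreover have "K \<inter> L = I \<inter> J" using nI unfolding K L by auto
      moreover have "K \<union> L = insert n (I \<union> J)" unfolding K L by auto
      moreover have "\<theta>' K (\<theta>' L x) = smul R (k J) (E I (E J (\<xi> x)))"
        unfolding K L \<theta>'n(2)[OF I] \<theta>'n(1)[OF J] using \<xi>E[OF J x] EJ by (simp add: Eh(3)[OF I])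
      ultimately show ?thesis
        using EE[OF I J \<xi>x] \<theta>'n(2)[OF IJ] unfolding L by (simp add: mult.commute)
    next
      assume n: "n \<notin> K" "n \<in> L"
      then have K: "K = I" and L: "L = insert n J" using KI LJ by auto
      have "grass_sign I L = grass_sign I J"
        using grass_sign_Un_right[of I "{n}" J] fin nI unfolding L by (simp add: g1)
      moreover have "K \<inter> L = I \<inter> J" using nI unfolding K L by auto
      moreover have "K \<union> L = insert n (I \<union> J)" unfolding K L by auto
      moreover have "\<theta>' K (\<theta>' L x) = E I (E J (\<xi> x))"
        unfolding K L \<theta>'n(2)[OF J] \<theta>'n(1)[OF I] ..
      ultimately show ?thesis using EE[OF I J \<xi>x] \<theta>'n(2)[OF IJ] unfolding K by simp
    next
      assume n: "n \<notin> K" "n \<notin> L"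
      then have K: "K = I" and L: "L = J" using KI LJ by auto
      show ?thesis unfolding K L \<theta>'n(1)[OF I] \<theta>'n(1)[OF J] \<theta>'n(1)[OF IJ] by (rule EE[OF I J x])
    qed
  next
    fix x assume x: "x \<in> C"
    obtain u v where uv: "u \<in> A" "v \<in> A" "x = u + \<xi> v" using decomp_cases[OF x] by blast
    obtain s where s: "\<forall>I\<subseteq>{..<n}. s I \<in> S" "u = (\<Sum>I\<in>Pow {..<n}. \<theta> I (s I))" using ex[OF uv(1)] by blast
    obtain t where t: "\<forall>I\<subseteq>{..<n}. t I \<in> S" "v = (\<Sum>I\<in>Pow {..<n}. \<theta> I (t I))" using ex[OF uv(2)] by blast
    \<comment> \<open>The factor \<open>k\<close> compensates the sign between
      \<open>E I (\<xi> x)\<close> and \<open>\<xi> (\<theta> I x)\<close>.\<close>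
    define r where "r K = (if n \<in> K then smul R (k (K - {n})) (t (K - {n})) else s K)" for K
    have Ssub: "vs.subspace S"
    proof -
      interpret S: lie_conformal_superalgebra "sub_lcs R S" by (rule Slcs)
      show ?thesis using S.subspace_carrier by simp
    qed
    have "r K \<in> S" if "K \<subseteq> {..<Suc n}" for K
      using sub[OF that] s(1) t(1) vs.subspace_scale[OF Ssub] by (simp add: r_def)
    moreover have "x = (\<Sum>K\<in>Pow {..<Suc n}. \<theta>' K (r K))"
    proof -
      have "(\<Sum>I\<in>Pow {..<n}. \<theta>' I (r I)) = u"
      proof -
        have "\<theta>' I (r I) = \<theta> I (s I)" if "I \<in> Pow {..<n}" for I
        proof -
          have I: "I \<subseteq> {..<n}" "n \<notin> I" using that by auto
          have "s I \<in> A" using s(1) I(1) SA by blast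
          then show ?thesis using I(2) \<theta>'n(1)[OF I(1)] EA[OF I(1)] by (simp add: r_def)
        qed
        then show ?thesis unfolding s(2) by (rule sum.cong[OF refl])
      qed
      moreover have "(\<Sum>I\<in>Pow {..<n}. \<theta>' (insert n I) (r (insert n I))) = \<xi> v"
      proof -
        have "\<theta>' (insert n I) (r (insert n I)) = \<xi> (\<theta> I (t I))" if "I \<in> Pow {..<n}" for I
        proof -
          have I: "I \<subseteq> {..<n}" "n \<notin> I" using that by auto
          have tA: "t I \<in> A" using t(1) I(1) SA by blast
          have "r (insert n I) = smul R (k I) (t I)" using I(2) by (simp add: r_def)
          then show ?thesis
            using \<theta>'n(2)[OF I(1)] E\<xi>[OF I(1) A_closed(7)[OF tA]] by (simp add: kk)
        qed
        then have "(\<Sum>I\<in>Pow {..<n}. \<theta>' (insert n I) (r (insert n I))) = (\<Sum>I\<in>Pow {..<n}. \<xi> (\<theta> I (t I)))"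
          by (rule sum.cong[OF refl])
        also have "\<dots> = \<xi> v"
          unfolding t(2) by (rule linear_sum[OF linear_\<xi>, symmetric]) (use t(1) SA \<theta>A A_carrier in blast)
        finally show ?thesis .
      qed
      ultimately show ?thesis unfolding sum_Pow_lessThan_Suc uv(3) by simp
    qed
    ultimately show "\<exists>s. (\<forall>K\<subseteq>{..<Suc n}. s K \<in> S) \<and> x = (\<Sum>K\<in>Pow {..<Suc n}. \<theta>' K (s K))" by blast
  next
    fix s K assume s: "(\<forall>K\<subseteq>{..<Suc n}. s K \<in> S) \<and> (\<Sum>K\<in>Pow {..<Suc n}. \<theta>' K (s K)) = 0" and K: "K \<subseteq> {..<Suc n}"
    have s0: "s I \<in> S" "s (insert n I) \<in> S" if "I \<subseteq> {..<n}" for I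
      using s that by (auto simp: subset_iff less_Suc_eq)
    have Ssub: "vs.subspace S"
    proof -
      interpret S: lie_conformal_superalgebra "sub_lcs R S" by (rule Slcs)
      show ?thesis using S.subspace_carrier by simp
    qed
    define t where "t I = smul R (k I) (s (insert n I))" for I
    have tS: "t I \<in> S" if "I \<subseteq> {..<n}" for I
      unfolding t_def by (rule vs.subspace_scale[OF Ssub s0(2)[OF that]])
    let ?u = "\<Sum>I\<in>Pow {..<n}. \<theta> I (s I)" and ?v = "\<Sum>I\<in>Pow {..<n}. \<theta> I (t I)"
    have uA: "?u \<in> A" by (intro vs.subspace_sum[OF A_closed(1)] \<theta>A) (use s0 SA in auto)
    have vA: "?v \<in> A" by (intro vs.subspace_sum[OF A_closed(1)] \<theta>A) (use tS SA in auto)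
    have "(\<Sum>I\<in>Pow {..<n}. \<theta>' I (s I)) = ?u"
    proof (rule sum.cong[OF refl])
      fix I assume "I \<in> Pow {..<n}"
      then have I: "I \<subseteq> {..<n}" by simp
      then have "s I \<in> A" using s0 SA by blast
      then show "\<theta>' I (s I) = \<theta> I (s I)" using \<theta>'n(1)[OF I] EA[OF I] by simp
    qed
    moreover have "(\<Sum>I\<in>Pow {..<n}. \<theta>' (insert n I) (s (insert n I))) = \<xi> ?v"
    proof -
      have "\<theta>' (insert n I) (s (insert n I)) = \<xi> (\<theta> I (t I))" if "I \<in> Pow {..<n}" for I
      proof -
        have I: "I \<subseteq> {..<n}" using that by simp
        then have "s (insert n I) \<in> A" using s0 SA by blast
        then show ?thesis using \<theta>'n(2)[OF I] E\<xi>[OF I] by (simp add: t_def)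
      qed
      then have "(\<Sum>I\<in>Pow {..<n}. \<theta>' (insert n I) (s (insert n I))) = (\<Sum>I\<in>Pow {..<n}. \<xi> (\<theta> I (t I)))"
        by (rule sum.cong[OF refl])
      also have "\<dots> = \<xi> ?v"
        by (rule linear_sum[OF linear_\<xi>, symmetric]) (use tS SA \<theta>A A_carrier in blast)
      finally show ?thesis .
    qed
    ultimately have "?u + \<xi> ?v = 0" using s by (simp add: sum_Pow_lessThan_Suc)
    then have "?u = 0" "?v = 0" using components[OF uA vA] \<Delta>(6) \<Xi>(6) by auto
    then have z: "s I = 0" "t I = 0" if "I \<subseteq> {..<n}" for I
      using uniq[of s I] uniq[of t I] s0 tS that by auto
    show "s K = 0"
    proof (cases "n \<in> K")
      case True
      have "smul R (k (K - {n})) (t (K - {n})) = s K"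
        using True by (simp add: t_def insert_absorb kk)
      then show ?thesis using z(2)[OF sub(1)[OF K]] by simp
    next
      case False
      then show ?thesis using z(1) sub(2)[OF K] by blast
    qed
  qed
  then show ?thesis by blast
qed

lemma exists_grassmann_decomposition:
  fixes R :: "('a::ab_group_add) lcs"
  assumes "derivation_simple_lcs R" "rank_le R b (carrier R)"
  shows "\<exists>n S \<theta>. grassmann_decomposition R n S \<theta>"
  using assms
proof (induction b arbitrary: R rule: less_induct)
  case (less b)
  interpret derivation_simple_lcs R by (rule less.prems(1))
  show ?case
  proof (cases "\<forall>J. conformal_ideal J \<longrightarrow> J = {0} \<or> J = C")
    \<comment> \<open>The recursion stops at a simple algebra, which is its own \<open>S\<close>
      with no Grassmann generators; this replaces a base case \<open>b = 0\<close>.\<close>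
    case True
    have sC: "subalgebra C"
      using conformal_ideal_carrier by (simp add: subalgebra_def conformal_ideal_def)
    have "simple_lcs R" using True not_abelian by (simp add: simple_lcs_def lcs_ideal_iff)
    moreover have "lcs_ideal (sub_lcs R C) J \<longleftrightarrow> lcs_ideal R J" for J
      unfolding lcs_ideal_def sub_lcs_simps by blast
    ultimately have "simple_lcs (sub_lcs R C)"
      by (simp add: simple_lcs_def abelian_def)
    moreover have "\<exists>s. (\<forall>I\<subseteq>{..<0::nat}. s I \<in> C) \<and> x = (\<Sum>I\<in>Pow {..<0::nat}. s I)" if "x \<in> C" for x
      by (rule exI[of _ "\<lambda>I. x"]) (simp add: that)
    ultimately have "grassmann_decomposition R 0 C (\<lambda>I x. x)"
      unfolding grassmann_decomposition_def
      using sub_lcs_lcs[OF sC] centroid_map_id by (simp add: grass_sign_def)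
    then show ?thesis by blast
  next
    case False
    then obtain J where J: "conformal_ideal J" "J \<noteq> {0}" "J \<noteq> C" by blast
    obtain M where M: "conformal_ideal M" "M \<noteq> C" "\<And>J. conformal_ideal J \<Longrightarrow> J \<noteq> C \<Longrightarrow> J \<subseteq> M"
      using largest_proper_ideal by blast
    interpret local_lcs R M by unfold_locales (use M in auto)
    have "M \<noteq> {0}" using M(3)[OF J(1,3)] J(2) conformal_idealD(9)[OF J(1)] by blast
    then obtain \<delta> \<xi> where "derivation_at R 1 0 \<delta>" "centroid_map R 1 0 \<xi>"
      "\<And>x. x \<in> C \<Longrightarrow> \<delta> (\<xi> x) + \<xi> (\<delta> x) = x" "\<And>x. x \<in> C \<Longrightarrow> \<delta> (\<delta> x) = 0" "\<And>x. x \<in> C \<Longrightarrow> \<xi> (\<xi> x) = 0"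
      using odd_pair by metis
    then interpret grassmann_pair R \<delta> \<xi> "{x \<in> C. \<delta> x = 0}" by unfold_locales auto
    let ?A = "{x \<in> C. \<delta> x = 0}"
    note drop = rank_drop[OF less.prems(2)]
    have "rank_le (sub_lcs R ?A) (b - 1) (carrier (sub_lcs R ?A))"
      using drop(2) by (simp add: rank_le_sub_lcs)
    then obtain n S \<theta> where "grassmann_decomposition (sub_lcs R ?A) n S \<theta>"
      using less.IH[of "b - 1" "sub_lcs R ?A"] derivation_simple_lcs_A drop(1) by auto
    then show ?thesis using grassmann_decomposition_lift[OF grassmann_pair_axioms] by blast
  qed
qed

section \<open>The isomorphism with the tensor product\<close>

context lie_conformal_superalgebra begin

section \<open>From conformal derivations to derivation families\<close>

text \<open>The defining Leibniz rule speaks of homogeneous \<open>x\<close>; both sides are linear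
  in \<open>x\<close>, so it extends to all \<open>x\<close> with the sign turned into
  \<open>sg s\<close>.\<close>

lemma conformal_derivation_family:
  assumes "conformal_derivation_of_parity R s \<phi>"
  shows "derivation_family R s (\<lambda>l x. gen_poly R (\<lambda>n. \<phi> n x) l)"
proof -
  have lin: "\<And>n. linear_map R R (\<phi> n)" and fin: "\<And>x. x \<in> C \<Longrightarrow> finite {n. \<phi> n x \<noteq> 0}"
    and par: "\<And>n p x. x \<in> gr R p \<Longrightarrow> \<phi> n x \<in> gr R (s + p)"
    and d: "\<And>l v. v \<in> C \<Longrightarrow> gen_poly R (\<lambda>n. \<phi> n (D v)) l =
        D (gen_poly R (\<lambda>n. \<phi> n v) l) + smul R l (gen_poly R (\<lambda>n. \<phi> n v) l)"
    and b: "\<And>l m p x y. x \<in> gr R p \<Longrightarrow> y \<in> C \<Longrightarrow>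
        gen_poly R (\<lambda>n. \<phi> n (B m x y)) l = B (l + m) (gen_poly R (\<lambda>n. \<phi> n x) l) y
          + smul R (koszul p s) (B m x (gen_poly R (\<lambda>n. \<phi> n y) l))"
    using assms unfolding conformal_derivation_of_parity_def by blast+
  let ?f = "\<lambda>l x. gen_poly R (\<lambda>n. \<phi> n x) l"
  have fl: "linear_map R R (?f l)" for l
    unfolding linear_map_def
  proof (intro conjI ballI allI)
    fix x assume x: "x \<in> C"
    show "?f l x \<in> C" unfolding gen_poly_def using linear_mapD(1)[OF lin x] by (intro carrier_sum carrier_smul)
    show "?f l (smul R c x) = smul R c (?f l x)" for c
      using gen_poly_linear_image[OF fin[OF x] _ linear_scale[OF linear_id]] linear_mapD(1)[OF lin x]
      by (simp add: linear_mapD(3)[OF lin x])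
    fix y assume y: "y \<in> C"
    show "?f l (x + y) = ?f l x + ?f l y"
      using gen_poly_add[OF fin[OF x] fin[OF y]] by (simp add: linear_mapD(2)[OF lin x y])
  qed
  have h: "homogeneous_map R s (?f l)" for l
    unfolding homogeneous_map_def
  proof (intro conjI fl allI ballI)
    fix p x assume "x \<in> gr R p"
    then show "?f l x \<in> gr R (s + p)"
      unfolding gen_poly_def by (intro vs.subspace_sum[OF subspace_gr] gr_smul par)
  qed
  have fC: "?f l x \<in> C" if "x \<in> C" for l x using linear_mapD(1)[OF fl that] .
  have "?f l (B m x y) = B (l + m) (?f l x) y + B m (sg s x) (?f l y)" if x: "x \<in> C" and y: "y \<in> C" for l m x y
  proof (rule linear_ext[OF x])
    show "linear_map R R (\<lambda>x. ?f l (B m x y))"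
      by (rule linear_comp[OF fl B_linear_left[OF y]])
    show "linear_map R R (\<lambda>x. B (l + m) (?f l x) y + B m (sg s x) (?f l y))"
      by (rule linear_plus[OF linear_comp[OF B_linear_left[OF y] fl]
            linear_comp[OF B_linear_left[OF fC[OF y]] linear_parity_map]])
    fix p x assume x: "x \<in> gr R p"
    show "?f l (B m x y) = B (l + m) (?f l x) y + B m (sg s x) (?f l y)"
      unfolding b[OF x y] parity_map_gr[OF x]
      using gr_carrier[OF x] fC[OF y] by (simp add: B_smul_left koszul_commute)
  qed
  then have "derivation_at R s l (?f l)" for l
    unfolding derivation_at_def using h d by blast
  moreover have "polynomial_family R (\<lambda>l. ?f l x)" if "x \<in> C" for x
    using gen_poly_polynomial_family[OF fin[OF that]] linear_mapD(1)[OF lin that] by blast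
  ultimately show ?thesis by (simp add: derivation_family_def)
qed

text \<open>Any set witnessing differentiable simplicity yields derivation families, and stability
  under their values gives stability under the coefficients.\<close>

lemma differentiably_simple_imp_derivation_simple:
  assumes "differentiably_simple R"
  shows "derivation_simple"
  unfolding derivation_simple_def
proof (intro allI impI)
  fix J assume J: "conformal_ideal J \<and> stable J"
  obtain \<D> where \<D>: "\<forall>\<phi>\<in>\<D>. conformal_derivation R \<phi>"
    "\<And>I. lcs_ideal R I \<Longrightarrow> stable_under \<D> I \<Longrightarrow> I = {0} \<or> I = C"
    using assms unfolding differentiably_simple_def by blast
  have "stable_under \<D> J"
    unfolding stable_under_def
  proof (intro ballI allI)
    fix \<phi> x n assume \<phi>: "\<phi> \<in> \<D>" and x: "x \<in> J"
    obtain s where s: "conformal_derivation_of_parity R s \<phi>"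
      using \<D>(1) \<phi> unfolding conformal_derivation_def by blast
    have xC: "x \<in> C" using conformal_idealD(4) J x by blast
    have "gen_poly R (\<lambda>n. \<phi> n x) l \<in> J" for l
      using conformal_derivation_family[OF s] J x unfolding stable_def by blast
    moreover have "finite {n. \<phi> n x \<noteq> 0}"
      using s xC unfolding conformal_derivation_of_parity_def by blast
    ultimately show "\<phi> n x \<in> J"
      using gen_poly_coefficients[of "\<lambda>n. \<phi> n x" J n] conformal_idealD(2) J by blast
  qed
  then show "J = {0} \<or> J = C" using \<D>(2) J lcs_ideal_iff by blast
qed

text \<open>In degree 0 the bracket parameter is not shifted, so \<open>centroid_map_left\<close>
  passes to coefficients.\<close>

lemma centroid_map_nprod_left:
  assumes f: "centroid_map R s 0 f" and a: "a \<in> C" and b: "b \<in> C"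
  shows "f (nprod R n a b) = nprod R n (f a) b"
proof (rule gen_poly_eqD)
  note h = homogeneous_mapD[OF centroid_mapD(1)[OF f]]
  have fin: "finite {n. nprod R n a b \<noteq> 0}" by (rule nprod_finite[OF a b])
  show "finite {n. f (nprod R n a b) \<noteq> 0}"
    by (rule finite_subset[OF _ fin]) (use h(6) in auto)
  show "finite {n. nprod R n (f a) b \<noteq> 0}" by (rule nprod_finite[OF h(1)[OF a] b])
  show "gen_poly R (\<lambda>n. f (nprod R n a b)) m = gen_poly R (\<lambda>n. nprod R n (f a) b) m" for m
    using centroid_map_left[OF f a b, of m] nprod_closed[OF a b]
      gen_poly_linear_image[OF fin _ homogeneous_map_linear[OF centroid_mapD(1)[OF f]]]
    by (simp add: bracket_def)
qed

lemma nprod_parity_map: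
  assumes a: "a \<in> C" and b: "b \<in> C"
  shows "sg s (nprod R n a b) = nprod R n (sg s a) (sg s b)"
proof (rule gen_poly_eqD)
  have fin: "finite {n. nprod R n a b \<noteq> 0}" by (rule nprod_finite[OF a b])
  show "finite {n. sg s (nprod R n a b) \<noteq> 0}"
    by (rule finite_subset[OF _ fin]) (use linear_zero[OF linear_parity_map] in auto)
  show "finite {n. nprod R n (sg s a) (sg s b) \<noteq> 0}" by (intro nprod_finite parity_map_closed a b)
  show "gen_poly R (\<lambda>n. sg s (nprod R n a b)) m = gen_poly R (\<lambda>n. nprod R n (sg s a) (sg s b)) m" for m
    using B_sg[OF a b, of s m] nprod_closed[OF a b] gen_poly_linear_image[OF fin _ linear_parity_map]
    by (simp add: bracket_def)
qed

end

section \<open>Products of sums in the tensor product\<close>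

lemma sum_apply: "(\<Sum>i\<in>A. f i) x = (\<Sum>i\<in>A. f i x)"
  for f :: "'c \<Rightarrow> 'd \<Rightarrow> 'e::comm_monoid_add"
  by (induction A rule: infinite_finite_induct) auto

text \<open>The first tensor is the outermost function applied, so its additivity is pointwise and
  needs no bilinearity.\<close>

lemma tensor_nprod_sum_left:
  "nprod (tensor_lcs S B) n (\<Sum>i\<in>A. t i) u = (\<Sum>i\<in>A. nprod (tensor_lcs S B) n (t i) u)"
  by (auto simp: tensor_lcs_def fun_eq_iff sum_apply)

text \<open>Additivity in the second argument is only clear when the first one is a pure tensor: a pure tensor
  evaluates to 0 on functions that are not bilinear.\<close>

lemma tensor_nprod_pure_sum:
  assumes "lie_conformal_superalgebra S" "comm_superalgebra B"
    and r: "r \<in> carrier S" and b: "b \<in> carrier B"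
    and r': "\<And>i. i \<in> A \<Longrightarrow> r' i \<in> carrier S" and b': "\<And>i. i \<in> A \<Longrightarrow> b' i \<in> carrier B"
  shows "nprod (tensor_lcs S B) n (pure_tensor S B r b) (\<Sum>i\<in>A. pure_tensor S B (r' i) (b' i)) =
    (\<Sum>i\<in>A. nprod (tensor_lcs S B) n (pure_tensor S B r b) (pure_tensor S B (r' i) (b' i)))"
proof
  fix \<beta>
  interpret S: lie_conformal_superalgebra S by fact
  interpret B: comm_superalgebra B by fact
  define G where "G = (\<lambda>r b r' b'. \<Sum>p\<in>UNIV. \<Sum>q\<in>UNIV.
         koszul p q * \<beta> (nprod S n r (proj S q r')) (mul B (proj B p b) b'))"
  show "nprod (tensor_lcs S B) n (pure_tensor S B r b) (\<Sum>i\<in>A. pure_tensor S B (r' i) (b' i)) \<beta> =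
    (\<Sum>i\<in>A. nprod (tensor_lcs S B) n (pure_tensor S B r b) (pure_tensor S B (r' i) (b' i))) \<beta>"
  proof (cases "bilinear_form S B \<beta>")
    case False
    then show ?thesis by (simp add: tensor_lcs_def sum_apply)
  next
    case True
    note S' = S.proj_carrier S.proj_add S.proj_smul S.carrier_add S.carrier_smul
    note B' = B.proj_carrier B.proj_add B.proj_smul B.carrier_add B.carrier_smul
    have Sl: "nprod S n x y \<in> carrier S"
      "nprod S n (x + x') y = nprod S n x y + nprod S n x' y"
      "nprod S n (smul S c x) y = smul S c (nprod S n x y)"
      "nprod S n x (y + y') = nprod S n x y + nprod S n x y'"
      "nprod S n x (smul S c y) = smul S c (nprod S n x y)"
      if "x \<in> carrier S" "x' \<in> carrier S" "y \<in> carrier S" "y' \<in> carrier S" for x x' y y' c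
      using that S.nprod_linear_left[of y n] S.nprod_linear_right[of x n] by (auto simp: linear_map_def)
    have Bl: "mul B x y \<in> carrier B"
      "mul B (x + x') y = mul B x y + mul B x' y"
      "mul B (smul B c x) y = smul B c (mul B x y)"
      "mul B x (y + y') = mul B x y + mul B x y'"
      "mul B x (smul B c y) = smul B c (mul B x y)"
      if "x \<in> carrier B" "x' \<in> carrier B" "y \<in> carrier B" "y' \<in> carrier B" for x x' y y' c
      using that B.mul_linear_left[of y] B.mul_linear_right[of x] by (auto simp: linear_map_def)
    have bl: "\<beta> (x + x') y = \<beta> x y + \<beta> x' y" "\<beta> x (y + y') = \<beta> x y + \<beta> x y'"
      "\<beta> (smul S c x) y = c * \<beta> x y" "\<beta> x (smul B c y) = c * \<beta> x y"
      if "x \<in> carrier S" "x' \<in> carrier S" "y \<in> carrier B" "y' \<in> carrier B" for x x' y y' c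
      using True that by (auto simp: bilinear_form_def)
    have inner: "bilinear_form S B (G x y)" if "x \<in> carrier S" "y \<in> carrier B" for x y
      unfolding bilinear_form_def G_def UNIV_bit
      using that by (auto simp: S' B' Sl Bl bl algebra_simps)
    have outer1: "bilinear_form S B (\<lambda>x y. G x y u v)" if "u \<in> carrier S" "v \<in> carrier B" for u v
      unfolding bilinear_form_def G_def UNIV_bit
      using that by (auto simp: S' B' Sl Bl bl algebra_simps)
    have pt: "pure_tensor S B (r' i) (b' i) (G x y) = G x y (r' i) (b' i)"
      if "x \<in> carrier S" "y \<in> carrier B" for x y i
      using inner[OF that] by (simp add: pure_tensor_def)
    have sum_bil: "bilinear_form S B (\<lambda>x y. \<Sum>i\<in>A. G x y (r' i) (b' i))"
      unfolding bilinear_form_def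
    proof (intro conjI ballI allI)
      note o = outer1[OF r' b', unfolded bilinear_form_def]
      fix x x' y c assume c: "x \<in> carrier S" "x' \<in> carrier S" "y \<in> carrier B"
      show "(\<Sum>i\<in>A. G (x + x') y (r' i) (b' i)) = (\<Sum>i\<in>A. G x y (r' i) (b' i)) + (\<Sum>i\<in>A. G x' y (r' i) (b' i))"
        unfolding sum.distrib[symmetric] by (rule sum.cong[OF refl]) (use o c in blast)
    next
      note o = outer1[OF r' b', unfolded bilinear_form_def]
      fix x y y' assume c: "x \<in> carrier S" "y \<in> carrier B" "y' \<in> carrier B"
      show "(\<Sum>i\<in>A. G x (y + y') (r' i) (b' i)) = (\<Sum>i\<in>A. G x y (r' i) (b' i)) + (\<Sum>i\<in>A. G x y' (r' i) (b' i))"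
        unfolding sum.distrib[symmetric] by (rule sum.cong[OF refl]) (use o c in blast)
    next
      note o = outer1[OF r' b', unfolded bilinear_form_def]
      fix c x y assume c: "x \<in> carrier S" "y \<in> carrier B"
      show "(\<Sum>i\<in>A. G (smul S c x) y (r' i) (b' i)) = c * (\<Sum>i\<in>A. G x y (r' i) (b' i))"
        "(\<Sum>i\<in>A. G x (smul B c y) (r' i) (b' i)) = c * (\<Sum>i\<in>A. G x y (r' i) (b' i))"
        unfolding sum_distrib_left by (rule sum.cong[OF refl], use o c in blast)+
    qed
    have one: "bilinear_form S B (\<lambda>x y. pure_tensor S B (r' i) (b' i) (G x y))" if "i \<in> A" for i
      by (rule bilinear_form_cong[OF S.super_space_axioms B.super_space_axioms outer1[OF r'[OF that] b'[OF that]]])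
        (simp add: pt)
    have all: "bilinear_form S B (\<lambda>x y. \<Sum>i\<in>A. pure_tensor S B (r' i) (b' i) (G x y))"
      by (rule bilinear_form_cong[OF S.super_space_axioms B.super_space_axioms sum_bil]) (simp add: pt)
    have "nprod (tensor_lcs S B) n (pure_tensor S B r b) u \<beta> = pure_tensor S B r b (\<lambda>x y. u (G x y))" for u
      using True by (simp add: tensor_lcs_def G_def)
    then show ?thesis
      using one all r b by (simp add: sum_apply pure_tensor_def[of S B r b])
  qed
qed

text \<open>Summing the homogeneous formula over the two components of \<open>r'\<close> collects
  the Koszul signs into \<open>parity_map\<close>.\<close>

lemma tensor_nprod_pure_parity:
  assumes S: "lie_conformal_superalgebra S" and B: "comm_superalgebra B"
    and r: "r \<in> carrier S" and b: "b \<in> gr B p" and r': "r' \<in> carrier S" and b': "b' \<in> carrier B"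
  shows "nprod (tensor_lcs S B) n (pure_tensor S B r b) (pure_tensor S B r' b') =
    pure_tensor S B (nprod S n r (parity_map S p r')) (mul B b b')"
proof -
  interpret S: lie_conformal_superalgebra S by (rule S)
  interpret B: comm_superalgebra B by (rule B)
  have bC: "b \<in> carrier B" by (rule B.gr_carrier[OF b])
  have mC: "mul B b b' \<in> carrier B" using linear_mapD(1)[OF B.mul_linear_left[OF b'] bC] .
  note pb = pure_tensor_bilinear[OF S.super_space_axioms B.super_space_axioms]
  note n = linear_mapD[OF S.nprod_linear_right[OF r]]
  let ?u = "\<lambda>q. proj S q r'"
  have uC: "?u q \<in> carrier S" for q by (rule S.proj_carrier[OF r'])
  have u: "?u q \<in> gr S q" for q by (rule S.proj_mem_gr[OF r'])
  have UNIV_sum: "(\<Sum>q\<in>UNIV. f q) = f 0 + f 1" for f :: "bit \<Rightarrow> 'c::comm_monoid_add" by (simp add: UNIV_bit)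
  have "pure_tensor S B r' b' = pure_tensor S B (?u 0) b' + pure_tensor S B (?u 1) b'"
    using pb(1)[OF uC uC b' b', of 0 1] S.proj_decomp[OF r'] by simp
  also have "\<dots> = (\<Sum>q\<in>UNIV. pure_tensor S B (?u q) b')" by (simp add: UNIV_sum)
  finally have "nprod (tensor_lcs S B) n (pure_tensor S B r b) (pure_tensor S B r' b') =
    (\<Sum>q\<in>UNIV. nprod (tensor_lcs S B) n (pure_tensor S B r b) (pure_tensor S B (?u q) b'))"
    using tensor_nprod_pure_sum[OF S B r bC, of UNIV ?u "\<lambda>q. b'" n] uC b' by simp
  also have "\<dots> = (\<Sum>q\<in>UNIV. pure_tensor S B (smul S (koszul p q) (nprod S n r (?u q))) (mul B b b'))"
    by (rule sum.cong[OF refl])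
      (simp only: tensor_nprod_pure[OF S B r b u b'] pb(3)[OF n(1)[OF uC] n(1)[OF uC] mC mC])
  also have "\<dots> = pure_tensor S B (nprod S n r (parity_map S p r')) (mul B b b')"
    using uC mC by (simp add: UNIV_sum parity_map_def n S.carrier_smul pb(1)[OF _ _ mC mC])
  finally show ?thesis .
qed

section \<open>Monomials of the Grassmann algebra\<close>

definition grass_monomial :: "nat set \<Rightarrow> nat set \<Rightarrow> complex" where
  "grass_monomial I = (\<lambda>K. if K = I then 1 else 0)"

lemma grass_monomial_gr: "I \<subseteq> {..<n} \<Longrightarrow> grass_monomial I \<in> gr (grassmann n) (of_nat (card I))"
  by (auto simp: grass_monomial_def grassmann_def)

text \<open>At \<open>K\<close> only the subset \<open>L = I\<close> can contribute, and only if the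
  complement is \<open>J\<close>. Finiteness matters because products vanish at infinite
  \<open>K\<close>.\<close>

lemma grass_monomial_mul:
  assumes "finite I" "finite J"
  shows "mul (grassmann n) (grass_monomial I) (grass_monomial J) =
    (if I \<inter> J = {} then smul (grassmann n) (grass_sign I J) (grass_monomial (I \<union> J)) else 0)"
proof
  fix K :: "nat set"
  have m: "mul (grassmann n) (grass_monomial I) (grass_monomial J) K =
      (\<Sum>L\<in>Pow K. if L = I then grass_sign I (K - I) * grass_monomial J (K - I) else 0)"
    unfolding grassmann_def by (auto simp: grass_monomial_def intro!: sum.cong)
  show "mul (grassmann n) (grass_monomial I) (grass_monomial J) K =
    (if I \<inter> J = {} then smul (grassmann n) (grass_sign I J) (grass_monomial (I \<union> J)) else 0) K"
  proof (cases "finite K")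
    case False
    then have "K \<noteq> I \<union> J" using assms by auto
    then show ?thesis unfolding m using False by (simp add: grassmann_def grass_monomial_def)
  next
    case True
    have "(\<Sum>L\<in>Pow K. if L = I then grass_sign I (K - I) * grass_monomial J (K - I) else 0) =
      (if I \<subseteq> K then grass_sign I (K - I) * grass_monomial J (K - I) else 0)"
      using True by simp
    also have "\<dots> = (if I \<inter> J = {} \<and> K = I \<union> J then grass_sign I J else 0)"
    proof -
      have "I \<subseteq> K \<and> K - I = J \<longleftrightarrow> I \<inter> J = {} \<and> K = I \<union> J" by blast
      then show ?thesis unfolding grass_monomial_def by auto
    qed
    also have "\<dots> = (if I \<inter> J = {} then smul (grassmann n) (grass_sign I J) (grass_monomial (I \<union> J)) else 0) K"
      by (simp add: grassmann_def grass_monomial_def)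
    finally show ?thesis unfolding m .
  qed
qed

lemma grassmann_expand:
  assumes "b \<in> carrier (grassmann n)"
  shows "b = (\<Sum>I\<in>Pow {..<n}. smul (grassmann n) (b I) (grass_monomial I))"
proof
  fix K
  have "(\<Sum>I\<in>Pow {..<n}. smul (grassmann n) (b I) (grass_monomial I)) K =
      (\<Sum>I\<in>Pow {..<n}. if I = K then b K else 0)"
    unfolding sum_apply by (rule sum.cong) (auto simp: grassmann_def grass_monomial_def)
  also have "\<dots> = (if K \<subseteq> {..<n} then b K else 0)" by simp
  also have "\<dots> = b K" using assms by (auto simp: grassmann_def)
  finally show "b K = (\<Sum>I\<in>Pow {..<n}. smul (grassmann n) (b I) (grass_monomial I)) K" ..
qed

text \<open>Converse of \<open>sub_lcs_lcs\<close>: the grading of \<open>sub_lcs R S\<close> is the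
  ambient one cut down to \<open>S\<close>, so components taken in \<open>S\<close> are ambient
  components.\<close>

lemma (in lie_conformal_superalgebra) subalgebraI:
  assumes S: "lie_conformal_superalgebra (sub_lcs R S)" and SC: "S \<subseteq> C"
  shows "subalgebra S"
proof -
  interpret S: lie_conformal_superalgebra "sub_lcs R S" by (rule S)
  have sub: "vs.subspace S" using S.subspace_carrier by simp
  have "sg 1 x \<in> S" if "x \<in> S" for x
  proof -
    have "x \<in> carrier (sub_lcs R S)" using that by simp
    then obtain y z where yz: "x = y + z" "y \<in> gr (sub_lcs R S) 0" "z \<in> gr (sub_lcs R S) (0 + 1)"
      by (rule S.carrier_split)
    then have g: "y \<in> gr R 0" "z \<in> gr R 1" "y \<in> S" "z \<in> S" by simp_all
    have "sg 1 x = y - z"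
      unfolding yz(1) using g by (simp add: parity_map_add gr_carrier parity_map_gr[OF g(1)] parity_map_gr[OF g(2)])
    then show ?thesis using vs.subspace_diff[OF sub g(3,4)] by simp
  qed
  moreover have "D x \<in> S" if "x \<in> S" for x using S.D_closed[of x] that by simp
  moreover have "B m x y \<in> S" if "x \<in> S" "y \<in> S" for m x y using S.B_closed[of x y m] that by simp
  ultimately show ?thesis using sub SC by (simp add: subalgebra_def graded_subspace_def)
qed

text \<open>Each coordinate is tensored with its monomial after a parity twist. The twist is needed
  because \<open>\<theta> I\<close> multiplies from the left, whereas the Grassmann factor of the
  tensor product stands on the right, so the monomial has to pass the coordinate.\<close>

lemma grassmann_decomposition_isomorphic:
  fixes R :: "('a::ab_group_add) lcs"
  assumes R: "lie_conformal_superalgebra R" and dec: "grassmann_decomposition R n S \<theta>"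
  shows "lcs_isomorphic R (tensor_lcs (sub_lcs R S) (grassmann n))"
proof -
  interpret lie_conformal_superalgebra R by (rule R)
  let ?S = "sub_lcs R S" and ?G = "grassmann n"
  let ?T = "tensor_lcs ?S ?G"
  let ?P = "Pow {..<n}"
  have SC: "\<And>x. x \<in> S \<Longrightarrow> x \<in> C" and Sl: "lie_conformal_superalgebra ?S"
    and cm: "\<And>I. I \<in> ?P \<Longrightarrow> centroid_map R (of_nat (card I)) 0 (\<theta> I)"
    and prod: "\<And>I J x. I \<in> ?P \<Longrightarrow> J \<in> ?P \<Longrightarrow> x \<in> C \<Longrightarrow>
      \<theta> I (\<theta> J x) = (if I \<inter> J = {} then smul R (grass_sign I J) (\<theta> (I \<union> J) x) else 0)"
    and ex: "\<And>x. x \<in> C \<Longrightarrow> \<exists>s. (\<forall>I\<in>?P. s I \<in> S) \<and> x = (\<Sum>I\<in>?P. \<theta> I (s I))"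
    and uniq: "\<And>s. (\<And>I. I \<in> ?P \<Longrightarrow> s I \<in> S) \<Longrightarrow> (\<Sum>I\<in>?P. \<theta> I (s I)) = 0 \<Longrightarrow> (\<And>I. I \<in> ?P \<Longrightarrow> s I = 0)"
    using dec unfolding grassmann_decomposition_def by (simp_all add: Ball_def subset_iff[of S])
  interpret S: lie_conformal_superalgebra ?S by (rule Sl)
  interpret G: comm_superalgebra ?G by (rule grassmann_comm_superalgebra)
  interpret T: vector_space "tens_smul :: complex \<Rightarrow> ('a, nat set \<Rightarrow> complex) tens \<Rightarrow> _"
    by (rule vector_space_tens)
  have Ssub: "subalgebra S" by (rule subalgebraI[OF Sl]) (use SC in blast)
  have Svs: "vs.subspace S" and Sg: "graded_subspace S" using Ssub by (simp_all add: subalgebra_def graded_subspace_def)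
  have Ssg: "sg t x \<in> S" if "x \<in> S" for t x by (rule graded_subspace_parity_map[OF Sg that])
  have S0: "0 \<in> S" by (rule vs.subspace_0[OF Svs])
  have Sadd: "x + y \<in> S" if "x \<in> S" "y \<in> S" for x y by (rule vs.subspace_add[OF Svs that])
  have Sdiff: "x - y \<in> S" if "x \<in> S" "y \<in> S" for x y by (rule vs.subspace_diff[OF Svs that])
  have Ssmul: "smul R a x \<in> S" if "x \<in> S" for a x by (rule vs.subspace_scale[OF Svs that])
  have SD: "D x \<in> S" if "x \<in> S" for x using Ssub that by (simp add: subalgebra_def)
  have Sn: "nprod R k x y \<in> S" if "x \<in> S" "y \<in> S" for k x y using S.nprod_closed[of x y k] that by simp
  have finP: "finite ?P" by simp
  define p :: "nat set \<Rightarrow> bit" where "p I = of_nat (card I)" for I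
  note cmp = cm[folded p_def]
  note \<Theta> = homogeneous_mapD[OF centroid_mapD(1)[OF cmp]]
  have \<theta>D: "\<theta> I (D x) = D (\<theta> I x)" if "I \<in> ?P" "x \<in> C" for I x
    using centroid_mapD(2)[OF cmp[OF that(1)] that(2)] by simp
  have \<theta>s: "\<theta> I (s I) \<in> C" if "I \<in> ?P" "s I \<in> S" for I s using \<Theta>(1)[OF that(1) SC[OF that(2)]] .
  \<comment> \<open>A choice of coordinates, unique on subsets of \<open>{..<n}\<close> by
    \<open>uniq\<close>. Through \<open>ceq\<close>, every rule for \<open>c\<close> is obtained by
    exhibiting an expansion.\<close>
  define c where "c x = (SOME s. (\<forall>I\<in>?P. s I \<in> S) \<and> x = (\<Sum>I\<in>?P. \<theta> I (s I)))" for x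
  have c: "I \<in> ?P \<Longrightarrow> c x I \<in> S" "x = (\<Sum>I\<in>?P. \<theta> I (c x I))" if "x \<in> C" for x I
    using someI_ex[OF ex[OF that]] unfolding c_def by blast+
  have ceq: "c x I = s I" if s: "\<And>I. I \<in> ?P \<Longrightarrow> s I \<in> S" and x: "x = (\<Sum>I\<in>?P. \<theta> I (s I))" and I: "I \<in> ?P" for x s I
  proof -
    have xC: "x \<in> C" unfolding x by (rule carrier_sum) (use \<theta>s s in blast)
    have "c x I - s I = 0"
    proof (rule uniq[of "\<lambda>I. c x I - s I", OF _ _ I])
      show "c x I - s I \<in> S" if "I \<in> ?P" for I by (rule Sdiff[OF c(1)[OF xC that] s[OF that]])
      have "(\<Sum>I\<in>?P. \<theta> I (c x I - s I)) = (\<Sum>I\<in>?P. \<theta> I (c x I) - \<theta> I (s I))"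
        by (rule sum.cong[OF refl]) (use \<Theta>(4) c(1)[OF xC] s SC in blast)
      also have "\<dots> = (\<Sum>I\<in>?P. \<theta> I (c x I)) - (\<Sum>I\<in>?P. \<theta> I (s I))" by (rule sum_subtractf)
      also have "\<dots> = 0" using c(2)[OF xC] x by simp
      finally show "(\<Sum>I\<in>?P. \<theta> I (c x I - s I)) = 0" .
    qed
    then show ?thesis by simp
  qed
  have cadd: "c (x + y) I = c x I + c y I" if x: "x \<in> C" and y: "y \<in> C" and I: "I \<in> ?P" for x y I
  proof (rule ceq[OF _ _ I])
    show "c x I + c y I \<in> S" if "I \<in> ?P" for I by (intro Sadd c(1) x y that)
    have "(\<Sum>I\<in>?P. \<theta> I (c x I + c y I)) = (\<Sum>I\<in>?P. \<theta> I (c x I) + \<theta> I (c y I))"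
      by (rule sum.cong[OF refl]) (use \<Theta>(2) c(1)[OF x] c(1)[OF y] SC in blast)
    then show "x + y = (\<Sum>I\<in>?P. \<theta> I (c x I + c y I))"
      using c(2)[OF x] c(2)[OF y] by (simp add: sum.distrib)
  qed
  have csmul: "c (smul R a x) I = smul R a (c x I)" if x: "x \<in> C" and I: "I \<in> ?P" for a x I
  proof (rule ceq[OF _ _ I])
    show "smul R a (c x I) \<in> S" if "I \<in> ?P" for I by (intro Ssmul c(1) x that)
    have "(\<Sum>I\<in>?P. \<theta> I (smul R a (c x I))) = (\<Sum>I\<in>?P. smul R a (\<theta> I (c x I)))"
      by (rule sum.cong[OF refl]) (use \<Theta>(3) c(1)[OF x] SC in blast)
    then show "smul R a x = (\<Sum>I\<in>?P. \<theta> I (smul R a (c x I)))"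
      using c(2)[OF x] by (metis vs.scale_sum_right)
  qed
  have csg: "c (sg t x) I = smul R (koszul (p I) t) (sg t (c x I))" if x: "x \<in> C" and I: "I \<in> ?P" for t x I
  proof (rule ceq[OF _ _ I])
    show "smul R (koszul (p I) t) (sg t (c x I)) \<in> S" if "I \<in> ?P" for I by (intro Ssmul Ssg c(1) x that)
    have "\<theta> I (smul R (koszul (p I) t) (sg t (c x I))) = sg t (\<theta> I (c x I))" if "I \<in> ?P" for I
      using SC[OF c(1)[OF x that]] by (simp add: \<Theta>(3)[OF that] \<Theta>(7)[OF that] parity_map_closed)
    then have "(\<Sum>I\<in>?P. \<theta> I (smul R (koszul (p I) t) (sg t (c x I)))) = (\<Sum>I\<in>?P. sg t (\<theta> I (c x I)))"
      by (rule sum.cong[OF refl])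
    also have "\<dots> = sg t (\<Sum>I\<in>?P. \<theta> I (c x I))"
      by (rule linear_sum[OF linear_parity_map, symmetric]) (use \<Theta>(1) SC c(1)[OF x] in blast)
    also have "\<dots> = sg t x" using c(2)[OF x] by simp
    finally show "sg t x = (\<Sum>I\<in>?P. \<theta> I (smul R (koszul (p I) t) (sg t (c x I))))" ..
  qed
  have cD: "c (D x) I = D (c x I)" if x: "x \<in> C" and I: "I \<in> ?P" for x I
  proof (rule ceq[OF _ _ I])
    show "D (c x I) \<in> S" if "I \<in> ?P" for I by (intro SD c(1) x that)
    have "(\<Sum>I\<in>?P. \<theta> I (D (c x I))) = (\<Sum>I\<in>?P. D (\<theta> I (c x I)))"
      by (rule sum.cong[OF refl]) (use \<theta>D SC c(1)[OF x] in blast)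
    also have "\<dots> = D (\<Sum>I\<in>?P. \<theta> I (c x I))"
      by (rule linear_sum[OF der_linear, symmetric]) (use \<Theta>(1) SC c(1)[OF x] in blast)
    also have "\<dots> = D x" using c(2)[OF x] by simp
    finally show "D x = (\<Sum>I\<in>?P. \<theta> I (D (c x I)))" ..
  qed
  have chom: "homogeneous_map R (p I) (\<lambda>x. c x I)" if I: "I \<in> ?P" for I
  proof (rule homogeneous_mapI)
    show "linear_map R R (\<lambda>x. c x I)"
      unfolding linear_map_def
      by (intro conjI ballI allI cadd csmul I SC[OF c(1)])
    show "c (sg t x) I = smul R (koszul (p I) t) (sg t (c x I))" if "x \<in> C" for x t
      by (rule csg[OF that I])
  qed
  have mono: "grass_monomial I \<in> gr ?G (p I)" "grass_monomial I \<in> carrier ?G" if "I \<in> ?P" for I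
    using grass_monomial_gr[of I n] that G.gr_carrier unfolding p_def by auto
  define pt where "pt r I = pure_tensor ?S ?G r (grass_monomial I)" for r I
  note pb = pure_tensor_bilinear[OF S.super_space_axioms G.super_space_axioms, unfolded sub_lcs_simps]
  have pt_add: "pt (x + y) I = pt x I + pt y I" if "x \<in> S" "y \<in> S" "I \<in> ?P" for x y I
    unfolding pt_def by (rule pb(1)[OF that(1,2) mono(2)[OF that(3)] mono(2)[OF that(3)]])
  have pt_smul: "pt (smul R a x) I = tens_smul a (pt x I)" if "x \<in> S" "I \<in> ?P" for a x I
    unfolding pt_def by (rule pb(3)[OF that(1,1) mono(2)[OF that(2)] mono(2)[OF that(2)]])
  have pt_0: "pt 0 I = 0" if "I \<in> ?P" for I
    using pt_smul[OF S0 that, of 0] by simp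
  define F where "F x = (\<Sum>I\<in>?P. pt (sg (p I) (c x I)) I)" for x
  have smulT: "smul ?T = tens_smul" by (simp add: tensor_lcs_def)
  have base: "pure_tensor ?S ?G r b \<in> carrier ?T" if "r \<in> S" "b \<in> carrier ?G" for r b
    unfolding tensor_lcs_def by simp (rule T.span_base, use that in auto)
  have Fcar: "F x \<in> carrier ?T" if x: "x \<in> C" for x
  proof -
    have "T.subspace (carrier ?T)" unfolding tensor_lcs_def by (simp add: T.subspace_span)
    moreover have "pt (sg (p I) (c x I)) I \<in> carrier ?T" if "I \<in> ?P" for I
      unfolding pt_def by (rule base[OF Ssg[OF c(1)[OF x that]] mono(2)[OF that]])
    ultimately show ?thesis unfolding F_def by (rule T.subspace_sum)
  qed
  have Fadd: "F (x + y) = F x + F y" if x: "x \<in> C" and y: "y \<in> C" for x y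
    unfolding F_def sum.distrib[symmetric]
  proof (rule sum.cong[OF refl])
    fix I assume I: "I \<in> ?P"
    note cS = c(1)[OF x I] c(1)[OF y I]
    show "pt (sg (p I) (c (x + y) I)) I = pt (sg (p I) (c x I)) I + pt (sg (p I) (c y I)) I"
      using pt_add[OF Ssg[OF cS(1)] Ssg[OF cS(2)] I] SC[OF cS(1)] SC[OF cS(2)]
      by (simp add: cadd[OF x y I] parity_map_add)
  qed
  have Fsmul: "F (smul R a x) = tens_smul a (F x)" if x: "x \<in> C" for a x
    unfolding F_def T.scale_sum_right
  proof (rule sum.cong[OF refl])
    fix I assume I: "I \<in> ?P"
    show "pt (sg (p I) (c (smul R a x) I)) I = tens_smul a (pt (sg (p I) (c x I)) I)"
      using pt_smul[OF Ssg[OF c(1)[OF x I]] I] SC[OF c(1)[OF x I]]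
      by (simp add: csmul[OF x I] parity_map_smul)
  qed
  have F0: "F 0 = 0" using Fsmul[OF carrier_zero, of 0] by simp
  have Fsum: "F (\<Sum>i\<in>A. x i) = (\<Sum>i\<in>A. F (x i))" if "\<And>i. i \<in> A \<Longrightarrow> x i \<in> C" for A and x :: "'i \<Rightarrow> 'a"
    using that
  proof (induction A rule: infinite_finite_induct)
    case (insert i A)
    then show ?case using Fadd[of "x i" "sum x A"] carrier_sum[of A x] by simp
  qed (simp_all add: F0)
  have F\<theta>: "F (\<theta> I s) = pt (sg (p I) s) I" if I: "I \<in> ?P" and s: "s \<in> S" for I s
  proof -
    have "c (\<theta> I s) J = (if J = I then s else 0)" if J: "J \<in> ?P" for J
    proof (rule ceq[OF _ _ J])
      show "(if J = I then s else 0) \<in> S" for J using s S0 by simp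
      have "(\<Sum>J\<in>?P. \<theta> J (if J = I then s else 0)) = (\<Sum>J\<in>?P. if J = I then \<theta> I s else 0)"
        by (rule sum.cong[OF refl]) (use \<Theta>(6) in auto)
      then show "\<theta> I s = (\<Sum>J\<in>?P. \<theta> J (if J = I then s else 0))" using I finP by simp
    qed
    then have "F (\<theta> I s) = (\<Sum>J\<in>?P. if J = I then pt (sg (p I) s) I else 0)"
      unfolding F_def
      by (intro sum.cong[OF refl]) (auto simp: linear_zero[OF linear_parity_map] pt_0)
    then show ?thesis using I finP by simp
  qed
  have Finj: "x = 0" if x: "x \<in> C" and Fx: "F x = 0" for x
  proof -
    have z: "c x I = 0" if I: "I \<in> ?P" for I
    proof (rule ccontr)
      assume nz: "c x I \<noteq> 0"
      let ?w = "sg (p I) (c x I)"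
      have "?w \<noteq> 0"
        using nz parity_map_involution[OF SC[OF c(1)[OF x I]], of "p I"] linear_zero[OF linear_parity_map] by metis
      then have "?w \<notin> {0}" by simp
      then obtain g where g: "\<And>x y. g (x + y) = g x + g y" "\<And>a x. g (smul R a x) = a * g x" "g ?w = 1"
        using vs.functional_separating_subspace[OF vs.subspace_single_0] by metis
      \<comment> \<open>A functional on the first factor times evaluation of the second at
        \<open>I\<close>: this form detects exactly the coordinate belonging to
        \<open>I\<close>.\<close>
      let ?\<beta> = "\<lambda>r b. g r * b I :: complex"
      have \<beta>: "bilinear_form ?S ?G ?\<beta>"
        unfolding bilinear_form_def by (simp add: g grassmann_def algebra_simps)
      have "F x ?\<beta> = (\<Sum>J\<in>?P. pt (sg (p J) (c x J)) J ?\<beta>)" by (simp add: F_def sum_apply)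
      also have "\<dots> = (\<Sum>J\<in>?P. if J = I then 1 else 0)"
        by (rule sum.cong[OF refl]) (simp add: pt_def pure_tensor_def \<beta> grass_monomial_def g(3))
      also have "\<dots> = 1" using I finP by simp
      finally show False using Fx by simp
    qed
    have "x = (\<Sum>I\<in>?P. \<theta> I (c x I))" by (rule c(2)[OF x])
    also have "\<dots> = (\<Sum>I\<in>?P. 0)" by (rule sum.cong[OF refl]) (simp add: z \<Theta>(6))
    finally show ?thesis by simp
  qed
  have inj: "inj_on F C"
  proof (rule inj_onI)
    fix x y assume xy: "x \<in> C" "y \<in> C" "F x = F y"
    have "F (x + smul R (- 1) y) = F x + tens_smul (- 1) (F y)"
      unfolding Fadd[OF xy(1) carrier_smul[OF xy(2)]] Fsmul[OF xy(2)] ..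
    also have "\<dots> = 0" unfolding xy(3) by simp
    finally have "F (x - y) = 0" by simp
    then have "x - y = 0" using Finj xy carrier_diff by blast
    then show "x = y" by simp
  qed
  have surj: "carrier ?T \<subseteq> F ` C"
  proof -
    have "T.subspace (F ` C)"
    proof (rule T.subspaceI)
      show "0 \<in> F ` C" using F0 carrier_zero by force
      show "x + y \<in> F ` C" if xy: "x \<in> F ` C" "y \<in> F ` C" for x y
      proof -
        obtain x' y' where "x = F x'" "y = F y'" "x' \<in> C" "y' \<in> C" using xy by blast
        then show ?thesis using Fadd[of x' y'] carrier_add[of x' y'] by (metis imageI)
      qed
      show "tens_smul a x \<in> F ` C" if xa: "x \<in> F ` C" for a x
      proof -
        obtain x' where "x = F x'" "x' \<in> C" using xa by blast
        then show ?thesis using Fsmul[of x' a] carrier_smul[of x' a] by (metis imageI)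
      qed
    qed
    moreover have "pure_tensor ?S ?G r b \<in> F ` C" if r: "r \<in> S" and b: "b \<in> carrier ?G" for r b
    proof -
      have bm: "smul ?G (b I) (grass_monomial I) \<in> carrier ?G" if "I \<in> ?P" for I
        by (rule G.carrier_smul[OF mono(2)[OF that]])
      have ps: "pure_tensor ?S ?G r (\<Sum>I\<in>Q. smul ?G (b I) (grass_monomial I)) =
          (\<Sum>I\<in>Q. pure_tensor ?S ?G r (smul ?G (b I) (grass_monomial I)))" if "Q \<subseteq> ?P" for Q
      proof -
        have "finite Q" using that finP finite_subset by blast
        then show ?thesis using that
        proof (induction Q)
          case empty
          have "pure_tensor ?S ?G r 0 = 0"
            using pb(4)[OF r r G.carrier_zero G.carrier_zero, of 0] by simp
          then show ?case by (simp only: sum.empty)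
        next
          case (insert I Q)
          have "pure_tensor ?S ?G r (smul ?G (b I) (grass_monomial I) + (\<Sum>I\<in>Q. smul ?G (b I) (grass_monomial I))) =
            pure_tensor ?S ?G r (smul ?G (b I) (grass_monomial I)) +
            pure_tensor ?S ?G r (\<Sum>I\<in>Q. smul ?G (b I) (grass_monomial I))"
            by (rule pb(2)[OF r r]) (use insert bm in \<open>auto intro!: G.carrier_sum\<close>)
          moreover have "Q \<subseteq> ?P" using insert.prems by blast
          ultimately show ?case using insert.IH by (simp only: sum.insert[OF insert.hyps])
        qed
      qed
      have "pure_tensor ?S ?G r b = (\<Sum>I\<in>?P. pure_tensor ?S ?G r (smul ?G (b I) (grass_monomial I)))"
        using ps[OF order_refl] grassmann_expand[OF b] by (simp only:)
      \<comment> \<open>\<open>F\<close> applies a parity twist, an involution, so the preimage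
        carries the same twist.\<close>
      also have "\<dots> = (\<Sum>I\<in>?P. F (\<theta> I (sg (p I) (smul R (b I) r))))"
      proof (rule sum.cong[OF refl])
        fix I assume I: "I \<in> ?P"
        have "F (\<theta> I (sg (p I) (smul R (b I) r))) = pt (smul R (b I) r) I"
          using F\<theta>[OF I Ssg[OF Ssmul[OF r]]] SC[OF Ssmul[OF r]] by (simp add: parity_map_involution)
        then show "pure_tensor ?S ?G r (smul ?G (b I) (grass_monomial I)) = F (\<theta> I (sg (p I) (smul R (b I) r)))"
          using pt_smul[OF r I] pb(4)[OF r r mono(2)[OF I] mono(2)[OF I]] by (simp add: pt_def)
      qed
      also have "\<dots> = F (\<Sum>I\<in>?P. \<theta> I (sg (p I) (smul R (b I) r)))"
        by (rule Fsum[symmetric]) (rule \<Theta>(1)[OF _ SC[OF Ssg[OF Ssmul[OF r]]]])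
      finally show ?thesis
        using carrier_sum[of ?P "\<lambda>I. \<theta> I (sg (p I) (smul R (b I) r))"] \<Theta>(1)[OF _ SC[OF Ssg[OF Ssmul[OF r]]]]
        by blast
    qed
    ultimately show ?thesis
      unfolding tensor_lcs_def by simp (rule T.span_minimal, auto)
  qed
  have base_gr: "pure_tensor ?S ?G r b \<in> gr ?T (u + v)" if "r \<in> gr ?S u" "b \<in> gr ?G v" for r b u v
  proof -
    have eq: "gr ?T (u + v) = T.span {pure_tensor ?S ?G r b |r b p q. r \<in> gr ?S p \<and> b \<in> gr ?G q \<and> p + q = u + v}"
      by (simp add: tensor_lcs_def)
    have mem: "pure_tensor ?S ?G r b \<in> {pure_tensor ?S ?G r b |r b p q. r \<in> gr ?S p \<and> b \<in> gr ?G q \<and> p + q = u + v}"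
      using that by blast
    show ?thesis unfolding eq by (rule T.span_base[OF mem])
  qed
  have Fgr: "F x \<in> gr ?T q" if x: "x \<in> gr R q" for x q
  proof -
    have xC: "x \<in> C" by (rule gr_carrier[OF x])
    have sub: "T.subspace (gr ?T q)" unfolding tensor_lcs_def by (simp add: T.subspace_span)
    have "pt (sg (p I) (c x I)) I \<in> gr ?T q" if I: "I \<in> ?P" for I
    proof -
      have "c x I \<in> gr R (p I + q)" using chom[OF I] x by (simp add: homogeneous_map_def)
      then have "sg (p I) (c x I) \<in> gr ?S (p I + q)"
        using parity_map_gr_closed Ssg[OF c(1)[OF xC I]] by simp
      from base_gr[OF this mono(1)[OF I]] show ?thesis unfolding pt_def by (simp add: add_ac)
    qed
    then show ?thesis unfolding F_def by (rule T.subspace_sum[OF sub])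
  qed
  have FD: "F (D x) = der ?T (F x)" if x: "x \<in> C" for x
  proof -
    have "der ?T (\<Sum>I\<in>Q. f I) = (\<Sum>I\<in>Q. der ?T (f I))" for Q :: "nat set set" and f
      by (auto simp: tensor_lcs_def fun_eq_iff sum_apply)
    then have "der ?T (F x) = (\<Sum>I\<in>?P. der ?T (pt (sg (p I) (c x I)) I))" unfolding F_def .
    also have "\<dots> = F (D x)"
      unfolding F_def
    proof (rule sum.cong[OF refl])
      fix I assume I: "I \<in> ?P"
      show "der ?T (pt (sg (p I) (c x I)) I) = pt (sg (p I) (c (D x) I)) I"
        unfolding pt_def cD[OF x I] D_sg[OF SC[OF c(1)[OF x I]], symmetric]
        using tensor_der_pure[OF Sl grassmann_comm_superalgebra, of "sg (p I) (c x I)" "grass_monomial I" n]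
          Ssg[OF c(1)[OF x I]] mono(2)[OF I] by simp
    qed
    finally show ?thesis ..
  qed
  have F_nprod_monomials: "F (nprod R k (\<theta> I a) (\<theta> J b)) = nprod ?T k (pt (sg (p I) a) I) (pt (sg (p J) b) J)"
    if I: "I \<in> ?P" and J: "J \<in> ?P" and a: "a \<in> S" and b: "b \<in> S" for k I J a b
  proof -
    have fin: "finite I" "finite J" using I J finite_subset by auto
    \<comment> \<open>Both operators are pulled out of the product: \<open>\<theta> I\<close> from
      the left factor without a sign, \<open>\<theta> J\<close> past \<open>a\<close>, leaving the
      twist \<open>sg (p J) a\<close>.\<close>
    define z where "z = nprod R k (sg (p J) a) b"
    have zS: "z \<in> S" unfolding z_def by (rule Sn[OF Ssg[OF a] b])
    have "nprod R k (\<theta> I a) (\<theta> J b) = \<theta> I (nprod R k a (\<theta> J b))"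
      using centroid_map_nprod_left[OF cm[OF I] SC[OF a] \<Theta>(1)[OF J SC[OF b]]] by simp
    also have "nprod R k a (\<theta> J b) = \<theta> J z"
      unfolding z_def using centroid_map_nprod[OF cmp[OF J] parity_map_closed[OF SC[OF a]] SC[OF b]] SC[OF a]
      by (simp add: parity_map_involution)
    finally have L: "nprod R k (\<theta> I a) (\<theta> J b) = \<theta> I (\<theta> J z)" .
    have Rt: "nprod ?T k (pt (sg (p I) a) I) (pt (sg (p J) b) J) =
        pure_tensor ?S ?G (nprod R k (sg (p I) a) (sg (p I) (sg (p J) b))) (mul ?G (grass_monomial I) (grass_monomial J))"
      unfolding pt_def
      using tensor_nprod_pure_parity[OF Sl grassmann_comm_superalgebra _ mono(1)[OF I] _ mono(2)[OF J],
          of "sg (p I) a" "sg (p J) b" k] Ssg a b parity_map_sub_lcs[OF Ssub Ssg[OF b]] by simp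
    show ?thesis
    proof (cases "I \<inter> J = {}")
      case True
      have IJ: "I \<union> J \<in> ?P" using I J by blast
      have pIJ: "p (I \<union> J) = p I + p J" unfolding p_def using True fin by (simp add: card_Un_disjoint)
      \<comment> \<open>As \<open>sg\<close> is an automorphism of all products, the twist that
        \<open>F\<close> applies to \<open>z\<close> distributes over the factors and reproduces the
        Koszul signs of the tensor product.\<close>
      have "sg (p I + p J) z = nprod R k (sg (p I) a) (sg (p I) (sg (p J) b))"
        unfolding z_def using SC[OF a] SC[OF b]
        by (simp add: nprod_parity_map parity_map_closed parity_map_parity_map add.assoc)
      moreover have "F (\<theta> I (\<theta> J z)) = tens_smul (grass_sign I J) (pt (sg (p I + p J) z) (I \<union> J))"
        using True prod[OF I J SC[OF zS]] Fsmul[OF \<Theta>(1)[OF IJ SC[OF zS]]] F\<theta>[OF IJ zS] pIJ by simp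
      moreover have "nprod R k (sg (p I) a) (sg (p I) (sg (p J) b)) \<in> S" by (intro Sn Ssg a b)
      ultimately show ?thesis
        unfolding L Rt using True pb(4)[OF _ _ mono(2)[OF IJ] mono(2)[OF IJ]]
        by (simp add: grass_monomial_mul[OF fin] pt_def)
    next
      case False
      have zn: "nprod R k (sg (p I) a) (sg (p I) (sg (p J) b)) \<in> S" by (intro Sn Ssg a b)
      have "pure_tensor ?S ?G (nprod R k (sg (p I) a) (sg (p I) (sg (p J) b))) 0 = 0"
        using pb(4)[OF zn zn G.carrier_zero G.carrier_zero, of 0] by simp
      then show ?thesis unfolding L Rt using False prod[OF I J SC[OF zS]] F0
        by (simp add: grass_monomial_mul[OF fin])
    qed
  qed
  have Fn: "F (nprod R k x y) = nprod ?T k (F x) (F y)" if x: "x \<in> C" and y: "y \<in> C" for k x y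
  proof -
    have \<theta>x: "\<theta> I (c x I) \<in> C" if "I \<in> ?P" for I using \<Theta>(1)[OF that SC[OF c(1)[OF x that]]] .
    have \<theta>y: "\<theta> I (c y I) \<in> C" if "I \<in> ?P" for I using \<Theta>(1)[OF that SC[OF c(1)[OF y that]]] .
    have "nprod R k x y = nprod R k (\<Sum>I\<in>?P. \<theta> I (c x I)) y" using c(2)[OF x] by simp
    also have "\<dots> = (\<Sum>I\<in>?P. nprod R k (\<theta> I (c x I)) y)"
      by (rule linear_sum[OF nprod_linear_left[OF y]]) (rule \<theta>x)
    also have "\<dots> = (\<Sum>I\<in>?P. \<Sum>J\<in>?P. nprod R k (\<theta> I (c x I)) (\<theta> J (c y J)))"
    proof (rule sum.cong[OF refl])
      fix I assume I: "I \<in> ?P"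
      have "nprod R k (\<theta> I (c x I)) y = nprod R k (\<theta> I (c x I)) (\<Sum>J\<in>?P. \<theta> J (c y J))" using c(2)[OF y] by simp
      also have "\<dots> = (\<Sum>J\<in>?P. nprod R k (\<theta> I (c x I)) (\<theta> J (c y J)))"
        by (rule linear_sum[OF nprod_linear_right[OF \<theta>x[OF I]]]) (rule \<theta>y)
      finally show "nprod R k (\<theta> I (c x I)) y = (\<Sum>J\<in>?P. nprod R k (\<theta> I (c x I)) (\<theta> J (c y J)))" .
    qed
    finally have "F (nprod R k x y) = F (\<Sum>I\<in>?P. \<Sum>J\<in>?P. nprod R k (\<theta> I (c x I)) (\<theta> J (c y J)))" by simp
    also have "\<dots> = (\<Sum>I\<in>?P. F (\<Sum>J\<in>?P. nprod R k (\<theta> I (c x I)) (\<theta> J (c y J))))"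
      by (rule Fsum) (intro carrier_sum nprod_closed \<theta>x \<theta>y)
    also have "\<dots> = (\<Sum>I\<in>?P. \<Sum>J\<in>?P. F (nprod R k (\<theta> I (c x I)) (\<theta> J (c y J))))"
      by (rule sum.cong[OF refl], rule Fsum) (intro nprod_closed \<theta>x \<theta>y)
    also have "\<dots> = (\<Sum>I\<in>?P. \<Sum>J\<in>?P. nprod ?T k (pt (sg (p I) (c x I)) I) (pt (sg (p J) (c y J)) J))"
      by (intro sum.cong[OF refl] F_nprod_monomials c(1) x y)
    also have "\<dots> = (\<Sum>I\<in>?P. nprod ?T k (pt (sg (p I) (c x I)) I) (F y))"
    proof (rule sum.cong[OF refl])
      fix I assume I: "I \<in> ?P"
      show "(\<Sum>J\<in>?P. nprod ?T k (pt (sg (p I) (c x I)) I) (pt (sg (p J) (c y J)) J)) =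
          nprod ?T k (pt (sg (p I) (c x I)) I) (F y)"
        unfolding F_def pt_def
        by (rule tensor_nprod_pure_sum[OF Sl grassmann_comm_superalgebra, symmetric])
          (use Ssg c(1)[OF x I] c(1)[OF y] mono(2) I in auto)
    qed
    also have "\<dots> = nprod ?T k (F x) (F y)"
      unfolding F_def[of x] by (rule tensor_nprod_sum_left[symmetric])
    finally show ?thesis .
  qed
  have "lcs_iso R ?T F"
    unfolding lcs_iso_def linear_map_def smulT bij_betw_def
    using Fcar Fadd Fsmul inj surj Fgr FD Fn by blast
  then show ?thesis unfolding lcs_isomorphic_def by blast
qed

text \<open>The witness \<open>S\<close> is cut out of \<open>R\<close> itself by successive kernels
  of odd derivations, so it lives on the same type.\<close>

theorem theorem2p1:
  fixes R :: "('a::ab_group_add) lcs"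
  assumes "lie_conformal_superalgebra R"
    and "finite_lcs R"
    and "\<not> abelian R"
    and "differentiably_simple R"
  shows "\<exists>(S :: 'a lcs) (n :: nat).
    lie_conformal_superalgebra S \<and> simple_lcs S \<and>
    lcs_isomorphic R (tensor_lcs S (grassmann n))"
proof -
  interpret lie_conformal_superalgebra R by (rule assms(1))
  obtain b where b: "rank_le R b C" using finite_rank[OF assms(2)] by blast
  have "derivation_simple_lcs R"
    by unfold_locales (use differentiably_simple_imp_derivation_simple[OF assms(4)] assms(3) b in blast)+
  then obtain n S \<theta> where dec: "grassmann_decomposition R n S \<theta>"
    using exists_grassmann_decomposition[OF _ b] by blast
  then have "lie_conformal_superalgebra (sub_lcs R S)" "simple_lcs (sub_lcs R S)"
    by (simp_all add: grassmann_decomposition_def)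
  moreover have "lcs_isomorphic R (tensor_lcs (sub_lcs R S) (grassmann n))"
    by (rule grassmann_decomposition_isomorphic[OF assms(1) dec])
  ultimately show ?thesis by blast
qed

end
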